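(* Let $f\in\bigcap_{n\ge 0}H^n(\mathbb{R}^3)$ be a real vector field with $\nabla\cdot f=0$, and let $u(\cdot,t)$, $0\le t<T_f$, be the maximal classical solution of the 3D incompressible Navier–Stokes equations with initial state $f$. Let $0<T\le T_f$, $T<\infty$, and assume that $$\sup_{0\le t<T}\|u(\cdot,t)\|_\infty=:M<\infty .$$ Then each function $J_n(t)$, $n=1,2,\dots$, is bounded in $0\le t<T$ by some quantity $K_n>0$ depending only on $n$, $M$, $T$ and $\|f\|_{H^n}$, that is, $K_n=K(n,M,T,\|f\|_{H^n})$.
   Context: Navier–Stokes Cauchy problem on $\mathbb{R}^3$: $u_t+u\cdot\nabla u+\nabla p=\Delta u$, $\nabla\cdot u=0$, $u(x,0)=f(x)$. Standing assumption: $f=(f_1,f_2,f_3)\in H^n(\mathbb{R}^3)$ for all $n$ and $\nabla\cdot f=0$. With the pressure normalized by $p(x,t)\to0$ as $|x|\to\infty$, there is a unique $C^\infty$ solution $(u,p)$ with $D^\alpha u(\cdot,t)\in L^2(\mathbb{R}^3)$ for all multi-indices $\alpha$ and all $0\le t<T_f$, where $[0,T_f)$, $0<T_f\le\infty$, is its maximal interval of existence. Notation: $\|u(\cdot,t)\|_\infty=\sup\{|u_i(x,t)|:x\in\mathbb{R}^3,\ 1\le i\le3\}$; $\|v\|^2=\sum_{i=1}^3\int_{\mathbb{R}^3}|v_i|^2dx$; $J_n(t)\ge0$ is defined by $J_n^2(t)=\sum_{|\alpha|=n}\|D^\alpha u(\cdot,t)\|^2$. *)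

theory Defs
  imports "HOL-Analysis.Analysis"
begin

section \<open>Classical derivatives\<close>

definition partial :: "3 \<Rightarrow> (real^3 \<Rightarrow> 'b::real_normed_vector) \<Rightarrow> real^3 \<Rightarrow> 'b" where
  "partial i g x = vector_derivative (\<lambda>s. g (x + s *\<^sub>R axis i 1)) (at 0)"

type_synonym multi_index = "nat^3"

definition mlen :: "multi_index \<Rightarrow> nat" where
  "mlen \<alpha> = (\<Sum>i\<in>UNIV. \<alpha> $ i)"

definition Dm :: "multi_index \<Rightarrow> (real^3 \<Rightarrow> 'b::real_normed_vector) \<Rightarrow> real^3 \<Rightarrow> 'b" where
  "Dm \<alpha> g = (partial 1 ^^ (\<alpha> $ 1)) ((partial 2 ^^ (\<alpha> $ 2)) ((partial 3 ^^ (\<alpha> $ 3)) g))"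

definition grad :: "(real^3 \<Rightarrow> real) \<Rightarrow> real^3 \<Rightarrow> real^3" where
  "grad q x = (\<chi> i. partial i q x)"

definition divergence :: "(real^3 \<Rightarrow> real^3) \<Rightarrow> real^3 \<Rightarrow> real" where
  "divergence v x = (\<Sum>i\<in>UNIV. partial i v x $ i)"

definition laplacian :: "(real^3 \<Rightarrow> real^3) \<Rightarrow> real^3 \<Rightarrow> real^3" where
  "laplacian v x = (\<Sum>i\<in>UNIV. partial i (partial i v) x)"

definition advect :: "(real^3 \<Rightarrow> real^3) \<Rightarrow> (real^3 \<Rightarrow> real^3) \<Rightarrow> real^3 \<Rightarrow> real^3" where
  "advect w v x = (\<Sum>j\<in>UNIV. w x $ j *\<^sub>R partial j v x)"

text \<open>Derivatives are taken within \<open>S\<close>, so that they are one-sided at boundary points of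
  \<open>S\<close>.  The definition is meant for convex \<open>S\<close> with nonempty interior, where the derivative
  within \<open>S\<close> is unique; below \<open>S\<close> is the whole space or \<open>[0,T) \<times> \<real>\<^sup>3\<close>.\<close>

primrec C_k_on :: "nat \<Rightarrow> 'a::real_normed_vector set \<Rightarrow> ('a \<Rightarrow> 'b::real_normed_vector) \<Rightarrow> bool" where
  "C_k_on 0 S f \<longleftrightarrow> continuous_on S f"
| "C_k_on (Suc k) S f \<longleftrightarrow>
     (\<exists>f'. (\<forall>x\<in>S. (f has_derivative f' x) (at x within S)) \<and> (\<forall>h. C_k_on k S (\<lambda>x. f' x h)))"

definition C_infinity_on :: "'a::real_normed_vector set \<Rightarrow> ('a \<Rightarrow> 'b::real_normed_vector) \<Rightarrow> bool" where
  "C_infinity_on S f \<longleftrightarrow> (\<forall>k. C_k_on k S f)"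


section \<open>Norms and Sobolev spaces\<close>

definition L2 :: "(real^3 \<Rightarrow> real) \<Rightarrow> bool" where
  "L2 g \<longleftrightarrow> g \<in> borel_measurable lebesgue \<and> integrable lebesgue (\<lambda>x. (g x)\<^sup>2)"

definition L2_norm_sq :: "(real^3 \<Rightarrow> real^3) \<Rightarrow> real" where
  "L2_norm_sq v = (\<Sum>i\<in>UNIV. \<integral>x. \<bar>v x $ i\<bar>\<^sup>2 \<partial>lebesgue)"

text \<open>The maximum norm is extended-real valued, so that it is meaningful for unbounded fields.\<close>

definition max_norm :: "(real^3 \<Rightarrow> real^3) \<Rightarrow> ereal" where
  "max_norm v = (SUP x. SUP i. ereal \<bar>v x $ i\<bar>)"

definition J :: "nat \<Rightarrow> (real^3 \<Rightarrow> real^3) \<Rightarrow> real" where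
  "J n v = sqrt (\<Sum>\<alpha> | mlen \<alpha> = n. L2_norm_sq (Dm \<alpha> v))"

definition test_function :: "(real^3 \<Rightarrow> real) \<Rightarrow> bool" where
  "test_function \<phi> \<longleftrightarrow> C_infinity_on UNIV \<phi> \<and> compact (closure {x. \<phi> x \<noteq> 0})"

definition is_weak_D :: "multi_index \<Rightarrow> (real^3 \<Rightarrow> real) \<Rightarrow> (real^3 \<Rightarrow> real) \<Rightarrow> bool" where
  "is_weak_D \<alpha> g h \<longleftrightarrow> L2 h \<and>
     (\<forall>\<phi>. test_function \<phi> \<longrightarrow>
        (\<integral>x. g x * Dm \<alpha> \<phi> x \<partial>lebesgue) = (- 1) ^ mlen \<alpha> * (\<integral>x. h x * \<phi> x \<partial>lebesgue))"

text \<open>A representative of the weak derivative, which is unique up to null sets if it exists.\<close>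

definition weak_D :: "multi_index \<Rightarrow> (real^3 \<Rightarrow> real) \<Rightarrow> real^3 \<Rightarrow> real" where
  "weak_D \<alpha> g = (SOME h. is_weak_D \<alpha> g h)"

definition in_H :: "nat \<Rightarrow> (real^3 \<Rightarrow> real^3) \<Rightarrow> bool" where
  "in_H n f \<longleftrightarrow> (\<forall>i. L2 (\<lambda>x. f x $ i) \<and>
     (\<forall>\<alpha>. mlen \<alpha> \<le> n \<longrightarrow> (\<exists>h. is_weak_D \<alpha> (\<lambda>x. f x $ i) h)))"

definition H_norm :: "nat \<Rightarrow> (real^3 \<Rightarrow> real^3) \<Rightarrow> real" where
  "H_norm n f = sqrt (\<Sum>\<alpha> | mlen \<alpha> \<le> n. L2_norm_sq (\<lambda>x. \<chi> i. weak_D \<alpha> (\<lambda>y. f y $ i) x))"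

definition weakly_div_free :: "(real^3 \<Rightarrow> real^3) \<Rightarrow> bool" where
  "weakly_div_free f \<longleftrightarrow>
     (AE x in lebesgue. (\<Sum>i\<in>UNIV. weak_D (axis i 1) (\<lambda>y. f y $ i) x) = 0)"


section \<open>The Navier--Stokes Cauchy problem\<close>

definition time_interval :: "ereal \<Rightarrow> real set" where
  "time_interval T = {t. 0 \<le> t \<and> ereal t < T}"

text \<open>The initial state \<open>f\<close> is an element of \<open>H\<^sup>n\<close>, hence only determined up to null sets;
  the initial condition says that the smooth field \<open>u 0\<close> represents \<open>f\<close>.\<close>

definition NS_solution ::
  "(real^3 \<Rightarrow> real^3) \<Rightarrow> ereal \<Rightarrow> (real \<Rightarrow> real^3 \<Rightarrow> real^3) \<Rightarrow> (real \<Rightarrow> real^3 \<Rightarrow> real) \<Rightarrow> bool" where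
  "NS_solution f T u p \<longleftrightarrow>
     C_infinity_on (time_interval T \<times> UNIV) (\<lambda>(t, x). u t x) \<and>
     C_infinity_on (time_interval T \<times> UNIV) (\<lambda>(t, x). p t x) \<and>
     (\<forall>t\<in>time_interval T. \<forall>x.
        vector_derivative (\<lambda>s. u s x) (at t within time_interval T)
          + advect (u t) (u t) x + grad (p t) x = laplacian (u t) x \<and>
        divergence (u t) x = 0) \<and>
     (AE x in lebesgue. u 0 x = f x) \<and>
     (\<forall>t\<in>time_interval T. (p t \<longlongrightarrow> 0) at_infinity) \<and>
     (\<forall>t\<in>time_interval T. \<forall>\<alpha> i. L2 (\<lambda>x. Dm \<alpha> (u t) x $ i))"

definition maximal_NS_solution ::
  "(real^3 \<Rightarrow> real^3) \<Rightarrow> ereal \<Rightarrow> (real \<Rightarrow> real^3 \<Rightarrow> real^3) \<Rightarrow> (real \<Rightarrow> real^3 \<Rightarrow> real) \<Rightarrow> bool" where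
  "maximal_NS_solution f Tf u p \<longleftrightarrow> 0 < Tf \<and> NS_solution f Tf u p \<and>
     \<not> (\<exists>T' u' p'. Tf < T' \<and> NS_solution f T' u' p' \<and> (\<forall>t\<in>time_interval Tf. u' t = u t))"

end

theory Submission
  imports Defs
begin

text \<open>
  The hypothesis gives \<open>L\<^sup>2\<close> bounds only at each separate time, with no uniformity, so all energy
  estimates are made with spatial cut-offs and must not involve the nonlocal pressure.  This is
  possible for the antisymmetric gradient \<open>A\<^sub>i\<^sub>j = \<partial>\<^sub>i u\<^sub>j - \<partial>\<^sub>j u\<^sub>i\<close>, which satisfies
  \<open>\<partial>\<^sub>t A\<^sub>i\<^sub>j = \<Delta> A\<^sub>i\<^sub>j - \<partial>\<^sub>i G\<^sub>j + \<partial>\<^sub>j G\<^sub>i\<close> with \<open>G\<^sub>j = \<Sum>\<^sub>k u\<^sub>k A\<^sub>k\<^sub>j\<close>.  With \<open>\<bar>u\<bar> \<le> M\<close> the local energy of \<open>A\<close> obeys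
  a Gronwall inequality whose cut-off error is again controlled by \<open>M\<close> and the dissipation; this
  bounds \<open>J\<^sub>1\<close> and the time integral of \<open>J\<^sub>2\<^sup>2\<close>.  Inductively, if \<open>J\<^sub>1, \<dots>, J\<^bsub>n-1\<^esub>\<close> and the time
  integral of \<open>J\<^sub>n\<^sup>2\<close> are bounded, then the derivatives of \<open>G\<close> of order \<open>n - 1\<close> have squared norm at most
  \<open>C (1 + J\<^sub>n\<^sup>2)\<close>, by \<open>\<integral> \<bar>D u\<bar>\<^sup>4 \<le> C M\<^sup>2 (J\<^sub>1\<^sup>2 + J\<^sub>2\<^sup>2)\<close> for \<open>n = 2\<close> and Ladyzhenskaya's inequality for
  \<open>n \<ge> 3\<close>.  This is integrable in time, which bounds \<open>J\<^sub>n\<close> and the time integral of \<open>J\<^bsub>n+1\<^esub>\<^sup>2\<close>.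
  Incompressibility enters only through \<open>\<parallel>\<nabla>u\<parallel> \<le> \<parallel>A\<parallel>\<close>, and at time 0 testing the weak derivatives of \<open>f\<close>
  with cut-offs of the classical ones gives \<open>J\<^sub>n \<le> C \<parallel>f\<parallel>\<close> in terms of the \<open>H\<^sup>n\<close> norm.
\<close>

section \<open>Smooth functions\<close>

text \<open>The kinetic energy of \<open>u\<close> is avoided altogether: localised, it would bring
  in the product of the pressure with \<open>u\<close>, and no integrability of the pressure is
  assumed. The estimates therefore begin with one derivative, where no earlier dissipation can be
  drawn on. The cut-off error there is the integral of |grad phi|^2 A^2, and a bound on the full L^2
  norm of A uniform in time is just what is missing. Two devices deal with it. The weight is the
  fourth power of a cut-off c of radius R, so that |grad c^2|^2 still carries a factor c^2 / R^2;
  and one factor of A^2 is written as a difference of derivatives of \<open>u\<close> and integrated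
  by parts. This leaves half of the dissipation plus a constant uniform in R >= 1. From order two on
  the error is harmless, because the quantity being differentiated is itself known to be integrable
  in time. On each level all bounds are independent of R, and the radius goes to infinity only after
  the integration in time.\<close>

lemma C_k_on_cong:
  assumes "\<And>x. x \<in> S \<Longrightarrow> f x = g x"
  shows "C_k_on k S f \<Longrightarrow> C_k_on k S g"
proof (cases k)
  case 0
  then show "C_k_on k S f \<Longrightarrow> C_k_on k S g"
    using assms continuous_on_cong by (metis C_k_on.simps(1))
next
  case (Suc m)
  assume "C_k_on k S f"
  with Suc obtain f' where f': "\<forall>x\<in>S. (f has_derivative f' x) (at x within S)"
    "\<forall>h. C_k_on m S (\<lambda>x. f' x h)" by auto
  have "(g has_derivative f' x) (at x within S)" if "x \<in> S" for x
    using has_derivative_transform[OF that, of g f] f' assms that by metis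
  then show "C_k_on k S g" using f' Suc by auto
qed

lemma C_k_on_subset: "C_k_on k S f \<Longrightarrow> T \<subseteq> S \<Longrightarrow> C_k_on k T f"
proof (induction k arbitrary: f)
  case 0
  then show ?case using continuous_on_subset by auto
next
  case (Suc k)
  then show ?case by simp (meson has_derivative_subset subsetD)
qed

lemma C_k_on_Suc_imp: "C_k_on (Suc k) S f \<Longrightarrow> C_k_on k S f"
proof (induction k arbitrary: f)
  case 0
  then show ?case
    by (metis C_k_on.simps has_derivative_continuous_on)
next
  case (Suc k)
  from Suc.prems obtain f' where f': "\<forall>x\<in>S. (f has_derivative f' x) (at x within S)"
    "\<And>h. C_k_on (Suc k) S (\<lambda>x. f' x h)" by (subst (asm) C_k_on.simps(2)) blast
  then show ?case using Suc.IH[OF f'(2)] by auto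
qed

lemma C_k_on_const: "C_k_on k S (\<lambda>x. c)"
proof (induction k arbitrary: c)
  case (Suc k)
  have "\<forall>x\<in>S. ((\<lambda>x. c) has_derivative (\<lambda>h. 0)) (at x within S)" by simp
  then show ?case using Suc by (auto intro!: exI[of _ "\<lambda>x h. 0"])
qed simp

lemma C_k_on_linear:
  assumes "bounded_linear L"
  shows "C_k_on k S f \<Longrightarrow> C_k_on k S (\<lambda>x. L (f x))"
proof (induction k arbitrary: f)
  case 0
  then show ?case using bounded_linear.continuous_on[OF assms] by auto
next
  case (Suc k)
  from Suc.prems obtain f' where f': "\<forall>x\<in>S. (f has_derivative f' x) (at x within S)"
    "\<And>h. C_k_on k S (\<lambda>x. f' x h)" by auto
  have "\<forall>x\<in>S. ((\<lambda>x. L (f x)) has_derivative (\<lambda>h. L (f' x h))) (at x within S)"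
    using bounded_linear.has_derivative[OF assms f'(1)[rule_format]] by blast
  moreover have "\<forall>h. C_k_on k S (\<lambda>x. L (f' x h))" using f' Suc.IH by blast
  ultimately show ?case unfolding C_k_on.simps(2) by (intro exI[of _ "\<lambda>x h. L (f' x h)"]) simp
qed

lemma C_k_on_add:
  "C_k_on k S f \<Longrightarrow> C_k_on k S g \<Longrightarrow> C_k_on k S (\<lambda>x. f x + g x)"
proof (induction k arbitrary: f g)
  case 0
  then show ?case by (auto intro!: continuous_intros)
next
  case (Suc k)
  from Suc.prems obtain f' where f': "\<forall>x\<in>S. (f has_derivative f' x) (at x within S)"
    "\<And>h. C_k_on k S (\<lambda>x. f' x h)" by auto
  from Suc.prems obtain g' where g': "\<forall>x\<in>S. (g has_derivative g' x) (at x within S)"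
    "\<And>h. C_k_on k S (\<lambda>x. g' x h)" by auto
  have "\<forall>x\<in>S. ((\<lambda>x. f x + g x) has_derivative (\<lambda>h. f' x h + g' x h)) (at x within S)"
    by (intro ballI has_derivative_add f'(1)[rule_format] g'(1)[rule_format])
  moreover have "\<forall>h. C_k_on k S (\<lambda>x. f' x h + g' x h)" by (intro allI Suc.IH f' g')
  ultimately show ?case unfolding C_k_on.simps(2) by (intro exI[of _ "\<lambda>x h. f' x h + g' x h"]) simp
qed

lemma C_k_on_mult:
  fixes f g :: "'a::real_normed_vector \<Rightarrow> real"
  shows "C_k_on k S f \<Longrightarrow> C_k_on k S g \<Longrightarrow> C_k_on k S (\<lambda>x. f x * g x)"
proof (induction k arbitrary: f g)
  case 0
  then show ?case by (auto intro!: continuous_intros)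
next
  case (Suc k)
  note lower = C_k_on_Suc_imp[OF Suc.prems(1)] C_k_on_Suc_imp[OF Suc.prems(2)]
  from Suc.prems obtain f' where f': "\<forall>x\<in>S. (f has_derivative f' x) (at x within S)"
    "\<And>h. C_k_on k S (\<lambda>x. f' x h)" by auto
  from Suc.prems obtain g' where g': "\<forall>x\<in>S. (g has_derivative g' x) (at x within S)"
    "\<And>h. C_k_on k S (\<lambda>x. g' x h)" by auto
  have "\<forall>x\<in>S. ((\<lambda>x. f x * g x) has_derivative (\<lambda>h. f x * g' x h + f' x h * g x)) (at x within S)"
    by (intro ballI has_derivative_mult f'(1)[rule_format] g'(1)[rule_format])
  moreover have "\<forall>h. C_k_on k S (\<lambda>x. f x * g' x h + f' x h * g x)"
    by (intro allI C_k_on_add Suc.IH lower f' g')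
  ultimately show ?case unfolding C_k_on.simps(2) by (intro exI[of _ "\<lambda>x h. f x * g' x h + f' x h * g x"]) simp
qed

text \<open>The induction varies only \<open>g\<close>: the derivative of the composition is a
  derivative of \<open>g\<close>, composed with the same \<open>f\<close>, times a directional
  derivative of \<open>f\<close>.\<close>

lemma C_k_on_compose_real:
  fixes f :: "'a::real_normed_vector \<Rightarrow> real" and g :: "real \<Rightarrow> real"
  shows "C_k_on k UNIV g \<Longrightarrow> C_k_on k S f \<Longrightarrow> C_k_on k S (\<lambda>x. g (f x))"
proof (induction k arbitrary: g)
  case 0
  then show ?case using continuous_on_compose2[of UNIV g S f] by auto
next
  case (Suc k)
  note lower = C_k_on_Suc_imp[OF Suc.prems(2)]
  from Suc.prems obtain f' where f': "\<forall>x\<in>S. (f has_derivative f' x) (at x within S)"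
    "\<And>h. C_k_on k S (\<lambda>x. f' x h)" by auto
  from Suc.prems obtain g' where g': "\<And>x. (g has_derivative g' x) (at x)"
    "\<And>h. C_k_on k UNIV (\<lambda>x. g' x h)" by auto
  \<comment> \<open>A linear map of the reals is multiplication by its value at 1; this puts the
    chain rule into product form, ready for \<open>C_k_on_mult\<close>.\<close>
  have lin: "g' y h = g' y 1 * h" for y h
    using linear_cmul[OF has_derivative_linear[OF g'(1)[of y]], of h 1] by (simp add: mult.commute)
  have "((\<lambda>x. g (f x)) has_derivative (\<lambda>h. g' (f x) 1 * f' x h)) (at x within S)" if "x \<in> S" for x
  proof -
    have "(\<lambda>h. g' (f x) (f' x h)) = (\<lambda>h. g' (f x) 1 * f' x h)" by (intro ext lin)
    then show ?thesis using has_derivative_compose[OF f'(1)[rule_format, OF that] g'(1)[of "f x"]] by simp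
  qed
  moreover have "\<forall>h. C_k_on k S (\<lambda>x. g' (f x) 1 * f' x h)"
    by (intro allI C_k_on_mult Suc.IH[OF g'(2) lower] f')
  ultimately show ?case unfolding C_k_on.simps(2) by (intro exI[of _ "\<lambda>x h. g' (f x) 1 * f' x h"]) simp
qed

text \<open>Serves both to freeze the time in a function on space-time and to rescale the bump
  function.\<close>

lemma C_k_on_affine:
  fixes F :: "'a::real_normed_vector \<Rightarrow> 'b::real_normed_vector"
  assumes L: "bounded_linear L" and T: "\<And>x. x \<in> T \<Longrightarrow> c + L x \<in> S"
  shows "C_k_on k S F \<Longrightarrow> C_k_on k T (\<lambda>x. F (c + L x))"
proof (induction k arbitrary: F)
  case 0
  have "continuous_on T (\<lambda>x. c + L x)"
    using bounded_linear.continuous_on[OF L] by (auto intro!: continuous_intros)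
  moreover have "(\<lambda>x. c + L x) ` T \<subseteq> S" using T by blast
  ultimately have "continuous_on T (\<lambda>x. F (c + L x))"
    using continuous_on_compose2 0 by (metis C_k_on.simps(1))
  then show ?case by (simp only: C_k_on.simps(1))
next
  case (Suc k)
  from Suc.prems obtain f' where f': "\<forall>x\<in>S. (F has_derivative f' x) (at x within S)"
    "\<And>h. C_k_on k S (\<lambda>x. f' x h)" by auto
  have "((\<lambda>x. F (c + L x)) has_derivative (\<lambda>h. f' (c + L x) (L h))) (at x within T)" if "x \<in> T" for x
  proof (rule has_derivative_in_compose2[where t=S])
    show "\<And>x. x \<in> S \<Longrightarrow> (F has_derivative f' x) (at x within S)" using f' by auto
    show "((\<lambda>x. c + L x) has_derivative L) (at x within T)"
      using has_derivative_add[OF has_derivative_const bounded_linear_imp_has_derivative[OF L]] by simp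
    show "(\<lambda>x. c + L x) ` T \<subseteq> S" using T by blast
  qed (use that in simp)
  moreover have "\<forall>h. C_k_on k T (\<lambda>x. f' (c + L x) (L h))" using Suc.IH[OF f'(2)] by blast
  ultimately show ?case unfolding C_k_on.simps(2)
    by (intro exI[of _ "\<lambda>x h. f' (c + L x) (L h)"] conjI ballI)
qed

lemma C_infinity_on_subset: "C_infinity_on S f \<Longrightarrow> T \<subseteq> S \<Longrightarrow> C_infinity_on T f"
  unfolding C_infinity_on_def using C_k_on_subset[of _ S f T] by simp

lemma C_infinity_on_linear: "bounded_linear L \<Longrightarrow> C_infinity_on S f \<Longrightarrow> C_infinity_on S (\<lambda>x. L (f x))"
  by (simp add: C_infinity_on_def C_k_on_linear)

lemma C_infinity_on_affine:
  "bounded_linear L \<Longrightarrow> (\<And>x. x \<in> T \<Longrightarrow> c + L x \<in> S) \<Longrightarrow> C_infinity_on S F \<Longrightarrow>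
    C_infinity_on T (\<lambda>x. F (c + L x))"
  unfolding C_infinity_on_def using C_k_on_affine[of L T c S _ F] by simp

lemma C_infinity_on_compose_real:
  fixes f :: "'a::real_normed_vector \<Rightarrow> real" and g :: "real \<Rightarrow> real"
  shows "C_infinity_on UNIV g \<Longrightarrow> C_infinity_on S f \<Longrightarrow> C_infinity_on S (\<lambda>x. g (f x))"
  by (simp add: C_infinity_on_def C_k_on_compose_real)

section \<open>Algebra of smooth functions\<close>

named_theorems smooth_intros

lemma C_infinity_on_const [smooth_intros]: "C_infinity_on S (\<lambda>x. c)"
  by (simp add: C_infinity_on_def C_k_on_const)

lemma C_infinity_on_add [smooth_intros]:
  "C_infinity_on S f \<Longrightarrow> C_infinity_on S g \<Longrightarrow> C_infinity_on S (\<lambda>x. f x + g x)"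
  by (simp add: C_infinity_on_def C_k_on_add)

lemma C_infinity_on_mult [smooth_intros]:
  fixes f g :: "'a::real_normed_vector \<Rightarrow> real"
  shows "C_infinity_on S f \<Longrightarrow> C_infinity_on S g \<Longrightarrow> C_infinity_on S (\<lambda>x. f x * g x)"
  by (simp add: C_infinity_on_def C_k_on_mult)

lemma C_infinity_on_uminus [smooth_intros]: "C_infinity_on S f \<Longrightarrow> C_infinity_on S (\<lambda>x. - f x)"
  using C_infinity_on_linear[OF bounded_linear_minus[OF bounded_linear_ident], of S f] by simp

lemma C_infinity_on_diff [smooth_intros]:
  "C_infinity_on S f \<Longrightarrow> C_infinity_on S g \<Longrightarrow> C_infinity_on S (\<lambda>x. f x - g x)"
  using C_infinity_on_add[of S f "\<lambda>x. - g x"] C_infinity_on_uminus by fastforce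

lemma C_infinity_on_sum [smooth_intros]:
  "(\<And>i. i \<in> I \<Longrightarrow> C_infinity_on S (f i)) \<Longrightarrow> C_infinity_on S (\<lambda>x. \<Sum>i\<in>I. f i x)"
  by (induction I rule: infinite_finite_induct) (auto intro!: smooth_intros)

lemma C_infinity_on_power [smooth_intros]:
  fixes f :: "'a::real_normed_vector \<Rightarrow> real"
  shows "C_infinity_on S f \<Longrightarrow> C_infinity_on S (\<lambda>x. f x ^ n)"
  by (induction n) (auto intro!: smooth_intros)

lemma C_infinity_on_imp_continuous_on: "C_infinity_on S f \<Longrightarrow> continuous_on S f"
  unfolding C_infinity_on_def by (metis C_k_on.simps(1))

lemma C_infinity_on_imp_differentiable:
  assumes "C_infinity_on S f"
  obtains f' where "\<And>x. x \<in> S \<Longrightarrow> (f has_derivative f' x) (at x within S)"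
proof -
  have "C_k_on (Suc 0) S f" using assms unfolding C_infinity_on_def by blast
  then show ?thesis using that by auto
qed

text \<open>\<open>C_k_on\<close> may provide a different derivative for every k. Since every
  derivative of \<open>f\<close> is required to take the value \<open>D x\<close>, one fixed
  function \<open>D\<close> serves all k at once.\<close>

lemma C_infinity_on_directional:
  assumes "C_infinity_on S f"
    and D: "\<And>x f'. x \<in> S \<Longrightarrow> (f has_derivative f') (at x within S) \<Longrightarrow> f' h = D x"
  shows "C_infinity_on S D"
  unfolding C_infinity_on_def
proof
  fix k
  have "C_k_on (Suc k) S f" using assms unfolding C_infinity_on_def by blast
  then obtain f' where f': "\<forall>x\<in>S. (f has_derivative f' x) (at x within S)"
    "\<forall>h. C_k_on k S (\<lambda>x. f' x h)" by auto
  show "C_k_on k S D"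
    by (rule C_k_on_cong[OF _ f'(2)[rule_format, of h]]) (use D f' in auto)
qed

section \<open>Partial derivatives\<close>

lemma has_derivative_imp_partial:
  assumes "(g has_derivative g') (at x)"
  shows "partial i g x = g' (axis i 1)"
    and "((\<lambda>s. g (x + s *\<^sub>R axis i 1)) has_vector_derivative partial i g x) (at 0)"
proof -
  have lin: "linear g'" using assms has_derivative_linear by blast
  have "((\<lambda>s::real. x + s *\<^sub>R axis i 1) has_derivative (\<lambda>s. s *\<^sub>R axis i 1)) (at 0)"
    by (auto intro!: derivative_eq_intros)
  moreover have "(g has_derivative g') (at (x + (0::real) *\<^sub>R axis i 1))" using assms by simp
  ultimately have "((\<lambda>s. g (x + s *\<^sub>R axis i 1)) has_derivative (\<lambda>s. g' (s *\<^sub>R axis i 1))) (at 0)"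
    using has_derivative_compose by blast
  then have v: "((\<lambda>s. g (x + s *\<^sub>R axis i 1)) has_vector_derivative g' (axis i 1)) (at 0)"
    unfolding has_vector_derivative_def by (simp add: linear_cmul[OF lin])
  then show *: "partial i g x = g' (axis i 1)"
    unfolding partial_def using vector_derivative_at by blast
  show "((\<lambda>s. g (x + s *\<^sub>R axis i 1)) has_vector_derivative partial i g x) (at 0)"
    unfolding * using v .
qed

abbreviation smooth :: "(real^3 \<Rightarrow> 'b::real_normed_vector) \<Rightarrow> bool" where
  "smooth g \<equiv> C_infinity_on UNIV g"

lemma smooth_partial [smooth_intros]: "smooth g \<Longrightarrow> smooth (partial i g)"
  by (rule C_infinity_on_directional[where h = "axis i 1"]) (simp_all, metis has_derivative_imp_partial(1))

lemma smooth_has_partial: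
  assumes "smooth g"
  shows "((\<lambda>s. g (x + s *\<^sub>R axis i 1)) has_vector_derivative partial i g (x + s *\<^sub>R axis i 1)) (at s)"
proof -
  obtain g' where "\<And>x. (g has_derivative g' x) (at x)"
    using C_infinity_on_imp_differentiable[OF assms] by auto
  then have "((\<lambda>r. g ((x + s *\<^sub>R axis i 1) + r *\<^sub>R axis i 1)) has_vector_derivative
      partial i g (x + s *\<^sub>R axis i 1)) (at 0)"
    using has_derivative_imp_partial(2) by blast
  then have "(((\<lambda>r. g ((x + s *\<^sub>R axis i 1) + r *\<^sub>R axis i 1)) \<circ> (\<lambda>r. r - s)) has_vector_derivative
      1 *\<^sub>R partial i g (x + s *\<^sub>R axis i 1)) (at s)"
    by (intro vector_diff_chain_at) (auto intro!: derivative_eq_intros)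
  then show ?thesis by (simp add: o_def algebra_simps)
qed

lemma smooth_imp_differentiable:
  assumes "smooth g" shows "g differentiable (at x)"
  using C_infinity_on_imp_differentiable[OF assms] unfolding differentiable_def by auto

lemma partial_has_real_derivative:
  fixes g :: "real^3 \<Rightarrow> real"
  assumes "smooth g"
  shows "((\<lambda>s. g (x + s *\<^sub>R axis i 1)) has_real_derivative partial i g x) (at 0)"
  using smooth_has_partial[OF assms, of x i 0] by (simp add: has_real_derivative_iff_has_vector_derivative)

lemma partialI:
  "((\<lambda>s. g (x + s *\<^sub>R axis i 1)) has_real_derivative d) (at 0) \<Longrightarrow> partial i g x = d"
  unfolding partial_def
  by (simp add: has_real_derivative_iff_has_vector_derivative vector_derivative_at)

lemma partial_const: "partial i (\<lambda>x. c::real) = (\<lambda>x. 0)"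
  by (intro ext partialI) auto

lemma partial_add:
  fixes f g :: "real^3 \<Rightarrow> real"
  assumes "smooth f" "smooth g"
  shows "partial i (\<lambda>x. f x + g x) = (\<lambda>x. partial i f x + partial i g x)"
  by (intro ext partialI derivative_intros partial_has_real_derivative assms)

lemma partial_diff:
  fixes f g :: "real^3 \<Rightarrow> real"
  assumes "smooth f" "smooth g"
  shows "partial i (\<lambda>x. f x - g x) = (\<lambda>x. partial i f x - partial i g x)"
  by (intro ext partialI derivative_intros partial_has_real_derivative assms)

lemma partial_mult:
  fixes f g :: "real^3 \<Rightarrow> real"
  assumes "smooth f" "smooth g"
  shows "partial i (\<lambda>x. f x * g x) = (\<lambda>x. partial i f x * g x + f x * partial i g x)"
proof (intro ext partialI)
  fix x
  show "((\<lambda>s. f (x + s *\<^sub>R axis i 1) * g (x + s *\<^sub>R axis i 1)) has_real_derivative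
      partial i f x * g x + f x * partial i g x) (at 0)"
    using DERIV_mult[OF partial_has_real_derivative[OF assms(1)] partial_has_real_derivative[OF assms(2)]]
    by (simp add: algebra_simps)
qed

lemma partial_sum:
  fixes f :: "'c \<Rightarrow> real^3 \<Rightarrow> real"
  assumes "\<And>k. k \<in> I \<Longrightarrow> smooth (f k)"
  shows "partial i (\<lambda>x. \<Sum>k\<in>I. f k x) = (\<lambda>x. \<Sum>k\<in>I. partial i (f k) x)"
  by (intro ext partialI DERIV_sum partial_has_real_derivative assms)

lemma partial_power:
  fixes f :: "real^3 \<Rightarrow> real"
  assumes "smooth f"
  shows "partial i (\<lambda>x. f x ^ n) = (\<lambda>x. real n * f x ^ (n - 1) * partial i f x)"
proof (intro ext partialI)
  fix x
  show "((\<lambda>s. f (x + s *\<^sub>R axis i 1) ^ n) has_real_derivative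
      real n * f x ^ (n - 1) * partial i f x) (at 0)"
    using DERIV_power[OF partial_has_real_derivative[OF assms], of x i n]
    by (simp add: mult_ac)
qed

lemma partial_component:
  fixes v :: "real^3 \<Rightarrow> real^3"
  assumes "smooth v"
  shows "partial i (\<lambda>x. v x $ j) = (\<lambda>x. partial i v x $ j)"
proof
  fix x
  obtain g' where g': "(v has_derivative g') (at x)"
    using smooth_imp_differentiable[OF assms] unfolding differentiable_def by blast
  then have "((\<lambda>x. v x $ j) has_derivative (\<lambda>h. g' h $ j)) (at x)"
    using bounded_linear.has_derivative[OF bounded_linear_vec_nth] by blast
  from has_derivative_imp_partial(1)[OF this] has_derivative_imp_partial(1)[OF g']
  show "partial i (\<lambda>x. v x $ j) x = partial i v x $ j" by simp
qed

lemma smooth_component: "smooth v \<Longrightarrow> smooth (\<lambda>x. v x $ j)"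
  by (rule C_infinity_on_linear[OF bounded_linear_vec_nth])

section \<open>Symmetry of second derivatives\<close>

text \<open>The second difference over a parallelogram is symmetric in the two directions, and two
  applications of the mean value theorem turn it into a mixed derivative at an intermediate point.\<close>

lemma second_difference_mean_value:
  fixes f :: "'a::real_normed_vector \<Rightarrow> real"
  assumes f: "\<And>y. y \<in> S \<Longrightarrow> (f has_derivative f' y) (at y)"
    and Dh: "\<And>y. y \<in> S \<Longrightarrow> ((\<lambda>y. f' y h) has_derivative Dh y) (at y)"
    and t: "0 < t" and S: "\<And>a b. 0 \<le> a \<Longrightarrow> a \<le> t \<Longrightarrow> 0 \<le> b \<Longrightarrow> b \<le> t \<Longrightarrow> x + a *\<^sub>R h + b *\<^sub>R k \<in> S"
  shows "\<exists>a b. 0 \<le> a \<and> a \<le> t \<and> 0 \<le> b \<and> b \<le> t \<and>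
    f (x + t *\<^sub>R h + t *\<^sub>R k) - f (x + t *\<^sub>R h) - f (x + t *\<^sub>R k) + f x
      = t\<^sup>2 * Dh (x + a *\<^sub>R h + b *\<^sub>R k) k"
proof -
  have line: "((\<lambda>s::real. g (y + s *\<^sub>R v)) has_real_derivative g' v) (at s)"
    if "(g has_derivative g') (at (y + s *\<^sub>R v))" for g :: "'a \<Rightarrow> real" and g' y v s
  proof -
    have "((\<lambda>s::real. y + s *\<^sub>R v) has_derivative (\<lambda>r. r *\<^sub>R v)) (at s)"
      by (auto intro!: derivative_eq_intros)
    then have "((\<lambda>s. g (y + s *\<^sub>R v)) has_derivative (\<lambda>r. g' (r *\<^sub>R v))) (at s)"
      using has_derivative_compose that by blast
    moreover have "(\<lambda>r. g' (r *\<^sub>R v)) = (*) (g' v)"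
      using linear_cmul[OF has_derivative_linear[OF that]] by (auto simp: mult.commute)
    ultimately show ?thesis by (simp add: has_field_derivative_def)
  qed
  define \<phi> where "\<phi> a = f (x + t *\<^sub>R k + a *\<^sub>R h) - f (x + a *\<^sub>R h)" for a
  have "(\<phi> has_real_derivative f' (x + t *\<^sub>R k + a *\<^sub>R h) h - f' (x + a *\<^sub>R h) h) (at a)"
    if "0 \<le> a" "a \<le> t" for a
    unfolding \<phi>_def
    using S[of a t] S[of a 0] that t by (intro DERIV_diff line f) (auto simp: algebra_simps)
  from MVT2[OF t this] obtain a where a: "0 < a" "a < t"
    "\<phi> t - \<phi> 0 = t * (f' (x + t *\<^sub>R k + a *\<^sub>R h) h - f' (x + a *\<^sub>R h) h)" by auto
  have "((\<lambda>b. f' (x + a *\<^sub>R h + b *\<^sub>R k) h) has_real_derivative Dh (x + a *\<^sub>R h + b *\<^sub>R k) k) (at b)"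
    if "0 \<le> b" "b \<le> t" for b
    using S[of a b] that a by (intro line Dh) auto
  from MVT2[OF t this] obtain b where b: "0 < b" "b < t"
    "f' (x + a *\<^sub>R h + t *\<^sub>R k) h - f' (x + a *\<^sub>R h) h = t * Dh (x + a *\<^sub>R h + b *\<^sub>R k) k" by auto
  have "f (x + t *\<^sub>R h + t *\<^sub>R k) - f (x + t *\<^sub>R h) - f (x + t *\<^sub>R k) + f x = \<phi> t - \<phi> 0"
    unfolding \<phi>_def by (simp add: algebra_simps)
  also have "\<dots> = t\<^sup>2 * Dh (x + a *\<^sub>R h + b *\<^sub>R k) k"
    using a b by (simp add: algebra_simps power2_eq_square)
  finally show ?thesis using a b by (intro exI[of _ a] exI[of _ b]) auto
qed

lemma second_derivative_symmetric:
  fixes f :: "'a::real_normed_vector \<Rightarrow> real"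
  assumes S: "open S" "x \<in> S"
    and f: "\<And>y. y \<in> S \<Longrightarrow> (f has_derivative f' y) (at y)"
    and Dh: "\<And>y. y \<in> S \<Longrightarrow> ((\<lambda>y. f' y h) has_derivative Dh y) (at y)"
    and Dk: "\<And>y. y \<in> S \<Longrightarrow> ((\<lambda>y. f' y k) has_derivative Dk y) (at y)"
    and cont: "continuous_on S (\<lambda>y. Dh y k)" "continuous_on S (\<lambda>y. Dk y h)"
  shows "Dh x k = Dk x h"
proof -
  have "\<bar>Dh x k - Dk x h\<bar> \<le> e" if "e > 0" for e
  proof -
    have "((\<lambda>y. Dh y k) \<longlongrightarrow> Dh x k) (nhds x)" "((\<lambda>y. Dk y h) \<longlongrightarrow> Dk x h) (nhds x)"
      using cont S continuous_on_eq_continuous_at isContD tendsto_at_iff_tendsto_nhds by metis+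
    from tendstoD[OF this(1), of "e / 2"] tendstoD[OF this(2), of "e / 2"] that
    have "\<forall>\<^sub>F y in nhds x. \<bar>Dh y k - Dh x k\<bar> < e / 2" "\<forall>\<^sub>F y in nhds x. \<bar>Dk y h - Dk x h\<bar> < e / 2"
      by (simp_all add: dist_real_def)
    moreover have "\<forall>\<^sub>F y in nhds x. y \<in> S" using S eventually_nhds by blast
    ultimately have "\<forall>\<^sub>F y in nhds x. \<bar>Dh y k - Dh x k\<bar> < e / 2 \<and> \<bar>Dk y h - Dk x h\<bar> < e / 2 \<and> y \<in> S"
      by eventually_elim auto
    then obtain d where d: "d > 0"
      "\<And>y. dist y x < d \<Longrightarrow> \<bar>Dh y k - Dh x k\<bar> < e / 2 \<and> \<bar>Dk y h - Dk x h\<bar> < e / 2 \<and> y \<in> S"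
      unfolding eventually_nhds_metric by auto
    \<comment> \<open>Keeps the whole parallelogram with sides t h and t k within distance d / 2 of
      x; the added 1 excludes division by zero.\<close>
    define t where "t = d / (2 * (norm h + norm k + 1))"
    have pos: "norm h + norm k + 1 > 0" by (smt (verit) norm_ge_zero)
    have t: "t > 0" unfolding t_def using d pos by simp
    have near: "dist (x + a *\<^sub>R h + b *\<^sub>R k) x < d" if "0 \<le> a" "a \<le> t" "0 \<le> b" "b \<le> t" for a b
    proof -
      have "dist (x + a *\<^sub>R h + b *\<^sub>R k) x = norm (a *\<^sub>R h + b *\<^sub>R k)" by (simp add: dist_norm)
      also have "\<dots> \<le> a * norm h + b * norm k"
        using norm_triangle_ineq[of "a *\<^sub>R h" "b *\<^sub>R k"] that by simp
      also have "\<dots> \<le> t * norm h + t * norm k"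
        using that by (intro add_mono mult_right_mono) auto
      also have "\<dots> \<le> t * (norm h + norm k + 1)" using t by (simp add: algebra_simps)
      also have "\<dots> = d / 2" unfolding t_def using pos by (simp add: divide_simps)
      finally show ?thesis using d by simp
    qed
    have near': "dist (x + a *\<^sub>R k + b *\<^sub>R h) x < d" if "0 \<le> a" "a \<le> t" "0 \<le> b" "b \<le> t" for a b
      using near[of b a] that by (simp add: add.commute add.left_commute)
    obtain a b where 1: "0 \<le> a" "a \<le> t" "0 \<le> b" "b \<le> t"
      "f (x + t *\<^sub>R h + t *\<^sub>R k) - f (x + t *\<^sub>R h) - f (x + t *\<^sub>R k) + f x
        = t\<^sup>2 * Dh (x + a *\<^sub>R h + b *\<^sub>R k) k"
      using second_difference_mean_value[of S f f' h Dh t x k] f Dh t near d by blast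
    obtain a' b' where 2: "0 \<le> a'" "a' \<le> t" "0 \<le> b'" "b' \<le> t"
      "f (x + t *\<^sub>R k + t *\<^sub>R h) - f (x + t *\<^sub>R k) - f (x + t *\<^sub>R h) + f x
        = t\<^sup>2 * Dk (x + a' *\<^sub>R k + b' *\<^sub>R h) h"
      using second_difference_mean_value[of S f f' k Dk t x h] f Dk t near' d by blast
    have e: "x + t *\<^sub>R k + t *\<^sub>R h = x + t *\<^sub>R h + t *\<^sub>R k" by (simp add: algebra_simps)
    then have "t\<^sup>2 * Dh (x + a *\<^sub>R h + b *\<^sub>R k) k = t\<^sup>2 * Dk (x + a' *\<^sub>R k + b' *\<^sub>R h) h"
      using 1(5) 2(5)[unfolded e] by linarith
    then have "Dh (x + a *\<^sub>R h + b *\<^sub>R k) k = Dk (x + a' *\<^sub>R k + b' *\<^sub>R h) h" using t by simp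
    then show ?thesis
      using d(2)[OF near[OF 1(1-4)]] d(2)[OF near'[OF 2(1-4)]] by linarith
  qed
  then show ?thesis using field_le_epsilon[of "\<bar>Dh x k - Dk x h\<bar>" 0] by force
qed

text \<open>Formulated on an open set so that it covers two space directions and also, in the
  interior of the time interval, a time and a space direction.\<close>

lemma C_infinity_on_mixed_symmetric:
  fixes f :: "'a::real_normed_vector \<Rightarrow> real"
  assumes S: "open S" "x \<in> S" and f: "C_infinity_on S f"
    and f': "\<And>y. y \<in> S \<Longrightarrow> (f has_derivative f' y) (at y)"
    and Dh: "((\<lambda>y. f' y h) has_derivative Dh) (at x)"
    and Dk: "((\<lambda>y. f' y k) has_derivative Dk) (at x)"
  shows "Dh k = Dk h"
proof -
  have within: "at y within S = at y" if "y \<in> S" for y using S that at_within_open by blast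
  have dir: "C_infinity_on S (\<lambda>y. f' y v)" for v
    by (rule C_infinity_on_directional[OF f, where h = v]) (use f' within has_derivative_unique in metis)
  obtain Eh where Eh: "\<And>y. y \<in> S \<Longrightarrow> ((\<lambda>y. f' y h) has_derivative Eh y) (at y)"
    using C_infinity_on_imp_differentiable[OF dir[of h]] within by metis
  obtain Ek where Ek: "\<And>y. y \<in> S \<Longrightarrow> ((\<lambda>y. f' y k) has_derivative Ek y) (at y)"
    using C_infinity_on_imp_differentiable[OF dir[of k]] within by metis
  have "C_infinity_on S (\<lambda>y. Eh y k)"
    by (rule C_infinity_on_directional[OF dir[of h], where h = k]) (use Eh within has_derivative_unique in metis)
  moreover have "C_infinity_on S (\<lambda>y. Ek y h)"
    by (rule C_infinity_on_directional[OF dir[of k], where h = h]) (use Ek within has_derivative_unique in metis)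
  ultimately have "Eh x k = Ek x h"
    by (intro second_derivative_symmetric[OF S f' Eh Ek] C_infinity_on_imp_continuous_on) auto
  moreover have "Eh x = Dh" "Ek x = Dk"
    using Eh Ek Dh Dk has_derivative_unique S by blast+
  ultimately show ?thesis by simp
qed

lemma partial_commute:
  fixes g :: "real^3 \<Rightarrow> real"
  assumes "smooth g"
  shows "partial i (partial j g) = partial j (partial i g)"
proof
  fix x
  obtain g' where g': "\<And>x. (g has_derivative g' x) (at x)"
    using C_infinity_on_imp_differentiable[OF assms] by auto
  have p: "partial i g = (\<lambda>x. g' x (axis i 1))" for i using has_derivative_imp_partial(1)[OF g'] by auto
  obtain Di where Di: "(partial i g has_derivative Di) (at x)"
    using smooth_imp_differentiable[OF smooth_partial[OF assms]] unfolding differentiable_def by blast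
  obtain Dj where Dj: "(partial j g has_derivative Dj) (at x)"
    using smooth_imp_differentiable[OF smooth_partial[OF assms]] unfolding differentiable_def by blast
  have "Di (axis j 1) = Dj (axis i 1)"
    by (rule C_infinity_on_mixed_symmetric[OF open_UNIV UNIV_I assms g'])
      (use Di Dj p in simp_all)
  then show "partial i (partial j g) x = partial j (partial i g) x"
    using has_derivative_imp_partial(1)[OF Di] has_derivative_imp_partial(1)[OF Dj] by simp
qed

text \<open>Words replace multi-indices because the product rule and the passage to one more
  derivative become inductions on lists. The head of the word is the derivative taken first. A mixed
  derivative is represented by several words, which affects only constants.\<close>

primrec word_deriv :: "3 list \<Rightarrow> (real^3 \<Rightarrow> 'b::real_normed_vector) \<Rightarrow> real^3 \<Rightarrow> 'b" where
  "word_deriv [] g = g"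
| "word_deriv (i # ws) g = word_deriv ws (partial i g)"

lemma smooth_word_deriv [smooth_intros]: "smooth g \<Longrightarrow> smooth (word_deriv ws g)"
  by (induction ws arbitrary: g) (auto intro: smooth_partial)

lemma word_deriv_append: "word_deriv (ws @ vs) g = word_deriv vs (word_deriv ws g)"
  by (induction ws arbitrary: g) auto

lemma partial_word_deriv:
  fixes g :: "real^3 \<Rightarrow> real"
  shows "smooth g \<Longrightarrow> partial i (word_deriv ws g) = word_deriv ws (partial i g)"
proof (induction ws arbitrary: g)
  case (Cons j ws)
  then show ?case using partial_commute[OF Cons.prems] smooth_partial by fastforce
qed simp

lemma word_deriv_add:
  fixes f g :: "real^3 \<Rightarrow> real"
  shows "smooth f \<Longrightarrow> smooth g \<Longrightarrow>
    word_deriv ws (\<lambda>x. f x + g x) = (\<lambda>x. word_deriv ws f x + word_deriv ws g x)"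
  by (induction ws arbitrary: f g) (simp_all add: partial_add smooth_partial)

lemma word_deriv_diff:
  fixes f g :: "real^3 \<Rightarrow> real"
  shows "smooth f \<Longrightarrow> smooth g \<Longrightarrow>
    word_deriv ws (\<lambda>x. f x - g x) = (\<lambda>x. word_deriv ws f x - word_deriv ws g x)"
  by (induction ws arbitrary: f g) (simp_all add: partial_diff smooth_partial)

lemma word_deriv_sum:
  fixes f :: "'c \<Rightarrow> real^3 \<Rightarrow> real"
  shows "(\<And>k. k \<in> I \<Longrightarrow> smooth (f k)) \<Longrightarrow>
    word_deriv ws (\<lambda>x. \<Sum>k\<in>I. f k x) = (\<lambda>x. \<Sum>k\<in>I. word_deriv ws (f k) x)"
  by (induction ws arbitrary: f) (simp_all add: partial_sum smooth_partial)

lemma word_deriv_replicate: "word_deriv (replicate n i) g = (partial i ^^ n) g"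
  by (induction n arbitrary: g) (simp_all add: funpow_swap1)

lemma Dm_eq_word_deriv:
  "Dm \<alpha> g = word_deriv (replicate (\<alpha> $ 3) 3 @ replicate (\<alpha> $ 2) 2 @ replicate (\<alpha> $ 1) 1) g"
  by (simp add: Dm_def word_deriv_append word_deriv_replicate)

lemma word_deriv_component:
  fixes v :: "real^3 \<Rightarrow> real^3"
  shows "smooth v \<Longrightarrow> word_deriv ws (\<lambda>x. v x $ j) = (\<lambda>x. word_deriv ws v x $ j)"
  by (induction ws arbitrary: v) (simp_all add: partial_component smooth_partial)

lemma partial_Dm:
  fixes g :: "real^3 \<Rightarrow> real"
  assumes "smooth g"
  shows "partial i (Dm \<alpha> g) = Dm (\<alpha> + axis i 1) g"
proof -
  have c: "partial i ((partial j ^^ n) h) = (partial j ^^ n) (partial i h) \<and> smooth ((partial j ^^ n) h)"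
    if "smooth h" for h :: "real^3 \<Rightarrow> real" and n j i
    using partial_word_deriv[OF that, of i "replicate n j"] smooth_word_deriv[OF that, of "replicate n j"]
    by (simp add: word_deriv_replicate)
  consider "i = 1" | "i = 2" | "i = 3" using exhaust_3 by blast
  then show ?thesis
    by cases (simp_all add: Dm_def c assms axis_def)
qed

text \<open>Appending a letter raises one entry of the multi-index, by \<open>partial_Dm\<close>. In
  this way the square integrability assumed for \<open>Dm\<close>, and the weak derivatives of the
  initial state, become available for all words.\<close>

lemma word_deriv_eq_Dm:
  fixes g :: "real^3 \<Rightarrow> real"
  assumes "smooth g"
  shows "\<exists>\<alpha>. mlen \<alpha> = length ws \<and> word_deriv ws g = Dm \<alpha> g"
proof (induction ws rule: rev_induct)
  case Nil
  show ?case by (intro exI[of _ 0]) (simp add: mlen_def Dm_def)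
next
  case (snoc i ws)
  then obtain \<alpha> where "mlen \<alpha> = length ws" "word_deriv ws g = Dm \<alpha> g" by blast
  then have "mlen (\<alpha> + axis i 1) = length (ws @ [i])" "word_deriv (ws @ [i]) g = Dm (\<alpha> + axis i 1) g"
    using partial_Dm[OF assms] by (simp_all add: mlen_def word_deriv_append sum.distrib axis_def)
  then show ?case by blast
qed

section \<open>Functions of time and space\<close>

abbreviation spacetime_smooth :: "real \<Rightarrow> (real \<Rightarrow> real^3 \<Rightarrow> 'b::real_normed_vector) \<Rightarrow> bool" where
  "spacetime_smooth T F \<equiv> C_infinity_on ({0..<T} \<times> UNIV) (\<lambda>(t, x). F t x)"

text \<open>Taken within the half-open interval, hence one-sided at time 0, so that the time
  derivative is again smooth up to the initial time.\<close>

definition time_deriv :: "real \<Rightarrow> (real \<Rightarrow> real^3 \<Rightarrow> real) \<Rightarrow> real \<Rightarrow> real^3 \<Rightarrow> real" where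
  "time_deriv T F t x = vector_derivative (\<lambda>s. F s x) (at t within {0..<T})"

lemma spacetime_slice:
  assumes F: "spacetime_smooth T F" and t: "t \<in> {0..<T}"
  shows "smooth (F t)"
proof -
  have "bounded_linear (\<lambda>x::real^3. (0::real, x))"
    by (intro bounded_linear_Pair bounded_linear_zero bounded_linear_ident)
  then have "smooth (\<lambda>x. (\<lambda>(t, x). F t x) ((t, 0) + (0, x)))"
    by (rule C_infinity_on_affine[OF _ _ F]) (use t in auto)
  then show ?thesis by simp
qed

lemma spacetime_slice_derivatives:
  fixes F :: "real \<Rightarrow> real^3 \<Rightarrow> 'b::real_normed_vector"
  assumes F: "((\<lambda>(t, x). F t x) has_derivative F') (at (t, x) within I \<times> UNIV)" and t: "t \<in> I"
  shows "(F t has_derivative (\<lambda>h. F' (0, h))) (at x)"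
    and "((\<lambda>s. F s x) has_vector_derivative F' (1, 0)) (at t within I)"
proof -
  have "((\<lambda>y. (t, y)) has_derivative (\<lambda>h. (0, h))) (at x)"
    by (intro has_derivative_Pair has_derivative_const has_derivative_ident)
  moreover have "((\<lambda>(t, x). F t x) has_derivative F') (at (t, x) within range (\<lambda>y. (t, y)))"
    by (rule has_derivative_subset[OF F]) (use t in blast)
  ultimately have "((\<lambda>y. (\<lambda>(t, x). F t x) (t, y)) has_derivative (\<lambda>h. F' (0, h))) (at x)"
    by (rule has_derivative_in_compose)
  then show "(F t has_derivative (\<lambda>h. F' (0, h))) (at x)" by simp
  have "((\<lambda>s. (s, x)) has_derivative (\<lambda>h. (h, 0))) (at t within I)"
    by (intro has_derivative_Pair has_derivative_const has_derivative_ident)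
  moreover have "((\<lambda>(t, x). F t x) has_derivative F') (at (t, x) within (\<lambda>s. (s, x)) ` I)"
    by (rule has_derivative_subset[OF F]) blast
  ultimately have "((\<lambda>s. (\<lambda>(t, x). F t x) (s, x)) has_derivative (\<lambda>h. F' (h, 0))) (at t within I)"
    by (rule has_derivative_in_compose)
  moreover have "(\<lambda>h. F' (h, 0)) = (\<lambda>h. h *\<^sub>R F' (1, 0))"
  proof
    fix h :: real
    have "(h, 0) = h *\<^sub>R (1, 0 :: real^3)" by simp
    then show "F' (h, 0) = h *\<^sub>R F' (1, 0)"
      by (simp only: linear_cmul[OF has_derivative_linear[OF F]])
  qed
  ultimately show "((\<lambda>s. F s x) has_vector_derivative F' (1, 0)) (at t within I)"
    by (simp add: has_vector_derivative_def)
qed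

lemma spacetime_partial:
  assumes F: "spacetime_smooth T F"
  shows "spacetime_smooth T (\<lambda>t. partial i (F t))"
proof (rule C_infinity_on_directional[OF F, where h = "(0, axis i 1)"])
  fix y F' assume y: "y \<in> {0..<T} \<times> UNIV"
    "((\<lambda>(t, x). F t x) has_derivative F') (at y within {0..<T} \<times> UNIV)"
  obtain t x where tx: "y = (t, x)" by fastforce
  with y have t: "t \<in> {0..<T}"
    and d: "((\<lambda>(t, x). F t x) has_derivative F') (at (t, x) within {0..<T} \<times> UNIV)"
    by blast+
  have "partial i (F t) x = F' (0, axis i 1)"
    by (rule has_derivative_imp_partial(1)[OF spacetime_slice_derivatives(1)[OF d t]])
  then show "F' (0, axis i 1) = (case y of (t, x) \<Rightarrow> partial i (F t) x)"
    using tx by (metis case_prod_conv)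
qed

lemma spacetime_word_deriv:
  "spacetime_smooth T F \<Longrightarrow> spacetime_smooth T (\<lambda>t. word_deriv ws (F t))"
proof (induction ws arbitrary: F)
  case (Cons i ws)
  show ?case using Cons.IH[OF spacetime_partial[OF Cons.prems, of i]] by simp
qed simp

lemma time_derivI:
  assumes "t \<in> {0..<T}" "((\<lambda>s. F s x) has_vector_derivative d) (at t within {0..<T})"
  shows "time_deriv T F t x = d"
proof -
  have "t islimpt {0..<T}" using assms(1) by (simp add: islimpt_Ico)
  then have "at t within {0..<T} \<noteq> bot" by (simp add: trivial_limit_within)
  then show ?thesis unfolding time_deriv_def using assms(2) vector_derivative_within by blast
qed

lemma spacetime_time_deriv:
  assumes F: "spacetime_smooth T F"
  shows "spacetime_smooth T (time_deriv T F)"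
proof (rule C_infinity_on_directional[OF F, where h = "(1, 0)"])
  fix y F' assume y: "y \<in> {0..<T} \<times> UNIV"
    "((\<lambda>(t, x). F t x) has_derivative F') (at y within {0..<T} \<times> UNIV)"
  obtain t x where tx: "y = (t, x)" by fastforce
  with y have t: "t \<in> {0..<T}"
    and d: "((\<lambda>(t, x). F t x) has_derivative F') (at (t, x) within {0..<T} \<times> UNIV)"
    by blast+
  have "time_deriv T F t x = F' (1, 0)"
    by (rule time_derivI[OF t]) (rule spacetime_slice_derivatives(2)[OF d t])
  then show "F' (1, 0) = (case y of (t, x) \<Rightarrow> time_deriv T F t x)"
    using tx by (metis case_prod_conv)
qed

lemma has_time_deriv:
  assumes F: "spacetime_smooth T F" and t: "t \<in> {0..<T}"
  shows "((\<lambda>s. F s x) has_vector_derivative time_deriv T F t x) (at t within {0..<T})"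
proof -
  obtain F' where "((\<lambda>(t, x). F t x) has_derivative F' (t, x)) (at (t, x) within {0..<T} \<times> UNIV)"
    using C_infinity_on_imp_differentiable[OF F] t by (metis SigmaI UNIV_I)
  from spacetime_slice_derivatives(2)[OF this t] time_derivI[of t T F x] t show ?thesis by simp
qed

text \<open>Symmetry of mixed derivatives needs an open set, whence the interior times. The
  integration in time asks for the differential inequality at interior times only, and for mere
  continuity at the endpoints.\<close>

lemma time_deriv_partial:
  fixes F :: "real \<Rightarrow> real^3 \<Rightarrow> real"
  assumes F: "spacetime_smooth T F" and t: "0 < t" "t < T"
  shows "time_deriv T (\<lambda>s. partial i (F s)) t = partial i (time_deriv T F t)"
proof
  fix x
  let ?S = "{0<..<T} \<times> (UNIV :: (real^3) set)"
  have S: "open ?S" "(t, x) \<in> ?S" using t by (auto intro: open_Times)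
  have sub: "?S \<subseteq> {0..<T} \<times> UNIV" by auto
  have within': "at y within {0..<T} \<times> UNIV = at y" if "y \<in> ?S" for y
    by (rule at_within_interior) (use interior_maximal[OF sub S(1)] that in \<open>rule subsetD\<close>)
  obtain F' where F'_within: "\<And>y. y \<in> {0..<T} \<times> UNIV \<Longrightarrow>
      ((\<lambda>(t, x). F t x) has_derivative F' y) (at y within {0..<T} \<times> UNIV)"
    using C_infinity_on_imp_differentiable[OF F] by metis
  have F': "((\<lambda>(t, x). F t x) has_derivative F' y) (at y)" if "y \<in> ?S" for y
    using F'_within[OF subsetD[OF sub that]] within'[OF that] by simp
  obtain P where P: "((\<lambda>(t, x). partial i (F t) x) has_derivative P) (at (t, x))"
    using C_infinity_on_imp_differentiable[OF spacetime_partial[OF F]] within'[OF S(2)] subsetD[OF sub S(2)]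
    by metis
  obtain D where D: "((\<lambda>(t, x). time_deriv T F t x) has_derivative D) (at (t, x))"
    using C_infinity_on_imp_differentiable[OF spacetime_time_deriv[OF F]] within'[OF S(2)] subsetD[OF sub S(2)]
    by metis
  have slice: "(\<lambda>(t, x). partial i (F t) x) y = F' y (0, axis i 1)"
    "(\<lambda>(t, x). time_deriv T F t x) y = F' y (1, 0)" if y: "y \<in> ?S" for y
  proof -
    obtain s z where sz: "y = (s, z)" "s \<in> {0..<T}" using y by auto
    have h: "((\<lambda>(t, x). F t x) has_derivative F' (s, z)) (at (s, z) within {0..<T} \<times> UNIV)"
      using F'_within sz by blast
    show "(\<lambda>(t, x). partial i (F t) x) y = F' y (0, axis i 1)"
      using has_derivative_imp_partial(1)[OF spacetime_slice_derivatives(1)[OF h sz(2)]] sz by simp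
    show "(\<lambda>(t, x). time_deriv T F t x) y = F' y (1, 0)"
      using time_derivI[of s T F z] spacetime_slice_derivatives(2)[OF h sz(2)] sz by simp
  qed
  have "P (1, 0) = D (0, axis i 1)"
  proof (rule C_infinity_on_mixed_symmetric[OF S C_infinity_on_subset[OF F sub] F'])
    show "((\<lambda>y. F' y (0, axis i 1)) has_derivative P) (at (t, x))"
      by (rule has_derivative_transform_within_open[OF P S]) (use slice in blast)
    show "((\<lambda>y. F' y (1, 0)) has_derivative D) (at (t, x))"
      by (rule has_derivative_transform_within_open[OF D S]) (use slice in blast)
  qed
  moreover have "time_deriv T (\<lambda>s. partial i (F s)) t x = P (1, 0)"
    using spacetime_slice_derivatives(2)[OF has_derivative_at_withinI[OF P], of "{0..<T}"] t
    by (intro time_derivI) auto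
  moreover have "partial i (time_deriv T F t) x = D (0, axis i 1)"
    using has_derivative_imp_partial(1)[OF spacetime_slice_derivatives(1)[OF has_derivative_at_withinI[OF D], of UNIV]]
    by simp
  ultimately show "time_deriv T (\<lambda>s. partial i (F s)) t x = partial i (time_deriv T F t) x" by simp
qed

lemma time_deriv_word_deriv:
  fixes F :: "real \<Rightarrow> real^3 \<Rightarrow> real"
  assumes t: "0 < t" "t < T"
  shows "spacetime_smooth T F \<Longrightarrow>
    time_deriv T (\<lambda>s. word_deriv ws (F s)) t = word_deriv ws (time_deriv T F t)"
proof (induction ws arbitrary: F)
  case (Cons i ws)
  then show ?case using time_deriv_partial[OF Cons.prems t] spacetime_partial[OF Cons.prems] by simp
qed simp

section \<open>Smooth cut-off functions\<close>

text \<open>The derivatives of \<open>exp (- (1 / s))\<close> are polynomials in \<open>1 / s\<close> times the same exponential, so the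
  family indexed by the polynomial is closed under differentiation.\<close>

definition flat_exp :: "real poly \<Rightarrow> real \<Rightarrow> real" where
  "flat_exp p s = (if s > 0 then poly p (1 / s) * exp (- (1 / s)) else 0)"

lemma tendsto_poly_exp_0: "((\<lambda>z. poly p z * exp (- z)) \<longlongrightarrow> (0::real)) at_top"
proof -
  have "((\<lambda>z. \<Sum>i\<le>degree p. coeff p i * (z ^ i / exp z)) \<longlongrightarrow> (\<Sum>i\<le>degree p. coeff p i * 0)) at_top"
    by (intro tendsto_intros tendsto_power_div_exp_0)
  then show ?thesis
    by (simp add: poly_altdef sum_distrib_right exp_minus sum_divide_distrib field_simps)
qed

text \<open>With z = 1 / s one has dz/ds = - z^2, so the derivative of p(z) exp (- z) is (p(z) -
  p'(z)) z^2 exp (- z); the polynomial \<open>[:0, 0, 1:]\<close> is z^2.\<close>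

lemma flat_exp_has_derivative:
  "(flat_exp p has_real_derivative flat_exp ((p - pderiv p) * [:0, 0, 1:]) s) (at s)"
proof -
  consider "s > 0" | "s < 0" | "s = 0" by linarith
  then show ?thesis
  proof cases
    case 1
    have "((\<lambda>s. poly p (1 / s) * exp (- (1 / s))) has_real_derivative
        flat_exp ((p - pderiv p) * [:0, 0, 1:]) s) (at s)"
      using 1 unfolding flat_exp_def
      by (auto intro!: derivative_eq_intros DERIV_chain2[OF poly_DERIV] simp: field_simps power2_eq_square)
    then show ?thesis
      by (rule has_field_derivative_transform_within_open[of _ _ _ "{0<..}"]) (use 1 in \<open>auto simp: flat_exp_def\<close>)
  next
    case 2
    have "((\<lambda>s. 0) has_real_derivative flat_exp ((p - pderiv p) * [:0, 0, 1:]) s) (at s)"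
      using 2 by (simp add: flat_exp_def)
    then show ?thesis
      by (rule has_field_derivative_transform_within_open[of _ _ _ "{..<0}"]) (use 2 in \<open>auto simp: flat_exp_def\<close>)
  next
    case 3
    \<comment> \<open>At 0 the difference quotient is z p(z) exp (- z) with z = 1 / h; the factor
      \<open>[:0, 1:]\<close> accounts for the extra z.\<close>
    have "((\<lambda>h. poly (p * [:0, 1:]) (inverse h) * exp (- inverse h)) \<longlongrightarrow> 0) (at_right (0::real))"
      by (rule filterlim_compose[OF tendsto_poly_exp_0 filterlim_inverse_at_top_right])
    then have "((\<lambda>h. flat_exp p h / h) \<longlongrightarrow> 0) (at_right 0)"
      by (rule Lim_transform_eventually)
        (auto simp: eventually_at_filter flat_exp_def field_simps)
    moreover have "((\<lambda>h. flat_exp p h / h) \<longlongrightarrow> 0) (at_left 0)"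
      by (rule tendsto_eventually) (auto simp: eventually_at_filter flat_exp_def)
    ultimately have "((\<lambda>h. flat_exp p h / h) \<longlongrightarrow> 0) (at 0)"
      using filterlim_split_at by blast
    then show ?thesis using 3 by (simp add: DERIV_def flat_exp_def)
  qed
qed

lemma flat_exp_smooth: "C_infinity_on UNIV (flat_exp p)"
proof -
  have "C_k_on k UNIV (flat_exp p)" for k
  proof (induction k arbitrary: p)
    case 0
    show ?case using DERIV_continuous[OF flat_exp_has_derivative]
      by (simp add: continuous_on_eq_continuous_at)
  next
    case (Suc k)
    have "\<forall>s\<in>UNIV. (flat_exp p has_derivative (\<lambda>h. flat_exp ((p - pderiv p) * [:0, 0, 1:]) s * h)) (at s within UNIV)"
      using flat_exp_has_derivative has_field_derivative_def by blast
    moreover have "\<forall>h. C_k_on k UNIV (\<lambda>s. flat_exp ((p - pderiv p) * [:0, 0, 1:]) s * h)"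
      using C_k_on_mult[OF Suc C_k_on_const] by blast
    ultimately show ?case unfolding C_k_on.simps(2)
      by (intro exI[of _ "\<lambda>s h. flat_exp ((p - pderiv p) * [:0, 0, 1:]) s * h"]) simp
  qed
  then show ?thesis unfolding C_infinity_on_def by blast
qed

text \<open>The factor \<open>exp 1\<close> normalises the value at 0 to 1. There is no plateau:
  what matters is that the function decreases radially, so that its rescalings increase to 1 as the
  radius grows.\<close>

definition bump :: "real^3 \<Rightarrow> real" where
  "bump x = exp 1 * flat_exp 1 (1 - (\<Sum>i\<in>UNIV. (x $ i)\<^sup>2))"

definition cutoff :: "real \<Rightarrow> real^3 \<Rightarrow> real" where
  "cutoff R x = bump ((1 / R) *\<^sub>R x)"

lemma smooth_nth [smooth_intros]: "smooth (\<lambda>x. x $ i)"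
proof -
  have "C_k_on k UNIV (\<lambda>x::real^3. x $ i)" for k
  proof (cases k)
    case (Suc m)
    have "\<forall>x\<in>UNIV. ((\<lambda>x::real^3. x $ i) has_derivative (\<lambda>h. h $ i)) (at x within UNIV)"
      by (auto intro!: bounded_linear_imp_has_derivative bounded_linear_vec_nth)
    then show ?thesis unfolding Suc C_k_on.simps(2)
      by (intro exI[of _ "\<lambda>x h. h $ i"] conjI allI C_k_on_const)
  qed (auto intro!: continuous_intros)
  then show ?thesis by (simp add: C_infinity_on_def)
qed

lemma flat_exp_mono: "s \<le> t \<Longrightarrow> flat_exp 1 s \<le> flat_exp 1 t"
  by (auto simp: flat_exp_def frac_le)

lemma bump_exp: "exp 1 * flat_exp 1 s = (if s > 0 then exp (1 - 1 / s) else 0)"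
  by (simp add: flat_exp_def flip: exp_add)

lemma sum_squares_eq_norm: "(\<Sum>i\<in>UNIV. (x $ i)\<^sup>2) = (norm (x :: real^3))\<^sup>2"
  unfolding power2_norm_eq_inner inner_vec_def by (simp add: power2_eq_square)

lemma bump_nonneg: "0 \<le> bump x"
  by (simp add: bump_def bump_exp)

lemma bump_le_1: "bump x \<le> 1"
proof -
  have "bump x \<le> exp 1 * flat_exp 1 1"
    unfolding bump_def by (intro mult_left_mono flat_exp_mono) (auto intro: sum_nonneg)
  then show ?thesis by (simp add: bump_exp)
qed

lemma bump_eq_0:
  assumes "1 \<le> norm x" shows "bump x = 0"
proof -
  have "\<not> (norm x)\<^sup>2 < 1" using one_le_power[OF assms, of 2] by linarith
  then show ?thesis by (simp add: bump_def bump_exp sum_squares_eq_norm)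
qed

lemma bump_0: "bump 0 = 1"
  by (simp add: bump_def bump_exp)

lemma smooth_bump: "smooth bump"
proof -
  have "smooth (\<lambda>x. exp 1 * flat_exp 1 (1 - (\<Sum>i\<in>UNIV. (x $ i)\<^sup>2)))"
    by (intro smooth_intros C_infinity_on_compose_real[OF flat_exp_smooth])
  then show ?thesis by (simp add: bump_def[abs_def])
qed

lemma smooth_scaled:
  "smooth g \<Longrightarrow> smooth (\<lambda>x. g (c *\<^sub>R x))"
  using C_infinity_on_affine[of "\<lambda>x. c *\<^sub>R x" UNIV 0 UNIV g] bounded_linear_scaleR_right[of c] by simp

lemma smooth_cutoff [smooth_intros]: "smooth (cutoff R)"
  using smooth_scaled[OF smooth_bump] by (simp add: cutoff_def[abs_def])

lemma cutoff_nonneg: "0 \<le> cutoff R x"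
  by (simp add: cutoff_def bump_nonneg)

lemma cutoff_le_1: "cutoff R x \<le> 1"
  by (simp add: cutoff_def bump_le_1)

lemma cutoff_eq_0: "0 < R \<Longrightarrow> R \<le> norm x \<Longrightarrow> cutoff R x = 0"
  by (simp add: cutoff_def bump_eq_0)

lemma cutoff_mono:
  assumes "0 < R" "R \<le> R'"
  shows "cutoff R x \<le> cutoff R' x"
proof -
  have "norm ((1 / R') *\<^sub>R x) \<le> norm ((1 / R) *\<^sub>R x)"
    using assms by (simp add: divide_left_mono mult_right_mono frac_le)
  then have "(norm ((1 / R') *\<^sub>R x))\<^sup>2 \<le> (norm ((1 / R) *\<^sub>R x))\<^sup>2"
    by (intro power_mono) auto
  then show ?thesis
    unfolding cutoff_def bump_def sum_squares_eq_norm by (intro mult_left_mono flat_exp_mono) auto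
qed

lemma cutoff_tendsto: "(\<lambda>n. cutoff (real (Suc n)) x) \<longlonglongrightarrow> 1"
proof -
  have "continuous_on UNIV bump" by (rule C_infinity_on_imp_continuous_on[OF smooth_bump])
  then have "isCont bump 0" by (simp add: continuous_on_eq_continuous_at)
  moreover have "(\<lambda>n. (1 / real (Suc n)) *\<^sub>R x) \<longlonglongrightarrow> 0 *\<^sub>R x"
    by (intro tendsto_intros LIMSEQ_Suc[OF lim_1_over_n])
  ultimately show ?thesis
    unfolding cutoff_def using isCont_tendsto_compose[of 0 bump] bump_0 by fastforce
qed

lemma partial_cutoff: "partial i (cutoff R) x = partial i bump ((1 / R) *\<^sub>R x) / R"
proof -
  obtain B where B: "(bump has_derivative B) (at ((1 / R) *\<^sub>R x))"
    using smooth_imp_differentiable[OF smooth_bump] unfolding differentiable_def by blast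
  have "((\<lambda>x. (1 / R) *\<^sub>R x) has_derivative (\<lambda>h. (1 / R) *\<^sub>R h)) (at x)"
    by (intro derivative_eq_intros) auto
  from has_derivative_compose[OF this B]
  have "(cutoff R has_derivative (\<lambda>h. B ((1 / R) *\<^sub>R h))) (at x)" by (simp add: cutoff_def[abs_def])
  from has_derivative_imp_partial(1)[OF this]
  have "partial i (cutoff R) x = B ((1 / R) *\<^sub>R axis i 1)" .
  also have "\<dots> = (1 / R) *\<^sub>R B (axis i 1)"
    by (rule linear_cmul[OF has_derivative_linear[OF B]])
  finally show ?thesis using has_derivative_imp_partial(1)[OF B] by simp
qed

lemma partial_eq_0_if_locally_0:
  assumes "open S" "x \<in> S" "\<And>y. y \<in> S \<Longrightarrow> g y = 0"
  shows "partial i g x = (0::real)"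
proof -
  have "((\<lambda>y. 0) has_derivative (\<lambda>h. 0)) (at x)" by simp
  then have "(g has_derivative (\<lambda>h. 0)) (at x)"
    by (rule has_derivative_transform_within_open) (use assms in auto)
  from has_derivative_imp_partial(1)[OF this] show ?thesis by simp
qed

section \<open>Functions of compact support\<close>

definition compactly_supported :: "(real^3 \<Rightarrow> real) \<Rightarrow> bool" where
  "compactly_supported g \<longleftrightarrow> (\<exists>R. \<forall>x. R < norm x \<longrightarrow> g x = 0)"

lemma compactly_supported_partial:
  assumes "compactly_supported g"
  shows "compactly_supported (partial i g)"
proof -
  obtain R where R: "\<forall>x. R < norm x \<longrightarrow> g x = 0" using assms unfolding compactly_supported_def by blast
  have "open {x::real^3. R < norm x}" by (intro open_Collect_less continuous_intros)
  then have "\<forall>x. R < norm x \<longrightarrow> partial i g x = 0"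
    using partial_eq_0_if_locally_0 R by blast
  then show ?thesis unfolding compactly_supported_def by blast
qed

lemma compactly_supported_mult1:
  "compactly_supported f \<Longrightarrow> compactly_supported (\<lambda>x. f x * g x)"
  unfolding compactly_supported_def by (metis mult_zero_left)

lemma compactly_supported_mult2:
  "compactly_supported g \<Longrightarrow> compactly_supported (\<lambda>x. f x * g x)"
  unfolding compactly_supported_def by (metis mult_zero_right)

lemma compactly_supported_power:
  "compactly_supported f \<Longrightarrow> 0 < n \<Longrightarrow> compactly_supported (\<lambda>x. f x ^ n)"
  unfolding compactly_supported_def by (metis zero_power)

lemma compactly_supported_add:
  assumes "compactly_supported f" "compactly_supported g"
  shows "compactly_supported (\<lambda>x. f x + g x)"
proof -
  obtain R1 R2 where "\<forall>x. R1 < norm x \<longrightarrow> f x = 0" "\<forall>x. R2 < norm x \<longrightarrow> g x = 0"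
    using assms unfolding compactly_supported_def by blast
  then have "\<forall>x. max R1 R2 < norm x \<longrightarrow> f x + g x = 0" by auto
  then show ?thesis unfolding compactly_supported_def by blast
qed

lemma compactly_supported_0: "compactly_supported (\<lambda>x. 0)"
  unfolding compactly_supported_def by blast

lemma compactly_supported_sum:
  "(\<And>i. i \<in> I \<Longrightarrow> compactly_supported (f i)) \<Longrightarrow> compactly_supported (\<lambda>x. \<Sum>i\<in>I. f i x)"
  by (induction I rule: infinite_finite_induct)
    (auto simp: compactly_supported_0 intro: compactly_supported_add)

lemma compactly_supported_cutoff: "0 < R \<Longrightarrow> compactly_supported (cutoff R)"
  unfolding compactly_supported_def using cutoff_eq_0 less_imp_le by blast

lemma compactly_supported_integrable:
  assumes "compactly_supported g" "continuous_on UNIV g"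
  shows "integrable lborel g"
proof -
  obtain R where R: "\<forall>x. R < norm x \<longrightarrow> g x = 0" using assms unfolding compactly_supported_def by blast
  have "integrable lborel (\<lambda>x. indicator (cball 0 R) x *\<^sub>R g x)"
    by (intro borel_integrable_compact compact_cball continuous_on_subset[OF assms(2)]) auto
  moreover have "(\<lambda>x. indicator (cball 0 R) x *\<^sub>R g x) = g"
    using R by (auto simp: indicator_def fun_eq_iff not_le)
  ultimately show ?thesis by simp
qed

text \<open>By scaling, the gradient is that of \<open>bump\<close> divided by R, and the latter is
  bounded by compactness. A constant of at least 1 can later absorb numerical ones through its
  powers.\<close>

lemma cutoff_gradient_bound: "\<exists>C\<ge>1. \<forall>R>0. \<forall>i x. \<bar>partial i (cutoff R) x\<bar> \<le> C / R"
proof -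
  have "\<exists>C. \<forall>x. \<bar>partial i bump x\<bar> \<le> C" for i
  proof -
    have "compactly_supported bump" unfolding compactly_supported_def using bump_eq_0 less_imp_le by blast
    then obtain R where R: "\<forall>x. R < norm x \<longrightarrow> partial i bump x = 0"
      using compactly_supported_partial unfolding compactly_supported_def by blast
    have "continuous_on (cball 0 R) (partial i bump)"
      using C_infinity_on_imp_continuous_on[OF smooth_partial[OF smooth_bump]] continuous_on_subset by blast
    then have "bounded (partial i bump ` cball 0 R)"
      using compact_continuous_image compact_cball compact_imp_bounded by blast
    then obtain B where "\<forall>x\<in>cball 0 R. \<bar>partial i bump x\<bar> \<le> B" unfolding bounded_iff by auto
    then have "\<bar>partial i bump x\<bar> \<le> max B 0" for x using R by (cases "R < norm x") (force simp: not_less le_max_iff_disj)+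
    then show ?thesis by blast
  qed
  then obtain C where C: "\<And>i x. \<bar>partial i bump x\<bar> \<le> C i" by metis
  \<comment> \<open>Dominates the bounds for all three directions and is at least 1.\<close>
  define D where "D = 1 + (\<Sum>i\<in>UNIV. \<bar>C i\<bar>)"
  have "\<bar>partial i bump x\<bar> \<le> D" for i x
    using C[of i x] member_le_sum[of i UNIV "\<lambda>i. \<bar>C i\<bar>"] unfolding D_def by simp
  then have "\<forall>R>0. \<forall>i x. \<bar>partial i (cutoff R) x\<bar> \<le> D / R"
    by (simp add: partial_cutoff divide_right_mono)
  moreover have "D \<ge> 1" unfolding D_def by (simp add: sum_nonneg)
  ultimately show ?thesis by blast
qed

section \<open>Integration over space\<close>

lemma lborel_translate:
  fixes f :: "real^3 \<Rightarrow> real"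
  assumes "integrable lborel f"
  shows "integrable lborel (\<lambda>x. f (x + c))" "(\<integral>x. f (x + c) \<partial>lborel) = (\<integral>x. f x \<partial>lborel)"
proof -
  have d: "lborel = distr lborel borel ((+) c)" by (rule lborel_distr_plus[symmetric])
  have "integrable (distr lborel borel ((+) c)) f" using assms d by metis
  then show "integrable lborel (\<lambda>x. f (x + c))"
    by (subst (asm) integrable_distr_eq) (use borel_measurable_integrable[OF assms] in \<open>auto simp: add.commute\<close>)
  have "(\<integral>x. f x \<partial>lborel) = (\<integral>x. f x \<partial>(distr lborel borel ((+) c)))" using d by metis
  also have "\<dots> = (\<integral>x. f (c + x) \<partial>lborel)"
    by (rule integral_distr) (use borel_measurable_integrable[OF assms] in auto)
  finally show "(\<integral>x. f (x + c) \<partial>lborel) = (\<integral>x. f x \<partial>lborel)" by (simp add: add.commute)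
qed

text \<open>Integrate \<open>H (x + e) - H x = \<integral> \<partial>\<^sub>i H (x + s e) ds\<close> over space: the left side vanishes by
  translation invariance, the right side is the integral of \<open>\<partial>\<^sub>i H\<close>.\<close>

lemma integral_partial_eq_0:
  fixes H :: "real^3 \<Rightarrow> real"
  assumes H: "smooth H" "integrable lborel H" "integrable lborel (partial i H)"
  shows "(\<integral>x. partial i H x \<partial>lborel) = 0"
proof -
  let ?e = "axis i 1 :: real^3"
  define K where "K s x = indicator {0..1} s * partial i H (x + s *\<^sub>R ?e)" for s :: real and x
  have cont: "continuous_on UNIV (partial i H)"
    by (intro C_infinity_on_imp_continuous_on smooth_partial H)
  have meas: "(\<lambda>p. K (fst p) (snd p)) \<in> borel_measurable (lborel \<Otimes>\<^sub>M lborel)"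
  proof -
    have "continuous_on UNIV (\<lambda>p :: real \<times> (real^3). partial i H (snd p + fst p *\<^sub>R ?e))"
      by (rule continuous_on_compose2[OF cont]) (auto intro!: continuous_intros)
    then have "(\<lambda>p :: real \<times> (real^3). partial i H (snd p + fst p *\<^sub>R ?e)) \<in> borel_measurable borel"
      by (rule borel_measurable_continuous_onI)
    moreover have "(indicator ({0..1} \<times> UNIV) :: real \<times> (real^3) \<Rightarrow> real) \<in> borel_measurable borel"
      by (intro borel_measurable_indicator borel_closed closed_Times) auto
    moreover have "(indicator ({0..1} \<times> UNIV) :: real \<times> (real^3) \<Rightarrow> real) = (\<lambda>p. indicator {0..1} (fst p))"
      by (auto simp: indicator_def fun_eq_iff)
    ultimately show ?thesis unfolding K_def lborel_prod by simp
  qed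
  \<comment> \<open>By translation invariance the spatial integral of the modulus does not depend on
    the shift s, so integrability on the product reduces to that of an indicator function in
    s.\<close>
  have K_norm: "(\<integral>x. norm (K s x) \<partial>lborel) = indicator {0..1} s * (\<integral>x. \<bar>partial i H x\<bar> \<partial>lborel)" for s
    using lborel_translate(2)[OF integrable_abs[OF H(3)], of "s *\<^sub>R ?e"]
    by (simp add: K_def abs_mult)
  have K_int: "integrable lborel (K s)" for s
    unfolding K_def using lborel_translate(1)[OF H(3), of "s *\<^sub>R ?e"] by simp
  have "integrable (lborel \<Otimes>\<^sub>M lborel) (\<lambda>p. K (fst p) (snd p))"
  proof (rule lborel_pair.Fubini_integrable[OF meas])
    have "integrable lborel (\<lambda>s::real. indicator {0..1} s * (\<integral>x. \<bar>partial i H x\<bar> \<partial>lborel) :: real)"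
      by (intro integrable_mult_left integrable_real_indicator) auto
    then show "integrable lborel (\<lambda>s. \<integral>x. norm (K (fst (s, x)) (snd (s, x))) \<partial>lborel)"
      by (simp only: fst_conv snd_conv K_norm)
    show "AE s in lborel. integrable lborel (\<lambda>x. K (fst (s, x)) (snd (s, x)))"
      using K_int by simp
  qed
  then have fub: "(\<integral>x. (\<integral>s. K s x \<partial>lborel) \<partial>lborel) = (\<integral>s. (\<integral>x. K s x \<partial>lborel) \<partial>lborel)"
    by (intro lborel_pair.Fubini_integral) (simp add: case_prod_beta')
  have "(\<integral>s. K s x \<partial>lborel) = H (x + ?e) - H x" for x
  proof -
    have hi: "((\<lambda>s. partial i H (x + s *\<^sub>R ?e)) has_integral H (x + 1 *\<^sub>R ?e) - H (x + 0 *\<^sub>R ?e)) {0..1}"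
      by (rule fundamental_theorem_of_calculus)
        (auto intro: has_vector_derivative_at_within smooth_has_partial[OF H(1)])
    have si: "set_integrable lborel {0..1} (\<lambda>s. partial i H (x + s *\<^sub>R ?e))"
      by (intro borel_integrable_atLeastAtMost' continuous_on_compose2[OF cont]) (auto intro!: continuous_intros)
    have "(\<integral>s\<in>{0..1}. partial i H (x + s *\<^sub>R ?e) \<partial>lborel) = H (x + ?e) - H x"
      using set_borel_integral_eq_integral(2)[OF si] integral_unique[OF hi] by simp
    then show ?thesis by (simp add: K_def set_lebesgue_integral_def)
  qed
  then have "(\<integral>x. (\<integral>s. K s x \<partial>lborel) \<partial>lborel) = 0"
    using lborel_translate[OF H(2), of ?e] H(2) by simp
  moreover have "(\<integral>x. K s x \<partial>lborel) = indicator {0..1} s * (\<integral>x. partial i H x \<partial>lborel)" for s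
    using lborel_translate(2)[OF H(3), of "s *\<^sub>R ?e"] by (simp add: K_def)
  then have "(\<integral>s. (\<integral>x. K s x \<partial>lborel) \<partial>lborel) = (\<integral>x. partial i H x \<partial>lborel)"
    by simp
  ultimately show ?thesis using fub by simp
qed

lemma integral_partial_eq_0_compact:
  fixes H :: "real^3 \<Rightarrow> real"
  assumes "smooth H" "compactly_supported H"
  shows "(\<integral>x. partial i H x \<partial>lborel) = 0"
  by (intro integral_partial_eq_0 assms compactly_supported_integrable compactly_supported_partial
      C_infinity_on_imp_continuous_on smooth_partial)

lemma smooth_borel_measurable: "smooth (g :: real^3 \<Rightarrow> real) \<Longrightarrow> g \<in> borel_measurable borel"
  by (intro borel_measurable_continuous_onI C_infinity_on_imp_continuous_on)

text \<open>Fatou's lemma. Integrability is part of the conclusion, so that finiteness of a global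
  integral can be deduced from bounds uniform in the radius.\<close>

lemma integrable_if_cutoff_bounded:
  fixes h :: "real^3 \<Rightarrow> real"
  assumes h: "h \<in> borel_measurable borel" "\<And>x. 0 \<le> h x"
    and int: "\<And>n. integrable lborel (\<lambda>x. cutoff (real (Suc n)) x ^ m * h x)"
    and bound: "\<And>n. (\<integral>x. cutoff (real (Suc n)) x ^ m * h x \<partial>lborel) \<le> C"
  shows "integrable lborel h" "(\<integral>x. h x \<partial>lborel) \<le> C"
proof -
  let ?f = "\<lambda>n x. cutoff (real (Suc n)) x ^ m * h x"
  have nn: "0 \<le> ?f n x" for n x using cutoff_nonneg h by simp
  have "0 \<le> (\<integral>x. ?f 0 x \<partial>lborel)" by (intro integral_nonneg_AE AE_I2 nn)
  with bound[of 0] have C: "0 \<le> C" by linarith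
  have lim: "(\<lambda>n. ?f n x) \<longlonglongrightarrow> 1 ^ m * h x" for x
    by (intro tendsto_intros cutoff_tendsto)
  have "(\<integral>\<^sup>+x. ennreal (h x) \<partial>lborel) = (\<integral>\<^sup>+x. liminf (\<lambda>n. ennreal (?f n x)) \<partial>lborel)"
  proof (rule nn_integral_cong)
    fix x
    have "(\<lambda>n. ennreal (?f n x)) \<longlonglongrightarrow> ennreal (h x)" using lim[of x] tendsto_ennrealI by fastforce
    then show "ennreal (h x) = liminf (\<lambda>n. ennreal (?f n x))"
      using lim_imp_Liminf trivial_limit_sequentially by metis
  qed
  also have "\<dots> \<le> liminf (\<lambda>n. \<integral>\<^sup>+x. ennreal (?f n x) \<partial>lborel)"
    by (intro nn_integral_liminf) (use int borel_measurable_integrable in \<open>auto intro!: measurable_compose[OF _ measurable_ennreal]\<close>)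
  also have "\<dots> = liminf (\<lambda>n. ennreal (\<integral>x. ?f n x \<partial>lborel))"
    using nn_integral_eq_integral[OF int] nn by simp
  also have "\<dots> \<le> liminf (\<lambda>n. ennreal C)"
    by (intro Liminf_mono always_eventually allI ennreal_leI bound)
  also have "\<dots> = ennreal C" by (simp add: Liminf_const)
  finally have le: "(\<integral>\<^sup>+x. ennreal (h x) \<partial>lborel) \<le> ennreal C" .
  show i: "integrable lborel h"
    by (rule integrableI_nonneg) (use h le in \<open>auto intro: le_less_trans\<close>)
  have "ennreal (\<integral>x. h x \<partial>lborel) \<le> ennreal C"
    using le nn_integral_eq_integral[OF i] h by simp
  then show "(\<integral>x. h x \<partial>lborel) \<le> C" using C by simp
qed

lemma integrable_cutoff_mult:
  fixes h :: "real^3 \<Rightarrow> real"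
  assumes h: "integrable lborel h"
  shows "integrable lborel (\<lambda>x. cutoff R x ^ m * h x)"
proof (rule Bochner_Integration.integrable_bound[OF h])
  show "(\<lambda>x. cutoff R x ^ m * h x) \<in> borel_measurable lborel"
    using borel_measurable_integrable[OF h] smooth_borel_measurable[OF smooth_cutoff] by simp
  have "cutoff R x ^ m * \<bar>h x\<bar> \<le> 1 * \<bar>h x\<bar>" for x
    by (intro mult_right_mono power_le_one cutoff_nonneg cutoff_le_1) auto
  then show "AE x in lborel. norm (cutoff R x ^ m * h x) \<le> norm (h x)"
    by (simp add: abs_mult cutoff_nonneg)
qed

lemma integral_cutoff_le:
  fixes h :: "real^3 \<Rightarrow> real"
  assumes "integrable lborel h" "\<And>x. 0 \<le> h x"
  shows "(\<integral>x. cutoff R x ^ m * h x \<partial>lborel) \<le> (\<integral>x. h x \<partial>lborel)"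
proof (rule integral_mono[OF integrable_cutoff_mult[OF assms(1)] assms(1)])
  fix x
  have "cutoff R x ^ m * h x \<le> 1 * h x"
    by (intro mult_right_mono power_le_one cutoff_nonneg cutoff_le_1 assms)
  then show "cutoff R x ^ m * h x \<le> h x" by simp
qed

lemma integral_cutoff_tendsto:
  fixes h :: "real^3 \<Rightarrow> real"
  assumes h: "integrable lborel h"
  shows "(\<lambda>n. \<integral>x. cutoff (real (Suc n)) x ^ m * h x \<partial>lborel) \<longlonglongrightarrow> (\<integral>x. h x \<partial>lborel)"
proof (rule integral_dominated_convergence[where w = "\<lambda>x. \<bar>h x\<bar>"])
  show "(\<lambda>x. cutoff (real (Suc n)) x ^ m * h x) \<in> borel_measurable lborel" for n
    by (rule borel_measurable_integrable[OF integrable_cutoff_mult[OF h]])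
  have "(\<lambda>n. cutoff (real (Suc n)) x ^ m * h x) \<longlonglongrightarrow> 1 ^ m * h x" for x
    by (intro tendsto_intros cutoff_tendsto)
  then show "AE x in lborel. (\<lambda>n. cutoff (real (Suc n)) x ^ m * h x) \<longlonglongrightarrow> h x" by simp
  have "cutoff R x ^ m * \<bar>h x\<bar> \<le> 1 * \<bar>h x\<bar>" for x R
    by (intro mult_right_mono power_le_one cutoff_nonneg cutoff_le_1) auto
  then show "AE x in lborel. norm (cutoff (real (Suc n)) x ^ m * h x) \<le> \<bar>h x\<bar>" for n
    by (simp add: abs_mult cutoff_nonneg)
qed (use h borel_measurable_integrable in auto)

lemma smooth_compact_integrable:
  "smooth g \<Longrightarrow> compactly_supported g \<Longrightarrow> integrable lborel (g :: real^3 \<Rightarrow> real)"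
  by (intro compactly_supported_integrable C_infinity_on_imp_continuous_on)

lemma integrable_square_add:
  fixes f g :: "'a \<Rightarrow> real"
  assumes f: "f \<in> borel_measurable M" "integrable M (\<lambda>x. (f x)\<^sup>2)"
    and g: "g \<in> borel_measurable M" "integrable M (\<lambda>x. (g x)\<^sup>2)"
  shows "integrable M (\<lambda>x. (f x + g x)\<^sup>2)"
    "(\<integral>x. (f x + g x)\<^sup>2 \<partial>M) \<le> 2 * (\<integral>x. (f x)\<^sup>2 \<partial>M) + 2 * (\<integral>x. (g x)\<^sup>2 \<partial>M)"
proof -
  have le: "(f x + g x)\<^sup>2 \<le> 2 * (f x)\<^sup>2 + 2 * (g x)\<^sup>2" for x
    using sum_squares_bound[of "f x" "g x"] by (simp add: power2_sum)
  show i: "integrable M (\<lambda>x. (f x + g x)\<^sup>2)"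
    by (rule Bochner_Integration.integrable_bound[of _ "\<lambda>x. 2 * (f x)\<^sup>2 + 2 * (g x)\<^sup>2"]) (use le f g in auto)
  have "(\<integral>x. (f x + g x)\<^sup>2 \<partial>M) \<le> (\<integral>x. 2 * (f x)\<^sup>2 + 2 * (g x)\<^sup>2 \<partial>M)"
    by (intro integral_mono i) (use le f g in auto)
  then show "(\<integral>x. (f x + g x)\<^sup>2 \<partial>M) \<le> 2 * (\<integral>x. (f x)\<^sup>2 \<partial>M) + 2 * (\<integral>x. (g x)\<^sup>2 \<partial>M)"
    using f g by simp
qed

lemma integrable_product:
  fixes f g :: "'a \<Rightarrow> real"
  assumes f: "f \<in> borel_measurable M" "integrable M (\<lambda>x. (f x)\<^sup>2)"
    and g: "g \<in> borel_measurable M" "integrable M (\<lambda>x. (g x)\<^sup>2)"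
  shows "integrable M (\<lambda>x. f x * g x)"
proof (rule Bochner_Integration.integrable_bound[of _ "\<lambda>x. (f x)\<^sup>2 + (g x)\<^sup>2"])
  have "2 * \<bar>f x * g x\<bar> \<le> (f x)\<^sup>2 + (g x)\<^sup>2" for x
    using sum_squares_bound[of "\<bar>f x\<bar>" "\<bar>g x\<bar>"] by (simp add: abs_mult)
  then have "\<bar>f x * g x\<bar> \<le> (f x)\<^sup>2 + (g x)\<^sup>2" for x by (smt (verit) abs_ge_zero)
  then show "AE x in M. norm (f x * g x) \<le> norm ((f x)\<^sup>2 + (g x)\<^sup>2)" by simp
qed (use f g in auto)

section \<open>Interpolation inequalities\<close>

text \<open>A fixed witness of \<open>cutoff_gradient_bound\<close>, so that later constants can be
  given by closed terms.\<close>

definition cutoff_const :: real where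
  "cutoff_const = (SOME C. C \<ge> 1 \<and> (\<forall>R>0. \<forall>i x. \<bar>partial i (cutoff R) x\<bar> \<le> C / R))"

lemma cutoff_const: "1 \<le> cutoff_const" "0 < R \<Longrightarrow> \<bar>partial i (cutoff R) x\<bar> \<le> cutoff_const / R"
proof -
  have "\<exists>C. C \<ge> 1 \<and> (\<forall>R>0. \<forall>i x. \<bar>partial i (cutoff R) x\<bar> \<le> C / R)"
    using cutoff_gradient_bound by blast
  from someI_ex[OF this] show "1 \<le> cutoff_const" "0 < R \<Longrightarrow> \<bar>partial i (cutoff R) x\<bar> \<le> cutoff_const / R"
    unfolding cutoff_const_def by blast+
qed

lemma cutoff_gradient_sq: "1 \<le> R \<Longrightarrow> (partial i (cutoff R) x)\<^sup>2 \<le> cutoff_const\<^sup>2"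
proof -
  assume R: "1 \<le> R"
  have "cutoff_const / R \<le> cutoff_const" using R cutoff_const(1) by (simp add: field_simps mult_left_mono)
  then have "\<bar>partial i (cutoff R) x\<bar> \<le> cutoff_const" using cutoff_const(2)[of R i x] R by linarith
  then show ?thesis by (metis abs_ge_zero power2_abs power_mono)
qed

text \<open>Let a be the first and b the second derivative of v in direction i. Integrating by parts
  in a * a^3 turns the integral of a^4 into that of - 3 v a^2 b, and Young's inequality with |v| <=
  M returns a part of a^4 to the left. The cut-off adds a term v a^3 times its gradient, which costs
  the integral of a^2.\<close>

lemma integral_partial_pow4_le:
  fixes v :: "real^3 \<Rightarrow> real"
  assumes v: "smooth v" "\<And>x. \<bar>v x\<bar> \<le> M"
    and i1: "integrable lborel (\<lambda>x. (partial i v x)\<^sup>2)"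
    and i2: "integrable lborel (\<lambda>x. (partial i (partial i v) x)\<^sup>2)"
  shows "integrable lborel (\<lambda>x. partial i v x ^ 4)"
    "(\<integral>x. partial i v x ^ 4 \<partial>lborel) \<le>
      18 * M\<^sup>2 * cutoff_const\<^sup>2 * ((\<integral>x. (partial i v x)\<^sup>2 \<partial>lborel) + (\<integral>x. (partial i (partial i v) x)\<^sup>2 \<partial>lborel))"
proof -
  let ?a = "partial i v" and ?b = "partial i (partial i v)"
  let ?W = "\<lambda>x. 9 * M\<^sup>2 * (?b x)\<^sup>2 + 4 * M\<^sup>2 * cutoff_const\<^sup>2 * (?a x)\<^sup>2"
  note sm = v(1) smooth_partial[OF v(1), of i] smooth_partial[OF smooth_partial[OF v(1), of i], of i]
  have iW: "integrable lborel ?W" using i1 i2 by simp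
  have key: "(\<integral>x. cutoff (real (Suc n)) x ^ 2 * ?a x ^ 4 \<partial>lborel) \<le> 2 * (\<integral>x. ?W x \<partial>lborel)"
    and int: "integrable lborel (\<lambda>x. cutoff (real (Suc n)) x ^ 2 * ?a x ^ 4)" for n
  proof -
    let ?c = "cutoff (real (Suc n))"
    let ?H = "\<lambda>x. ?c x ^ 2 * (v x * ?a x ^ 3)"
    have cs: "compactly_supported ?c" by (rule compactly_supported_cutoff) simp
    have sH: "smooth ?H" by (intro smooth_intros sm)
    have cH: "compactly_supported ?H"
      by (intro compactly_supported_mult1 compactly_supported_power cs) simp
    have pH: "partial i ?H = (\<lambda>x. 2 * ?c x * partial i ?c x * (v x * ?a x ^ 3)
        + ?c x ^ 2 * (?a x ^ 4 + 3 * v x * (?a x)\<^sup>2 * ?b x))"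
      by (simp add: partial_mult partial_power smooth_intros sm fun_eq_iff power4_eq_xxxx power3_eq_cube
          power2_eq_square algebra_simps)
    have ip: "integrable lborel (partial i ?H)"
      by (intro smooth_compact_integrable smooth_partial sH compactly_supported_partial cH)
    show int: "integrable lborel (\<lambda>x. ?c x ^ 2 * ?a x ^ 4)"
      by (intro smooth_compact_integrable smooth_intros sm compactly_supported_mult1 compactly_supported_power cs) simp
    have pw: "(1/2) * (?c x ^ 2 * ?a x ^ 4) \<le> partial i ?H x + ?W x" for x
    proof -
      define c d a b w where "c = ?c x" "d = partial i ?c x" "a = ?a x" "b = ?b x" "w = v x"
      have c: "0 \<le> c" "c \<le> 1" unfolding c_d_a_b_w_def by (simp_all add: cutoff_nonneg cutoff_le_1)
      have d: "d\<^sup>2 \<le> cutoff_const\<^sup>2" unfolding c_d_a_b_w_def by (rule cutoff_gradient_sq) simp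
      have w: "w\<^sup>2 \<le> M\<^sup>2" using v(2)[of x] unfolding c_d_a_b_w_def
        by (metis abs_ge_zero power2_abs power_mono)
      \<comment> \<open>Two completed squares, each giving up a quarter of c^2 a^4 so that half of
        it survives. Their remainders, 4 w^2 d^2 a^2 and 9 w^2 c^2 b^2, yield the two parts of
        \<open>?W\<close>.\<close>
      have 1: "- (2 * c * d * (w * a^3)) \<le> (1/4) * (c\<^sup>2 * a^4) + 4 * (w\<^sup>2 * d\<^sup>2 * a\<^sup>2)"
        using zero_le_power2[of "(1/2) * c * a\<^sup>2 + 2 * w * d * a"]
        by (simp add: power2_eq_square power3_eq_cube power4_eq_xxxx algebra_simps)
      have 2: "- (c\<^sup>2 * (3 * w * a\<^sup>2 * b)) \<le> (1/4) * (c\<^sup>2 * a^4) + 9 * (w\<^sup>2 * (c\<^sup>2 * b\<^sup>2))"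
        using zero_le_power2[of "(1/2) * c * a\<^sup>2 + 3 * w * c * b"]
        by (simp add: power2_eq_square power3_eq_cube power4_eq_xxxx algebra_simps)
      have 3: "w\<^sup>2 * d\<^sup>2 * a\<^sup>2 \<le> M\<^sup>2 * cutoff_const\<^sup>2 * a\<^sup>2"
        using w d by (intro mult_right_mono mult_mono) auto
      have "c\<^sup>2 \<le> 1" using c by (simp add: power_le_one)
      then have 4: "w\<^sup>2 * (c\<^sup>2 * b\<^sup>2) \<le> M\<^sup>2 * (1 * b\<^sup>2)"
        using w by (intro mult_mono mult_right_mono) auto
      have "(1/2) * (c\<^sup>2 * a^4) \<le> 2 * c * d * (w * a ^ 3) + c\<^sup>2 * (a ^ 4 + 3 * w * a\<^sup>2 * b)
          + (9 * M\<^sup>2 * b\<^sup>2 + 4 * M\<^sup>2 * cutoff_const\<^sup>2 * a\<^sup>2)"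
        using 1 2 3 4 by (simp add: distrib_left)
      then show ?thesis unfolding pH c_d_a_b_w_def .
    qed
    have "(\<integral>x. (1/2) * (?c x ^ 2 * ?a x ^ 4) \<partial>lborel) \<le> (\<integral>x. partial i ?H x + ?W x \<partial>lborel)"
      by (rule integral_mono) (use int ip iW pw in auto)
    also have "\<dots> = (\<integral>x. ?W x \<partial>lborel)"
      using integral_partial_eq_0_compact[OF sH cH] ip iW by simp
    finally show "(\<integral>x. ?c x ^ 2 * ?a x ^ 4 \<partial>lborel) \<le> 2 * (\<integral>x. ?W x \<partial>lborel)"
      by simp
  qed
  have meas: "(\<lambda>x. ?a x ^ 4) \<in> borel_measurable borel"
    by (intro smooth_borel_measurable smooth_intros sm)
  show "integrable lborel (\<lambda>x. ?a x ^ 4)"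
    by (rule integrable_if_cutoff_bounded(1)[OF meas _ int key]) simp
  have "(\<integral>x. ?a x ^ 4 \<partial>lborel) \<le> 2 * (\<integral>x. ?W x \<partial>lborel)"
    by (rule integrable_if_cutoff_bounded(2)[OF meas _ int key]) simp
  also have "\<dots> = 18 * M\<^sup>2 * 1 * (\<integral>x. (?b x)\<^sup>2 \<partial>lborel) + 8 * M\<^sup>2 * cutoff_const\<^sup>2 * (\<integral>x. (?a x)\<^sup>2 \<partial>lborel)"
    using i1 i2 by simp
  also have "\<dots> \<le> 18 * M\<^sup>2 * cutoff_const\<^sup>2 * (\<integral>x. (?b x)\<^sup>2 \<partial>lborel) + 18 * M\<^sup>2 * cutoff_const\<^sup>2 * (\<integral>x. (?a x)\<^sup>2 \<partial>lborel)"
    using cutoff_const(1) by (intro add_mono mult_right_mono mult_left_mono) (auto simp: one_le_power)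
  finally show "(\<integral>x. ?a x ^ 4 \<partial>lborel) \<le>
      18 * M\<^sup>2 * cutoff_const\<^sup>2 * ((\<integral>x. (?a x)\<^sup>2 \<partial>lborel) + (\<integral>x. (?b x)\<^sup>2 \<partial>lborel))"
    by (simp add: algebra_simps)
qed

text \<open>The third coordinate comes first, so that a slice is a pair.\<close>

definition coords :: "real \<times> real \<times> real \<Rightarrow> real^3" where
  "coords p = fst p *\<^sub>R axis 3 1 + fst (snd p) *\<^sub>R axis 1 1 + snd (snd p) *\<^sub>R axis 2 1"

lemma coords_nth:
  "coords (c, a, b) $ 1 = a" "coords (c, a, b) $ 2 = b" "coords (c, a, b) $ 3 = c"
  by (simp_all add: coords_def axis_def)

lemma continuous_coords: "continuous_on UNIV coords"
  unfolding coords_def by (intro continuous_intros)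

text \<open>Lebesgue measure is determined by its values on boxes, and the preimage of a box under
  \<open>coords\<close> is a product of three intervals, only in another order.\<close>

lemma distr_coords: "distr lborel borel coords = lborel"
proof (rule lborel_eqI[symmetric])
  have [measurable]: "coords \<in> borel \<rightarrow>\<^sub>M borel"
    by (rule borel_measurable_continuous_onI[OF continuous_coords])
  fix l u :: "real^3" assume le: "\<And>b. b \<in> Basis \<Longrightarrow> l \<bullet> b \<le> u \<bullet> b"
  then have le': "l $ i \<le> u $ i" for i by (metis axis_in_Basis_iff Basis_real_def insertI1 inner_axis inner_real_def mult.right_neutral)
  have "coords -` box l u = {l $ 3<..<u $ 3} \<times> {l $ 1<..<u $ 1} \<times> {l $ 2<..<u $ 2}"
    by (auto simp: mem_box_cart forall_3 coords_nth)
  then have 1: "emeasure (distr lborel borel coords) (box l u)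
      = emeasure lborel ({l $ 3<..<u $ 3} \<times> {l $ 1<..<u $ 1} \<times> {l $ 2<..<u $ 2})"
    by (subst emeasure_distr) auto
  have 2: "emeasure lborel ({l $ 3<..<u $ 3} \<times> {l $ 1<..<u $ 1} \<times> {l $ 2<..<u $ 2})
      = emeasure lborel {l $ 3<..<u $ 3} * emeasure lborel ({l $ 1<..<u $ 1} \<times> {l $ 2<..<u $ 2})"
    by (subst lborel_prod[symmetric], rule lborel.emeasure_pair_measure_Times)
      (auto intro!: borel_open open_Times simp: sets_lborel)
  have 3: "emeasure lborel ({l $ 1<..<u $ 1} \<times> {l $ 2<..<u $ 2})
      = emeasure lborel {l $ 1<..<u $ 1} * emeasure lborel {l $ 2<..<u $ 2}"
    by (subst lborel_prod[symmetric], rule lborel.emeasure_pair_measure_Times) auto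
  have "prod f UNIV = f 3 * (f 1 * f 2)" for f :: "3 \<Rightarrow> real"
    unfolding UNIV_3 by simp
  then have "(\<Prod>i\<in>UNIV. u $ i - l $ i) = (u $ 3 - l $ 3) * ((u $ 1 - l $ 1) * (u $ 2 - l $ 2))" .
  then have "emeasure (distr lborel borel coords) (box l u) = ennreal (\<Prod>i\<in>UNIV. u $ i - l $ i)"
    unfolding 1 2 3 using le' by (simp only: emeasure_lborel_Ioo ennreal_mult mult_nonneg_nonneg diff_ge_0_iff_ge)
  also have "(\<Prod>i\<in>UNIV. u $ i - l $ i) = (\<Prod>b\<in>Basis. (u - l) \<bullet> b)"
  proof -
    have B: "(Basis :: (real^3) set) = (\<lambda>i. axis i 1) ` UNIV" by (auto simp: Basis_vec_def)
    have "inj (\<lambda>i::3. axis i (1::real))" by (auto simp: inj_on_def axis_eq_axis)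
    then show ?thesis unfolding B by (subst prod.reindex) (auto simp: inner_axis)
  qed
  finally show "emeasure (distr lborel borel coords) (box l u) = ennreal (\<Prod>b\<in>Basis. (u - l) \<bullet> b)" .
qed simp

lemma nn_integral_coords:
  assumes [measurable]: "f \<in> borel_measurable borel"
  shows "(\<integral>\<^sup>+x. f x \<partial>lborel) = (\<integral>\<^sup>+c. (\<integral>\<^sup>+z. f (coords (c, z)) \<partial>lborel) \<partial>lborel)"
proof -
  have [measurable]: "coords \<in> borel \<rightarrow>\<^sub>M borel"
    by (rule borel_measurable_continuous_onI[OF continuous_coords])
  have "(\<integral>\<^sup>+x. f x \<partial>lborel) = (\<integral>\<^sup>+x. f x \<partial>distr lborel borel coords)" by (simp add: distr_coords)
  also have "\<dots> = (\<integral>\<^sup>+p. f (coords p) \<partial>lborel)" by (subst nn_integral_distr) auto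
  also have "\<dots> = (\<integral>\<^sup>+p. f (coords p) \<partial>(lborel \<Otimes>\<^sub>M lborel))" by (simp add: lborel_prod)
  also have "\<dots> = (\<integral>\<^sup>+c. (\<integral>\<^sup>+z. f (coords (c, z)) \<partial>lborel) \<partial>lborel)"
    by (rule lborel.nn_integral_fst[symmetric]) (simp add: lborel_prod)
  finally show ?thesis .
qed

lemma ennreal_power2_le_imp_le:
  fixes a b :: ennreal
  assumes "a\<^sup>2 \<le> b\<^sup>2" shows "a \<le> b"
proof (cases "b = \<infinity>")
  case False
  then obtain r where r: "b = ennreal r" "0 \<le> r" by (cases b) auto
  have "a \<noteq> \<infinity>"
  proof
    assume "a = \<infinity>"
    then have "\<infinity> \<le> ennreal (r\<^sup>2)" using assms r by (simp add: power2_eq_square ennreal_mult)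
    then show False by (simp add: top_unique)
  qed
  then obtain s where s: "a = ennreal s" "0 \<le> s" by (cases a) auto
  have "ennreal (s\<^sup>2) \<le> ennreal (r\<^sup>2)"
    using assms unfolding r(1) s(1) ennreal_power[OF r(2)] ennreal_power[OF s(2)] .
  then have "s\<^sup>2 \<le> r\<^sup>2" by (rule ennreal_le_iff[THEN iffD1, rotated]) simp
  then have "s \<le> r" by (rule power2_le_imp_le[OF _ r(2)])
  then show ?thesis unfolding r(1) s(1) by (rule ennreal_leI)
qed simp

text \<open>Along the line v^2 is the integral of its derivative 2 v D_i v from a point outside the
  support. Extending the modulus to the whole line makes the bound independent of the coordinate
  \<open>a\<close>, which is the gain.\<close>

lemma sq_le_line_integral:
  fixes v :: "real^3 \<Rightarrow> real"
  assumes v: "smooth v" "compactly_supported v"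
  shows "ennreal ((v (y + a *\<^sub>R axis i 1))\<^sup>2)
    \<le> (\<integral>\<^sup>+s. ennreal \<bar>2 * v (y + s *\<^sub>R axis i 1) * partial i v (y + s *\<^sub>R axis i 1)\<bar> \<partial>lborel)"
proof -
  let ?x = "\<lambda>s. y + s *\<^sub>R axis i (1::real) :: real^3"
  let ?g = "\<lambda>s. 2 * v (?x s) * partial i v (?x s)"
  obtain R where R: "\<forall>x. R < norm x \<longrightarrow> v x = 0" using v unfolding compactly_supported_def by blast
  \<comment> \<open>So far out that the point with parameter \<open>b\<close> lies outside the ball
    of radius \<open>R\<close>, and to the left of \<open>a\<close>.\<close>
  define b where "b = - (\<bar>R\<bar> + norm y + \<bar>a\<bar> + 1)"
  have "\<bar>b\<bar> = norm (?x b - y)" by simp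
  also have "\<dots> \<le> norm (?x b) + norm y" by (rule norm_triangle_ineq4)
  finally have "R < norm (?x b)" unfolding b_def by linarith
  then have vb: "v (?x b) = 0" using R by blast
  have ba: "b \<le> a" unfolding b_def using norm_ge_zero[of y] by linarith
  have cont: "continuous_on UNIV (\<lambda>s. \<bar>?g s\<bar>)"
    by (intro continuous_intros continuous_on_compose2[OF C_infinity_on_imp_continuous_on[OF v(1)]]
      continuous_on_compose2[OF C_infinity_on_imp_continuous_on[OF smooth_partial[OF v(1)]]]) auto
  have fr: "((\<lambda>s. (v (?x s))\<^sup>2) has_real_derivative ?g s) (at s)" for s
  proof -
    have "((\<lambda>s. v (?x s)) has_real_derivative partial i v (?x s)) (at s)"
      using smooth_has_partial[OF v(1)] by (simp add: has_real_derivative_iff_has_vector_derivative)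
    from DERIV_power[OF this, of 2] show ?thesis by (simp add: mult_ac)
  qed
  have hi: "(?g has_integral (v (?x a))\<^sup>2 - (v (?x b))\<^sup>2) {b..a}"
    by (intro fundamental_theorem_of_calculus ba)
      (use fr in \<open>auto simp: has_real_derivative_iff_has_vector_derivative intro: has_vector_derivative_at_within\<close>)
  have si: "set_integrable lborel {b..a} (\<lambda>s. \<bar>?g s\<bar>)"
    by (intro borel_integrable_atLeastAtMost' continuous_on_subset[OF cont]) auto
  have "(v (?x a))\<^sup>2 = integral {b..a} ?g" using integral_unique[OF hi] vb by simp
  also have "\<dots> \<le> integral {b..a} (\<lambda>s. \<bar>?g s\<bar>)"
    using hi set_borel_integral_eq_integral(1)[OF si] by (intro integral_le) auto
  also have "\<dots> = (\<integral>s\<in>{b..a}. \<bar>?g s\<bar> \<partial>lborel)" by (rule set_borel_integral_eq_integral(2)[OF si, symmetric])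
  finally have "ennreal ((v (?x a))\<^sup>2) \<le> ennreal (\<integral>s. indicator {b..a} s * \<bar>?g s\<bar> \<partial>lborel)"
    unfolding set_lebesgue_integral_def by (simp add: ennreal_leI)
  also have "\<dots> = (\<integral>\<^sup>+s. ennreal (indicator {b..a} s * \<bar>?g s\<bar>) \<partial>lborel)"
    using si unfolding set_integrable_def by (intro nn_integral_eq_integral[symmetric]) auto
  also have "\<dots> \<le> (\<integral>\<^sup>+s. ennreal \<bar>?g s\<bar> \<partial>lborel)"
    by (intro nn_integral_mono ennreal_leI) (auto simp: indicator_def)
  finally show ?thesis .
qed


text \<open>Cauchy-Schwarz on one slice; the 4 is the square of the 2 that comes from
  differentiating v^2.\<close>

lemma nn_integral_slice_bound:
  fixes v :: "real^3 \<Rightarrow> real"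
  assumes v: "smooth v"
  shows "(\<integral>\<^sup>+z. ennreal \<bar>2 * v (coords (c, z)) * partial i v (coords (c, z))\<bar> \<partial>lborel)\<^sup>2
    \<le> 4 * (\<integral>\<^sup>+z. ennreal ((v (coords (c, z)))\<^sup>2) \<partial>lborel) * (\<integral>\<^sup>+z. ennreal ((partial i v (coords (c, z)))\<^sup>2) \<partial>lborel)"
proof -
  have [measurable]: "coords \<in> borel \<rightarrow>\<^sub>M borel"
    by (rule borel_measurable_continuous_onI[OF continuous_coords])
  have [measurable]: "v \<in> borel_measurable borel" "partial i v \<in> borel_measurable borel"
    by (intro smooth_borel_measurable smooth_partial v)+
  have [measurable]: "(\<lambda>z. (c, z)) \<in> borel \<rightarrow>\<^sub>M (borel :: (real \<times> real \<times> real) measure)"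
    by (intro borel_measurable_continuous_onI continuous_intros)
  have "(\<integral>\<^sup>+z. ennreal \<bar>2 * v (coords (c, z)) * partial i v (coords (c, z))\<bar> \<partial>lborel)
      = (\<integral>\<^sup>+z. ennreal (2 * \<bar>v (coords (c, z))\<bar>) * ennreal \<bar>partial i v (coords (c, z))\<bar> \<partial>lborel)"
    by (simp add: abs_mult flip: ennreal_mult')
  then have "(\<integral>\<^sup>+z. ennreal \<bar>2 * v (coords (c, z)) * partial i v (coords (c, z))\<bar> \<partial>lborel)\<^sup>2
      \<le> (\<integral>\<^sup>+z. (ennreal (2 * \<bar>v (coords (c, z))\<bar>))\<^sup>2 \<partial>lborel) * (\<integral>\<^sup>+z. (ennreal \<bar>partial i v (coords (c, z))\<bar>)\<^sup>2 \<partial>lborel)"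
    by (simp only:) (rule Cauchy_Schwarz_nn_integral; measurable)
  also have "(\<lambda>z. (ennreal (2 * \<bar>v (coords (c, z))\<bar>))\<^sup>2) = (\<lambda>z. 4 * ennreal ((v (coords (c, z)))\<^sup>2))"
  proof
    fix z
    have "(ennreal (2 * \<bar>v (coords (c, z))\<bar>))\<^sup>2 = ennreal (4 * (v (coords (c, z)))\<^sup>2)"
      by (simp add: ennreal_power power_mult_distrib)
    then show "(ennreal (2 * \<bar>v (coords (c, z))\<bar>))\<^sup>2 = 4 * ennreal ((v (coords (c, z)))\<^sup>2)"
      by (simp add: ennreal_mult)
  qed
  also have "(\<lambda>z. (ennreal \<bar>partial i v (coords (c, z))\<bar>)\<^sup>2) = (\<lambda>z. ennreal ((partial i v (coords (c, z)))\<^sup>2))"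
    by (simp add: ennreal_power)
  also have "(\<integral>\<^sup>+z. 4 * ennreal ((v (coords (c, z)))\<^sup>2) \<partial>lborel) = 4 * (\<integral>\<^sup>+z. ennreal ((v (coords (c, z)))\<^sup>2) \<partial>lborel)"
    by (rule nn_integral_cmult) measurable
  finally show ?thesis .
qed

text \<open>On a slice of constant third coordinate, \<open>v\<^sup>2\<close> is bounded by a line integral in direction 1
  and by one in direction 2, so that \<open>v\<^sup>4\<close> is bounded by a product of functions of separate
  variables; a third line integral bounds the slice norm uniformly.\<close>

lemma ladyzhenskaya_compact_nn:
  fixes v :: "real^3 \<Rightarrow> real"
  assumes v: "smooth v" "compactly_supported v"
  defines "S \<equiv> (\<integral>\<^sup>+x. ennreal ((v x)\<^sup>2) \<partial>lborel)"
    and "V \<equiv> (\<lambda>i. \<integral>\<^sup>+x. ennreal ((partial i v x)\<^sup>2) \<partial>lborel)"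
  shows "(\<integral>\<^sup>+x. ennreal (v x ^ 4) \<partial>lborel) \<le> 2 * (S + V 3) * (V 1 + V 2)"
proof -
  have [measurable]: "coords \<in> borel \<rightarrow>\<^sub>M borel"
    by (rule borel_measurable_continuous_onI[OF continuous_coords])
  have [measurable]: "v \<in> borel_measurable borel" "partial i v \<in> borel_measurable borel" for i
    by (intro smooth_borel_measurable smooth_partial v)+
  have [measurable]: "(\<lambda>z. (c, z)) \<in> borel \<rightarrow>\<^sub>M (borel :: (real \<times> real \<times> real) measure)" for c
    by (intro borel_measurable_continuous_onI continuous_intros)
  have [measurable]: "(\<lambda>b. (c, a, b)) \<in> borel \<rightarrow>\<^sub>M (borel :: (real \<times> real \<times> real) measure)"
    "(\<lambda>a. (c, a, b)) \<in> borel \<rightarrow>\<^sub>M (borel :: (real \<times> real \<times> real) measure)"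
    "(\<lambda>c. (c, a, b)) \<in> borel \<rightarrow>\<^sub>M (borel :: (real \<times> real \<times> real) measure)" for a b c
    by (intro borel_measurable_continuous_onI continuous_intros)+
  define D where "D i p = ennreal \<bar>2 * v (coords p) * partial i v (coords p)\<bar>" for i p
  have [measurable]: "D i \<in> borel_measurable borel" for i unfolding D_def by measurable
  define s where "s c = (\<integral>\<^sup>+z. ennreal ((v (coords (c, z)))\<^sup>2) \<partial>lborel)" for c
  define w where "w i c = (\<integral>\<^sup>+z. ennreal ((partial i v (coords (c, z)))\<^sup>2) \<partial>lborel)" for i c
  have prod_meas: "lborel \<Otimes>\<^sub>M lborel = (lborel :: (real \<times> real) measure)" by (rule lborel_prod)
  \<comment> \<open>The base point has coordinate 0 in the direction of integration, so the bound
    depends only on the other coordinates; likewise for the next two directions.\<close>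
  have line1: "ennreal ((v (coords (c, a, b)))\<^sup>2) \<le> (\<integral>\<^sup>+r. D 1 (c, r, b) \<partial>lborel)" for a b c
    using sq_le_line_integral[OF v, of "coords (c, 0, b)" a 1] by (simp add: coords_def D_def add_ac)
  have line2: "ennreal ((v (coords (c, a, b)))\<^sup>2) \<le> (\<integral>\<^sup>+r. D 2 (c, a, r) \<partial>lborel)" for a b c
    using sq_le_line_integral[OF v, of "coords (c, a, 0)" b 2] by (simp add: coords_def D_def add_ac)
  have line3: "ennreal ((v (coords (c, z)))\<^sup>2) \<le> (\<integral>\<^sup>+r. D 3 (r, z) \<partial>lborel)" for z c
    using sq_le_line_integral[OF v, of "coords (0, z)" c 3] by (simp add: coords_def D_def add_ac)
  have slice: "(\<integral>\<^sup>+z. ennreal (v (coords (c, z)) ^ 4) \<partial>lborel) \<le> 2 * s c * (w 1 c + w 2 c)" for c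
  proof -
    have [measurable]: "(\<lambda>z. D i (c, z)) \<in> borel_measurable (borel \<Otimes>\<^sub>M borel)" for i
      unfolding borel_prod by measurable
    let ?F1 = "\<lambda>b. \<integral>\<^sup>+r. D 1 (c, r, b) \<partial>lborel" and ?F2 = "\<lambda>a. \<integral>\<^sup>+r. D 2 (c, a, r) \<partial>lborel"
    have F[measurable]: "?F1 \<in> borel_measurable borel" "?F2 \<in> borel_measurable borel"
      by (measurable; simp add: split_beta')+
    have "(\<integral>\<^sup>+z. ennreal (v (coords (c, z)) ^ 4) \<partial>lborel) \<le> (\<integral>\<^sup>+z. ?F1 (snd z) * ?F2 (fst z) \<partial>lborel)"
    proof (rule nn_integral_mono)
      fix z :: "real \<times> real"
      obtain a b where z: "z = (a, b)" by fastforce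
      have "ennreal (v (coords (c, z)) ^ 4) = ennreal ((v (coords (c, z)))\<^sup>2) * ennreal ((v (coords (c, z)))\<^sup>2)"
        by (simp flip: ennreal_mult' power_add)
      also have "\<dots> \<le> ?F1 b * ?F2 a" unfolding z by (intro mult_mono line1 line2) auto
      finally show "ennreal (v (coords (c, z)) ^ 4) \<le> ?F1 (snd z) * ?F2 (fst z)" using z by simp
    qed
    also have "\<dots> = (\<integral>\<^sup>+z. ?F1 (snd z) * ?F2 (fst z) \<partial>(lborel \<Otimes>\<^sub>M lborel))" unfolding prod_meas ..
    also have "\<dots> = (\<integral>\<^sup>+a. (\<integral>\<^sup>+b. ?F1 b * ?F2 a \<partial>lborel) \<partial>lborel)"
      by (subst lborel.nn_integral_fst[symmetric]) auto
    also have "\<dots> = (\<integral>\<^sup>+b. ?F1 b \<partial>lborel) * (\<integral>\<^sup>+a. ?F2 a \<partial>lborel)"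
      by (simp add: nn_integral_multc nn_integral_cmult)
    also have "(\<integral>\<^sup>+b. ?F1 b \<partial>lborel) = (\<integral>\<^sup>+z. D 1 (c, z) \<partial>lborel)"
      unfolding prod_meas[symmetric]
      by (subst lborel_pair.nn_integral_snd[symmetric]) (auto simp: borel_prod)
    also have "(\<integral>\<^sup>+a. ?F2 a \<partial>lborel) = (\<integral>\<^sup>+z. D 2 (c, z) \<partial>lborel)"
      unfolding prod_meas[symmetric]
      by (subst lborel.nn_integral_fst[symmetric]) (auto simp: borel_prod)
    finally have le: "(\<integral>\<^sup>+z. ennreal (v (coords (c, z)) ^ 4) \<partial>lborel) \<le> (\<integral>\<^sup>+z. D 1 (c, z) \<partial>lborel) * (\<integral>\<^sup>+z. D 2 (c, z) \<partial>lborel)" .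
    \<comment> \<open>Working with squares avoids square roots in the extended reals: the two slice
      bounds multiply to 16 s^2 w_1 w_2, and 4 w_1 w_2 <= (w_1 + w_2)^2 makes this the square of the
      desired right side.\<close>
    have "((\<integral>\<^sup>+z. D 1 (c, z) \<partial>lborel) * (\<integral>\<^sup>+z. D 2 (c, z) \<partial>lborel))\<^sup>2 \<le> (4 * s c * w 1 c) * (4 * s c * w 2 c)"
      unfolding power_mult_distrib D_def s_def w_def by (intro mult_mono nn_integral_slice_bound v) auto
    also have "\<dots> = (4 * (s c)\<^sup>2) * (4 * (w 1 c * w 2 c))"
      by (simp add: power2_eq_square mult_ac)
    also have "\<dots> \<le> (4 * (s c)\<^sup>2) * (w 1 c + w 2 c)\<^sup>2"
    proof (rule mult_left_mono)
      show "4 * (w 1 c * w 2 c) \<le> (w 1 c + w 2 c)\<^sup>2"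
      \<comment> \<open>The square of w_1 - w_2 makes sense only for finite values, so infinite
        slices are treated apart.\<close>
      proof (cases "w 1 c = \<infinity> \<or> w 2 c = \<infinity>")
        case False
        then obtain x y where xy: "w 1 c = ennreal x" "0 \<le> x" "w 2 c = ennreal y" "0 \<le> y"
          by (cases "w 1 c"; cases "w 2 c") auto
        have "4 * (x * y) \<le> (x + y)\<^sup>2" using zero_le_power2[of "x - y"] by (simp add: power2_eq_square algebra_simps)
        then have "ennreal (4 * (x * y)) \<le> ennreal ((x + y)\<^sup>2)" by (rule ennreal_leI)
        then show ?thesis using xy by (simp add: ennreal_mult ennreal_plus[symmetric] ennreal_power del: ennreal_plus)
      qed (auto simp: power2_eq_square)
    qed simp
    also have "\<dots> = (2 * s c * (w 1 c + w 2 c))\<^sup>2" by (simp add: power_mult_distrib)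
    finally have "(\<integral>\<^sup>+z. D 1 (c, z) \<partial>lborel) * (\<integral>\<^sup>+z. D 2 (c, z) \<partial>lborel) \<le> 2 * s c * (w 1 c + w 2 c)"
      by (rule ennreal_power2_le_imp_le)
    with le show ?thesis by (rule order_trans)
  qed
  have sup: "s c \<le> S + V 3" for c
  proof -
    have "s c \<le> (\<integral>\<^sup>+z. (\<integral>\<^sup>+r. D 3 (r, z) \<partial>lborel) \<partial>lborel)"
      unfolding s_def by (intro nn_integral_mono line3)
    also have "\<dots> = (\<integral>\<^sup>+r. (\<integral>\<^sup>+z. D 3 (r, z) \<partial>lborel) \<partial>lborel)"
    proof (rule lborel_pair.Fubini')
      have "D 3 \<in> borel_measurable (lborel \<Otimes>\<^sub>M (lborel :: (real \<times> real) measure))"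
        unfolding lborel_prod by simp
      then show "(\<lambda>(r, z). D 3 (r, z)) \<in> borel_measurable (lborel \<Otimes>\<^sub>M (lborel :: (real \<times> real) measure))"
        by (simp add: split_beta')
    qed
    also have "\<dots> = (\<integral>\<^sup>+x. ennreal \<bar>2 * v x * partial 3 v x\<bar> \<partial>lborel)"
      unfolding D_def by (rule nn_integral_coords[symmetric]) measurable
    also have "\<dots> \<le> (\<integral>\<^sup>+x. ennreal ((v x)\<^sup>2) + ennreal ((partial 3 v x)\<^sup>2) \<partial>lborel)"
    proof (rule nn_integral_mono)
      fix x
      have "\<bar>2 * v x * partial 3 v x\<bar> \<le> (v x)\<^sup>2 + (partial 3 v x)\<^sup>2"
        using sum_squares_bound[of "\<bar>v x\<bar>" "\<bar>partial 3 v x\<bar>"] by (simp add: abs_mult)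
      then show "ennreal \<bar>2 * v x * partial 3 v x\<bar> \<le> ennreal ((v x)\<^sup>2) + ennreal ((partial 3 v x)\<^sup>2)"
        by (simp flip: ennreal_plus add: ennreal_leI)
    qed
    also have "\<dots> = S + V 3" unfolding S_def V_def by (rule nn_integral_add) measurable
    finally show ?thesis .
  qed
  have wV: "(\<integral>\<^sup>+c. w i c \<partial>lborel) = V i" for i
    unfolding w_def V_def by (rule nn_integral_coords[symmetric]) measurable
  have [measurable]: "w i \<in> borel_measurable borel" for i
  proof -
    have "(\<lambda>p. ennreal ((partial i v (coords p))\<^sup>2)) \<in> borel_measurable (borel \<Otimes>\<^sub>M borel)"
      unfolding borel_prod by measurable
    then have "(\<lambda>c. \<integral>\<^sup>+z. ennreal ((partial i v (coords (c, z)))\<^sup>2) \<partial>lborel) \<in> borel_measurable borel"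
      using lborel.borel_measurable_nn_integral_fst[of "\<lambda>p. ennreal ((partial i v (coords p))\<^sup>2)" borel] by simp
    then show ?thesis by (simp add: w_def[abs_def])
  qed
  have "(\<integral>\<^sup>+x. ennreal (v x ^ 4) \<partial>lborel) = (\<integral>\<^sup>+c. (\<integral>\<^sup>+z. ennreal (v (coords (c, z)) ^ 4) \<partial>lborel) \<partial>lborel)"
    by (rule nn_integral_coords) measurable
  also have "\<dots> \<le> (\<integral>\<^sup>+c. 2 * (S + V 3) * (w 1 c + w 2 c) \<partial>lborel)"
  proof (rule nn_integral_mono)
    fix c
    have "2 * s c * (w 1 c + w 2 c) \<le> 2 * (S + V 3) * (w 1 c + w 2 c)"
      by (intro mult_right_mono mult_left_mono sup) auto
    with slice show "(\<integral>\<^sup>+z. ennreal (v (coords (c, z)) ^ 4) \<partial>lborel) \<le> 2 * (S + V 3) * (w 1 c + w 2 c)"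
      by (rule order_trans)
  qed
  also have "\<dots> = 2 * (S + V 3) * (\<integral>\<^sup>+c. w 1 c + w 2 c \<partial>lborel)"
    by (rule nn_integral_cmult) measurable
  also have "(\<integral>\<^sup>+c. w 1 c + w 2 c \<partial>lborel) = V 1 + V 2"
    by (subst nn_integral_add) (simp_all add: wV)
  finally show ?thesis .
qed

section \<open>Estimates at a fixed time\<close>

definition nsq :: "(real^3 \<Rightarrow> real) \<Rightarrow> real" where
  "nsq g = (\<integral>x. (g x)\<^sup>2 \<partial>lborel)"

definition sq_integrable :: "(real^3 \<Rightarrow> real) \<Rightarrow> bool" where
  "sq_integrable g \<longleftrightarrow> g \<in> borel_measurable borel \<and> integrable lborel (\<lambda>x. (g x)\<^sup>2)"

text \<open>The regularity of a velocity component at one fixed time; no uniformity in time is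
  encoded.\<close>

definition H_infinity :: "(real^3 \<Rightarrow> real) \<Rightarrow> bool" where
  "H_infinity g \<longleftrightarrow> smooth g \<and> (\<forall>ws. sq_integrable (word_deriv ws g))"

lemma nsq_nonneg: "0 \<le> nsq g"
  by (simp add: nsq_def)

lemma sq_integrable_add:
  assumes "sq_integrable f" "sq_integrable g"
  shows "sq_integrable (\<lambda>x. f x + g x)" "nsq (\<lambda>x. f x + g x) \<le> 2 * nsq f + 2 * nsq g"
  using assms integrable_square_add[of f lborel g] unfolding sq_integrable_def nsq_def by auto

lemma sq_integrable_uminus: "sq_integrable g \<Longrightarrow> sq_integrable (\<lambda>x. - g x)" "nsq (\<lambda>x. - g x) = nsq g"
  unfolding sq_integrable_def nsq_def by auto

lemma sq_integrable_diff:
  assumes "sq_integrable f" "sq_integrable g"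
  shows "sq_integrable (\<lambda>x. f x - g x)" "nsq (\<lambda>x. f x - g x) \<le> 2 * nsq f + 2 * nsq g"
  using sq_integrable_add[OF assms(1) sq_integrable_uminus(1)[OF assms(2)]] sq_integrable_uminus(2)[of g] by auto

lemma sq_integrable_product:
  assumes "sq_integrable f" "sq_integrable g"
  shows "integrable lborel (\<lambda>x. f x * g x)"
  using assms integrable_product[of f lborel g] unfolding sq_integrable_def by auto

lemma H_infinity_smooth: "H_infinity g \<Longrightarrow> smooth g"
  by (simp add: H_infinity_def)

lemma H_infinity_sq_integrable: "H_infinity g \<Longrightarrow> sq_integrable (word_deriv ws g)"
  by (simp add: H_infinity_def)

lemma H_infinity_word_deriv: "H_infinity g \<Longrightarrow> H_infinity (word_deriv ws g)"
  unfolding H_infinity_def by (auto simp: smooth_word_deriv simp flip: word_deriv_append)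

lemma H_infinity_partial: "H_infinity g \<Longrightarrow> H_infinity (partial i g)"
  using H_infinity_word_deriv[of g "[i]"] by simp

lemma H_infinity_sq: "H_infinity g \<Longrightarrow> sq_integrable g"
  using H_infinity_sq_integrable[of g "[]"] by simp

lemma H_infinity_diff: "H_infinity f \<Longrightarrow> H_infinity g \<Longrightarrow> H_infinity (\<lambda>x. f x - g x)"
  unfolding H_infinity_def by (auto simp: word_deriv_diff intro: smooth_intros sq_integrable_diff)

lemma ladyzhenskaya_compact:
  assumes v: "smooth v" "compactly_supported v"
  shows "(\<integral>x. v x ^ 4 \<partial>lborel) \<le> 2 * (nsq v + (\<Sum>i\<in>UNIV. nsq (partial i v)))\<^sup>2"
proof -
  have int: "integrable lborel (\<lambda>x. v x ^ 4)" "integrable lborel (\<lambda>x. (v x)\<^sup>2)"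
    "integrable lborel (\<lambda>x. (partial i v x)\<^sup>2)" for i
    by (intro smooth_compact_integrable smooth_intros compactly_supported_power compactly_supported_partial v; simp)+
  have e: "(\<integral>\<^sup>+x. ennreal ((v x)\<^sup>2) \<partial>lborel) = ennreal (nsq v)"
    "(\<integral>\<^sup>+x. ennreal ((partial i v x)\<^sup>2) \<partial>lborel) = ennreal (nsq (partial i v))"
    "(\<integral>\<^sup>+x. ennreal (v x ^ 4) \<partial>lborel) = ennreal (\<integral>x. v x ^ 4 \<partial>lborel)" for i
    unfolding nsq_def by (rule nn_integral_eq_integral; simp add: int)+
  let ?a = "nsq v + nsq (partial 3 v)" and ?b = "nsq (partial 1 v) + nsq (partial 2 v)"
  have nn: "0 \<le> ?a" "0 \<le> ?b" by (simp_all add: nsq_nonneg)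
  have "2 * (ennreal (nsq v) + ennreal (nsq (partial 3 v))) * (ennreal (nsq (partial 1 v)) + ennreal (nsq (partial 2 v)))
      = ennreal (2 * ?a * ?b)"
    using nn by (simp add: ennreal_mult nsq_nonneg)
  then have "ennreal (\<integral>x. v x ^ 4 \<partial>lborel) \<le> ennreal (2 * ?a * ?b)"
    using ladyzhenskaya_compact_nn[OF v] unfolding e by simp
  then have "(\<integral>x. v x ^ 4 \<partial>lborel) \<le> 2 * ?a * ?b"
    by (rule ennreal_le_iff[THEN iffD1, rotated]) (use nn in simp)
  also have "\<dots> = 2 * (?a * ?b)" by simp
  also have "\<dots> \<le> 2 * ((?a + ?b) * (?a + ?b))" using nn by (intro mult_left_mono mult_mono) auto
  also have "\<dots> = 2 * (nsq v + (\<Sum>i\<in>UNIV. nsq (partial i v)))\<^sup>2"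
    by (simp add: sum_3 power2_eq_square add_ac)
  finally show ?thesis .
qed

text \<open>98 = 2 * 7^2: the cut-off costs a factor 7 \<open>cutoff_const\<close>^2 in the squared
  H^1 norm, which \<open>ladyzhenskaya_compact\<close> squares and doubles.\<close>

definition sobolev_const :: real where "sobolev_const = 98 * cutoff_const ^ 4"

lemma sobolev_const_ge: "1 \<le> sobolev_const"
  using one_le_power[OF cutoff_const(1), of 4] by (simp add: sobolev_const_def)

definition H1sq :: "(real^3 \<Rightarrow> real) \<Rightarrow> real" where
  "H1sq g = nsq g + (\<Sum>i\<in>UNIV. nsq (partial i g))"

lemma H1sq_nonneg: "0 \<le> H1sq g"
  by (simp add: H1sq_def nsq_nonneg sum_nonneg)

text \<open>The compact case is applied to g times a cut-off. Radii of at least 1 keep the gradient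
  of the cut-off uniformly bounded, so the estimate survives the limit of infinite radius.\<close>

lemma ladyzhenskaya:
  assumes g: "smooth g" "sq_integrable g" "\<And>i. sq_integrable (partial i g)"
  shows "integrable lborel (\<lambda>x. g x ^ 4)" "(\<integral>x. g x ^ 4 \<partial>lborel) \<le> sobolev_const * (H1sq g)\<^sup>2"
proof -
  have key: "(\<integral>x. cutoff (real (Suc n)) x ^ 4 * g x ^ 4 \<partial>lborel) \<le> sobolev_const * (H1sq g)\<^sup>2"
    and int: "integrable lborel (\<lambda>x. cutoff (real (Suc n)) x ^ 4 * g x ^ 4)" for n
  proof -
    let ?c = "cutoff (real (Suc n))"
    let ?v = "\<lambda>x. ?c x * g x"
    have c: "compactly_supported ?c" by (rule compactly_supported_cutoff) simp
    have v: "smooth ?v" "compactly_supported ?v"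
      by (intro smooth_intros g compactly_supported_mult1 c)+
    show "integrable lborel (\<lambda>x. ?c x ^ 4 * g x ^ 4)"
      by (intro smooth_compact_integrable smooth_intros g compactly_supported_mult1 compactly_supported_power c) simp
    have c1: "(?c x)\<^sup>2 \<le> 1" for x by (simp add: power_le_one cutoff_nonneg cutoff_le_1)
    have "integrable lborel (\<lambda>x. (?v x)\<^sup>2)"
      by (intro smooth_compact_integrable smooth_intros v compactly_supported_power) simp
    then have n0: "nsq ?v \<le> nsq g"
      unfolding nsq_def using g(2) c1
      by (intro integral_mono) (auto simp: sq_integrable_def power_mult_distrib mult_left_le_one_le)
    have n1: "nsq (partial i ?v) \<le> 2 * cutoff_const\<^sup>2 * nsq g + 2 * nsq (partial i g)" for i
    proof -
      have p: "partial i ?v = (\<lambda>x. partial i ?c x * g x + ?c x * partial i g x)"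
        by (simp add: partial_mult smooth_cutoff g)
      have "integrable lborel (\<lambda>x. (partial i ?v x)\<^sup>2)"
        by (intro smooth_compact_integrable smooth_intros v compactly_supported_power compactly_supported_partial) simp
      moreover have "(partial i ?v x)\<^sup>2 \<le> 2 * cutoff_const\<^sup>2 * (g x)\<^sup>2 + 2 * (partial i g x)\<^sup>2" for x
      proof -
        have "(partial i ?v x)\<^sup>2 \<le> 2 * (partial i ?c x * g x)\<^sup>2 + 2 * (?c x * partial i g x)\<^sup>2"
          unfolding p using sum_squares_bound[of "partial i ?c x * g x" "?c x * partial i g x"] by (simp add: power2_sum)
        also have "\<dots> \<le> 2 * (cutoff_const\<^sup>2 * (g x)\<^sup>2) + 2 * (1 * (partial i g x)\<^sup>2)"
          unfolding power_mult_distrib using c1 cutoff_gradient_sq[of "real (Suc n)" i x]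
          by (intro add_mono mult_left_mono mult_right_mono) auto
        finally show ?thesis by simp
      qed
      ultimately have "nsq (partial i ?v) \<le> (\<integral>x. 2 * cutoff_const\<^sup>2 * (g x)\<^sup>2 + 2 * (partial i g x)\<^sup>2 \<partial>lborel)"
        unfolding nsq_def using g(2) g(3)[of i] by (intro integral_mono) (auto simp: sq_integrable_def)
      also have "\<dots> = 2 * cutoff_const\<^sup>2 * nsq g + 2 * nsq (partial i g)"
        unfolding nsq_def using g(2) g(3)[of i] by (simp add: sq_integrable_def)
      finally show ?thesis .
    qed
    have C: "1 \<le> cutoff_const\<^sup>2" using cutoff_const(1) by (simp add: one_le_power)
    have "nsq ?v + (\<Sum>i\<in>UNIV. nsq (partial i ?v))
        \<le> nsq g + (\<Sum>i\<in>UNIV. 2 * cutoff_const\<^sup>2 * nsq g + 2 * nsq (partial i g))"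
      by (intro add_mono n0 sum_mono n1)
    also have "\<dots> = (1 + 6 * cutoff_const\<^sup>2) * nsq g + 2 * (\<Sum>i\<in>UNIV. nsq (partial i g))"
      by (simp add: sum_3 algebra_simps)
    also have "\<dots> \<le> (7 * cutoff_const\<^sup>2) * nsq g + (7 * cutoff_const\<^sup>2) * (\<Sum>i\<in>UNIV. nsq (partial i g))"
      using C by (intro add_mono mult_right_mono sum_nonneg nsq_nonneg) auto
    also have "\<dots> = (7 * cutoff_const\<^sup>2) * H1sq g" by (simp add: H1sq_def algebra_simps)
    finally have le: "nsq ?v + (\<Sum>i\<in>UNIV. nsq (partial i ?v)) \<le> (7 * cutoff_const\<^sup>2) * H1sq g" .
    have "(\<integral>x. ?c x ^ 4 * g x ^ 4 \<partial>lborel) = (\<integral>x. ?v x ^ 4 \<partial>lborel)" by (simp add: power_mult_distrib)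
    also have "\<dots> \<le> 2 * (nsq ?v + (\<Sum>i\<in>UNIV. nsq (partial i ?v)))\<^sup>2"
      by (rule ladyzhenskaya_compact[OF v])
    also have "\<dots> \<le> 2 * ((7 * cutoff_const\<^sup>2) * H1sq g)\<^sup>2"
      by (intro mult_left_mono power_mono le add_nonneg_nonneg sum_nonneg nsq_nonneg) auto
    also have "\<dots> = sobolev_const * (H1sq g)\<^sup>2"
      by (simp add: sobolev_const_def power_mult_distrib)
    finally show "(\<integral>x. ?c x ^ 4 * g x ^ 4 \<partial>lborel) \<le> sobolev_const * (H1sq g)\<^sup>2" .
  qed
  have meas: "(\<lambda>x. g x ^ 4) \<in> borel_measurable borel"
    by (intro smooth_borel_measurable smooth_intros g)
  show "integrable lborel (\<lambda>x. g x ^ 4)"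
    by (rule integrable_if_cutoff_bounded(1)[OF meas _ int key]) simp
  show "(\<integral>x. g x ^ 4 \<partial>lborel) \<le> sobolev_const * (H1sq g)\<^sup>2"
    by (rule integrable_if_cutoff_bounded(2)[OF meas _ int key]) simp
qed

text \<open>Young's inequality with a free weight \<open>l\<close>; balancing the two terms by the
  choice of \<open>l\<close> turns the sum into a product of norms.\<close>

lemma sq_integrable_mult_weighted:
  assumes f: "f \<in> borel_measurable borel" "integrable lborel (\<lambda>x. f x ^ 4)"
    and g: "g \<in> borel_measurable borel" "integrable lborel (\<lambda>x. g x ^ 4)" and l: "l > 0"
  shows "sq_integrable (\<lambda>x. f x * g x)"
    "2 * nsq (\<lambda>x. f x * g x) \<le> l * (\<integral>x. f x ^ 4 \<partial>lborel) + (\<integral>x. g x ^ 4 \<partial>lborel) / l"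
proof -
  have "2 * ((l * a\<^sup>2) * b\<^sup>2) \<le> (l * a\<^sup>2)\<^sup>2 + (b\<^sup>2)\<^sup>2" for a b :: real
    using sum_squares_bound[of "l * a\<^sup>2" "b\<^sup>2"] by simp
  then have "2 * (a * b)\<^sup>2 * l \<le> (l * a ^ 4 + b ^ 4 / l) * l" for a b :: real
    using l by (simp add: power2_eq_square power4_eq_xxxx algebra_simps)
  then have pw: "2 * (a * b)\<^sup>2 \<le> l * a ^ 4 + b ^ 4 / l" for a b :: real
    using mult_right_le_imp_le l by blast
  have iR: "integrable lborel (\<lambda>x. l * f x ^ 4 + g x ^ 4 / l)" using f g by simp
  have "integrable lborel (\<lambda>x. (f x * g x)\<^sup>2)"
  proof (rule Bochner_Integration.integrable_bound[OF iR])
    have "(f x * g x)\<^sup>2 \<le> l * f x ^ 4 + g x ^ 4 / l" for x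
      using pw[of "f x" "g x"] zero_le_power2[of "f x * g x"] by linarith
    then show "AE x in lborel. norm ((f x * g x)\<^sup>2) \<le> norm (l * f x ^ 4 + g x ^ 4 / l)"
      by (intro AE_I2) (smt (verit) real_norm_def zero_le_power2)
  qed (use f g in auto)
  then show i: "sq_integrable (\<lambda>x. f x * g x)" using f g by (simp add: sq_integrable_def)
  have "(\<integral>x. 2 * (f x * g x)\<^sup>2 \<partial>lborel) \<le> (\<integral>x. l * f x ^ 4 + g x ^ 4 / l \<partial>lborel)"
    by (rule integral_mono) (use i iR pw in \<open>auto simp: sq_integrable_def\<close>)
  then show "2 * nsq (\<lambda>x. f x * g x) \<le> l * (\<integral>x. f x ^ 4 \<partial>lborel) + (\<integral>x. g x ^ 4 \<partial>lborel) / l"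
    using f g i by (simp add: nsq_def sq_integrable_def)
qed

lemma sq_integrable_mult_H1:
  assumes f: "H_infinity f" and g: "H_infinity g"
  shows "sq_integrable (\<lambda>x. f x * g x)"
    "nsq (\<lambda>x. f x * g x) \<le> sobolev_const * (H1sq f + 1) * (H1sq g + 1)"
proof -
  note lf = ladyzhenskaya[OF H_infinity_smooth[OF f] H_infinity_sq[OF f] H_infinity_sq[OF H_infinity_partial[OF f]]]
  note lg = ladyzhenskaya[OF H_infinity_smooth[OF g] H_infinity_sq[OF g] H_infinity_sq[OF H_infinity_partial[OF g]]]
  note meas = smooth_borel_measurable[OF H_infinity_smooth[OF f]] smooth_borel_measurable[OF H_infinity_smooth[OF g]]
  define a b where "a = H1sq f + 1" and "b = H1sq g + 1"
  have ab: "a > 0" "b > 0" unfolding a_def b_def using H1sq_nonneg[of f] H1sq_nonneg[of g] by linarith+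
  \<comment> \<open>The weight b / a makes both terms equal to \<open>sobolev_const\<close> * a * b;
    the 1 added in \<open>a\<close> and \<open>b\<close> keeps it positive and finite.\<close>
  note w = sq_integrable_mult_weighted[OF meas(1) lf(1) meas(2) lg(1), of "b / a"]
  show "sq_integrable (\<lambda>x. f x * g x)" using w(1) ab by simp
  have "(H1sq f)\<^sup>2 \<le> a\<^sup>2" "(H1sq g)\<^sup>2 \<le> b\<^sup>2"
    unfolding a_def b_def using H1sq_nonneg by (auto intro!: power_mono)
  then have 4: "(\<integral>x. f x ^ 4 \<partial>lborel) \<le> sobolev_const * a\<^sup>2" "(\<integral>x. g x ^ 4 \<partial>lborel) \<le> sobolev_const * b\<^sup>2"
    using lf(2) lg(2) sobolev_const_ge by (smt (verit) mult_left_mono)+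
  have "2 * nsq (\<lambda>x. f x * g x) \<le> (b / a) * (\<integral>x. f x ^ 4 \<partial>lborel) + (\<integral>x. g x ^ 4 \<partial>lborel) / (b / a)"
    using w(2) ab by simp
  also have "\<dots> \<le> (b / a) * (sobolev_const * a\<^sup>2) + (sobolev_const * b\<^sup>2) / (b / a)"
    using ab by (intro add_mono mult_left_mono divide_right_mono 4) auto
  also have "\<dots> = 2 * (sobolev_const * a * b)"
    using ab by (simp add: power2_eq_square field_simps)
  finally show "nsq (\<lambda>x. f x * g x) \<le> sobolev_const * (H1sq f + 1) * (H1sq g + 1)"
    unfolding a_def b_def by simp
qed

section \<open>Sums of squares over all derivatives of a given order\<close>

definition words :: "nat \<Rightarrow> 3 list set" where "words n = {ws. length ws = n}"

text \<open>The square of J_n, except that each derivative is counted as often as there are words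
  representing it.\<close>

definition energy :: "nat \<Rightarrow> (3 \<Rightarrow> real^3 \<Rightarrow> real) \<Rightarrow> real" where
  "energy n u = (\<Sum>ws\<in>words n. \<Sum>j\<in>UNIV. nsq (word_deriv ws (u j)))"

definition vort :: "(3 \<Rightarrow> real^3 \<Rightarrow> real) \<Rightarrow> 3 \<Rightarrow> 3 \<Rightarrow> real^3 \<Rightarrow> real" where
  "vort u i j = (\<lambda>x. partial i (u j) x - partial j (u i) x)"

definition enstrophy :: "nat \<Rightarrow> (3 \<Rightarrow> real^3 \<Rightarrow> real) \<Rightarrow> real" where
  "enstrophy n u = (\<Sum>ws\<in>words n. \<Sum>i\<in>UNIV. \<Sum>j\<in>UNIV. nsq (word_deriv ws (vort u i j)))"

lemma finite_words: "finite (words n)"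
  unfolding words_def using finite_lists_length_eq[of "UNIV :: 3 set" n] by simp

lemma sum_words_Suc: "(\<Sum>ws\<in>words (Suc n). f ws) = (\<Sum>ws\<in>words n. \<Sum>i\<in>UNIV. f (i # ws))"
proof -
  have e: "words (Suc n) = (\<lambda>(ws, i). i # ws) ` (words n \<times> UNIV)"
  proof -
    have "ws \<in> (\<lambda>(ws, i). i # ws) ` (words n \<times> UNIV)" if "length ws = Suc n" for ws
      using that by (cases ws) (auto simp: words_def image_iff)
    then show ?thesis by (auto simp: words_def)
  qed
  have "inj_on (\<lambda>(ws, i). i # ws) (words n \<times> (UNIV :: 3 set))" by (auto simp: inj_on_def)
  then show ?thesis
    unfolding e by (subst sum.reindex) (auto simp: sum.cartesian_product split_beta')
qed

lemma energy_nonneg: "0 \<le> energy n u"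
  by (simp add: energy_def nsq_nonneg sum_nonneg)

lemma nsq_le_energy: "nsq (word_deriv ws (u j)) \<le> energy (length ws) u"
proof -
  have "nsq (word_deriv ws (u j)) \<le> (\<Sum>j\<in>UNIV. nsq (word_deriv ws (u j)))"
    by (rule member_le_sum) (auto simp: nsq_nonneg)
  also have "\<dots> \<le> energy (length ws) u"
    unfolding energy_def
    by (rule member_le_sum[of ws "words (length ws)" "\<lambda>ws. \<Sum>j\<in>UNIV. nsq (word_deriv ws (u j))"])
      (auto simp: words_def sum_nonneg nsq_nonneg finite_words[unfolded words_def])
  finally show ?thesis .
qed

lemma H1sq_le_energy:
  "H1sq (word_deriv ws (u j)) \<le> energy (length ws) u + 3 * energy (Suc (length ws)) u"
proof -
  have "nsq (partial i (word_deriv ws (u j))) \<le> energy (Suc (length ws)) u" for i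
    using nsq_le_energy[of "ws @ [i]" u j] by (simp add: word_deriv_append)
  then have "(\<Sum>i\<in>UNIV. nsq (partial i (word_deriv ws (u j)))) \<le> (\<Sum>i\<in>(UNIV :: 3 set). energy (Suc (length ws)) u)"
    by (intro sum_mono)
  then show ?thesis using nsq_le_energy[of ws u j] by (simp add: H1sq_def)
qed

lemma H_infinity_vort: "(\<And>j. H_infinity (u j)) \<Longrightarrow> H_infinity (vort u i j)"
  unfolding vort_def by (intro H_infinity_diff H_infinity_partial)

lemma word_deriv_vort:
  assumes "\<And>j. smooth (u j)"
  shows "word_deriv ws (vort u i j) = vort (\<lambda>j. word_deriv ws (u j)) i j"
  unfolding vort_def using assms by (simp add: word_deriv_diff smooth_partial partial_word_deriv)

lemma enstrophy_le_energy:
  assumes u: "\<And>j. H_infinity (u j)"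
  shows "enstrophy n u \<le> 4 * energy (Suc n) u"
proof -
  have le: "nsq (word_deriv ws (vort u i j)) \<le> 2 * nsq (word_deriv (i # ws) (u j)) + 2 * nsq (word_deriv (j # ws) (u i))" for ws i j
  proof -
    have e: "word_deriv ws (vort u i j) = (\<lambda>x. word_deriv (i # ws) (u j) x - word_deriv (j # ws) (u i) x)"
      by (simp add: vort_def word_deriv_diff smooth_partial H_infinity_smooth u)
    show ?thesis unfolding e by (intro sq_integrable_diff(2) H_infinity_sq_integrable u)
  qed
  have "enstrophy n u \<le> (\<Sum>ws\<in>words n. \<Sum>i\<in>UNIV. \<Sum>j\<in>UNIV.
      2 * nsq (word_deriv (i # ws) (u j)) + 2 * nsq (word_deriv (j # ws) (u i)))"
    unfolding enstrophy_def by (intro sum_mono le)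
  also have "\<dots> = (\<Sum>ws\<in>words n. 4 * (\<Sum>i\<in>UNIV. \<Sum>j\<in>UNIV. nsq (word_deriv (i # ws) (u j))))"
  proof (rule sum.cong[OF refl])
    fix ws
    have "(\<Sum>i\<in>UNIV. \<Sum>j\<in>UNIV. nsq (word_deriv (j # ws) (u i))) = (\<Sum>i\<in>UNIV. \<Sum>j\<in>UNIV. nsq (word_deriv (i # ws) (u j)))"
      by (rule sum.swap)
    then show "(\<Sum>i\<in>UNIV. \<Sum>j\<in>UNIV. 2 * nsq (word_deriv (i # ws) (u j)) + 2 * nsq (word_deriv (j # ws) (u i)))
        = 4 * (\<Sum>i\<in>UNIV. \<Sum>j\<in>UNIV. nsq (word_deriv (i # ws) (u j)))"
      by (simp only: sum.distrib sum_distrib_left[symmetric])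
  qed
  also have "\<dots> = 4 * energy (Suc n) u"
    unfolding energy_def sum_words_Suc by (simp add: sum_distrib_left)
  finally show ?thesis .
qed

text \<open>Expanding the squares of \<open>vort v i j\<close> leaves the cross terms, whose sum is
  the integral of sum_{i,j} D_i v_j D_j v_i. For divergence-free v this sum is the divergence of the
  convection field \<open>H\<close>, because the terms v_j D_j (div v) vanish. \<open>H\<close> and
  its derivatives are sums of products of square integrable functions, so the integral of the
  divergence is 0 without a cut-off.\<close>

lemma div_free_elliptic:
  assumes v: "\<And>j. H_infinity (v j)" and div: "\<And>x. (\<Sum>i\<in>UNIV. partial i (v i) x) = 0"
  shows "(\<Sum>i\<in>UNIV. \<Sum>j\<in>UNIV. nsq (partial i (v j))) \<le> (\<Sum>i\<in>UNIV. \<Sum>j\<in>UNIV. nsq (vort v i j))"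
proof -
  note sm = H_infinity_smooth[OF v] smooth_partial[OF H_infinity_smooth[OF v]]
  note si = H_infinity_sq[OF v] H_infinity_sq[OF H_infinity_partial[OF v]]
    H_infinity_sq[OF H_infinity_partial[OF H_infinity_partial[OF v]]]
  define H where "H i = (\<lambda>x. \<Sum>j\<in>UNIV. v j x * partial j (v i) x)" for i
  have sH: "smooth (H i)" for i unfolding H_def by (intro smooth_intros sm)
  have pH: "partial i (H i) = (\<lambda>x. \<Sum>j\<in>UNIV. partial i (v j) x * partial j (v i) x + v j x * partial i (partial j (v i)) x)" for i
    unfolding H_def by (simp add: partial_sum partial_mult smooth_intros sm)
  have iH: "integrable lborel (H i)" for i
    unfolding H_def by (intro Bochner_Integration.integrable_sum sq_integrable_product si)
  have iP: "integrable lborel (\<lambda>x. partial i (v j) x * partial j (v i) x)" for i j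
    by (intro sq_integrable_product si)
  have ipH: "integrable lborel (partial i (H i))" for i
    unfolding pH by (intro Bochner_Integration.integrable_sum Bochner_Integration.integrable_add sq_integrable_product si)
  have z: "(\<integral>x. partial i (H i) x \<partial>lborel) = 0" for i
    by (rule integral_partial_eq_0[OF sH iH ipH])
  have dd: "(\<Sum>i\<in>UNIV. partial i (partial j (v i)) x) = 0" for j x
  proof -
    have "(\<lambda>x. \<Sum>i\<in>UNIV. partial i (v i) x) = (\<lambda>x. 0)" using div by auto
    then have "partial j (\<lambda>x. \<Sum>i\<in>UNIV. partial i (v i) x) = (\<lambda>x. 0)" by (simp add: partial_const)
    moreover have "partial j (\<lambda>x. \<Sum>i\<in>UNIV. partial i (v i) x) = (\<lambda>x. \<Sum>i\<in>UNIV. partial j (partial i (v i)) x)"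
      by (rule partial_sum) (intro sm)
    ultimately show ?thesis using partial_commute[OF sm(1)] by (metis (no_types, lifting) sum.cong)
  qed
  have pw: "(\<Sum>i\<in>UNIV. \<Sum>j\<in>UNIV. partial i (v j) x * partial j (v i) x) = (\<Sum>i\<in>UNIV. partial i (H i) x)" for x
  proof -
    have "(\<Sum>i\<in>UNIV. \<Sum>j\<in>UNIV. v j x * partial i (partial j (v i)) x) = (\<Sum>j\<in>UNIV. v j x * (\<Sum>i\<in>UNIV. partial i (partial j (v i)) x))"
      by (subst sum.swap) (simp add: sum_distrib_left)
    then show ?thesis by (simp add: pH sum.distrib dd)
  qed
  have cross: "(\<Sum>i\<in>UNIV. \<Sum>j\<in>UNIV. (\<integral>x. partial i (v j) x * partial j (v i) x \<partial>lborel)) = 0"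
  proof -
    have "(\<Sum>i\<in>UNIV. \<Sum>j\<in>UNIV. (\<integral>x. partial i (v j) x * partial j (v i) x \<partial>lborel))
        = (\<integral>x. (\<Sum>i\<in>UNIV. \<Sum>j\<in>UNIV. partial i (v j) x * partial j (v i) x) \<partial>lborel)"
      by (simp add: Bochner_Integration.integral_sum Bochner_Integration.integrable_sum iP)
    also have "\<dots> = (\<Sum>i\<in>UNIV. \<integral>x. partial i (H i) x \<partial>lborel)"
      unfolding pw by (simp add: Bochner_Integration.integral_sum ipH)
    finally show ?thesis by (simp add: z)
  qed
  have exp: "nsq (vort v i j) = nsq (partial i (v j)) + nsq (partial j (v i)) - 2 * (\<integral>x. partial i (v j) x * partial j (v i) x \<partial>lborel)" for i j
  proof -
    have "nsq (vort v i j) = (\<integral>x. (partial i (v j) x)\<^sup>2 + (partial j (v i) x)\<^sup>2 - 2 * (partial i (v j) x * partial j (v i) x) \<partial>lborel)"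
      unfolding nsq_def vort_def by (simp add: power2_diff mult.assoc)
    also have "\<dots> = nsq (partial i (v j)) + nsq (partial j (v i)) - 2 * (\<integral>x. partial i (v j) x * partial j (v i) x \<partial>lborel)"
      unfolding nsq_def using iP si(2) by (simp add: sq_integrable_def)
    finally show ?thesis .
  qed
  have "(\<Sum>i\<in>UNIV. \<Sum>j\<in>UNIV. nsq (vort v i j))
      = (\<Sum>i\<in>UNIV. \<Sum>j\<in>UNIV. nsq (partial i (v j))) + (\<Sum>i\<in>UNIV. \<Sum>j\<in>UNIV. nsq (partial j (v i)))"
    unfolding exp sum_subtractf sum.distrib sum_distrib_left[symmetric] cross by simp
  also have "(\<Sum>i\<in>UNIV. \<Sum>j\<in>UNIV. nsq (partial j (v i))) = (\<Sum>i\<in>UNIV. \<Sum>j\<in>UNIV. nsq (partial i (v j)))"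
    by (rule sum.swap)
  finally show ?thesis
    by (simp add: sum_nonneg nsq_nonneg)
qed

lemma energy_le_enstrophy:
  assumes u: "\<And>j. H_infinity (u j)" and div: "\<And>x. (\<Sum>i\<in>UNIV. partial i (u i) x) = 0"
  shows "energy (Suc n) u \<le> enstrophy n u"
proof -
  note sm = H_infinity_smooth[OF u]
  have "(\<Sum>i\<in>UNIV. \<Sum>j\<in>UNIV. nsq (word_deriv (i # ws) (u j))) \<le> (\<Sum>i\<in>UNIV. \<Sum>j\<in>UNIV. nsq (word_deriv ws (vort u i j)))" for ws
  proof -
    have d: "(\<Sum>i\<in>UNIV. partial i (word_deriv ws (u i)) x) = 0" for x
    proof -
      have "word_deriv ws (\<lambda>x. \<Sum>i\<in>UNIV. partial i (u i) x) = (\<lambda>x. \<Sum>i\<in>UNIV. partial i (word_deriv ws (u i)) x)"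
        by (simp add: word_deriv_sum smooth_partial sm partial_word_deriv)
      moreover have "(\<lambda>x. \<Sum>i\<in>UNIV. partial i (u i) x) = (\<lambda>x. 0)" using div by auto
      moreover have "word_deriv ws (\<lambda>x. 0 :: real) = (\<lambda>x. 0)"
        by (induction ws) (simp_all add: partial_const)
      ultimately show ?thesis by metis
    qed
    show ?thesis
      using div_free_elliptic[of "\<lambda>j. word_deriv ws (u j)", OF H_infinity_word_deriv[OF u] d]
      by (simp add: word_deriv_vort sm partial_word_deriv)
  qed
  then show ?thesis
    unfolding energy_def enstrophy_def sum_words_Suc by (rule sum_mono)
qed


text \<open>One summand for each case of \<open>product_estimate\<close>: an undifferentiated first
  factor, two first derivatives, and at least three derivatives shared by both factors.\<close>

definition product_const :: "real \<Rightarrow> real \<Rightarrow> real" where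
  "product_const M K = M\<^sup>2 + 18 * M\<^sup>2 * cutoff_const\<^sup>2 * (1 + K) + 16 * sobolev_const * (1 + K)\<^sup>2"

text \<open>The bound has to be linear in \<open>energy n u\<close>, of which only the time integral
  will be controlled. For n = 2 the Ladyzhenskaya inequality would produce its square, so the bound
  M on u is used through \<open>integral_partial_pow4_le\<close>. For n >= 3 only the factor with
  more derivatives can reach order n in its H^1 norm. The second factor carries at least one
  derivative because it stems from the vorticity.\<close>

lemma product_estimate:
  assumes u: "\<And>j. H_infinity (u j)" and M: "\<And>j x. \<bar>u j x\<bar> \<le> M"
    and n: "2 \<le> n" and K: "0 \<le> K" "\<And>m. 1 \<le> m \<Longrightarrow> m < n \<Longrightarrow> energy m u \<le> K"
    and ab: "length a + length b = n" "1 \<le> length b"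
  shows "sq_integrable (\<lambda>x. word_deriv a (u k) x * word_deriv b (u j) x)"
    "nsq (\<lambda>x. word_deriv a (u k) x * word_deriv b (u j) x) \<le> product_const M K * (1 + energy n u)"
proof -
  let ?E = "1 + energy n u"
  have E: "1 \<le> ?E" using energy_nonneg by simp
  have C: "M\<^sup>2 * ?E \<le> product_const M K * ?E"
    "18 * M\<^sup>2 * cutoff_const\<^sup>2 * (1 + K) * ?E \<le> product_const M K * ?E"
    "16 * sobolev_const * (1 + K)\<^sup>2 * ?E \<le> product_const M K * ?E"
    unfolding product_const_def using E K(1) sobolev_const_ge by (intro mult_right_mono; simp)+
  consider "a = []" | "n = 2" "length a = 1" "length b = 1" | "3 \<le> n" "1 \<le> length a"
  proof (cases "a = []")
    case False
    then have "1 \<le> length a" by (cases a) auto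
    then have "(n = 2 \<and> length a = 1 \<and> length b = 1) \<or> (3 \<le> n \<and> 1 \<le> length a)"
      using ab n by arith
    then show ?thesis using that by blast
  qed (use that in blast)
  then have "sq_integrable (\<lambda>x. word_deriv a (u k) x * word_deriv b (u j) x) \<and>
      nsq (\<lambda>x. word_deriv a (u k) x * word_deriv b (u j) x) \<le> product_const M K * ?E"
  proof cases
    case 1
    have b: "sq_integrable (word_deriv b (u j))" by (rule H_infinity_sq_integrable[OF u])
    have pw: "(u k x * word_deriv b (u j) x)\<^sup>2 \<le> M\<^sup>2 * (word_deriv b (u j) x)\<^sup>2" for x
    proof -
      have "(u k x)\<^sup>2 \<le> M\<^sup>2" using M[of k x] by (metis abs_ge_zero power2_abs power_mono)
      then show ?thesis unfolding power_mult_distrib by (intro mult_right_mono) auto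
    qed
    have ib: "integrable lborel (\<lambda>x. M\<^sup>2 * (word_deriv b (u j) x)\<^sup>2)" using b by (simp add: sq_integrable_def)
    have meas: "(\<lambda>x. u k x * word_deriv b (u j) x) \<in> borel_measurable borel"
      by (intro smooth_borel_measurable smooth_intros H_infinity_smooth u)
    have i: "integrable lborel (\<lambda>x. (u k x * word_deriv b (u j) x)\<^sup>2)"
      by (rule Bochner_Integration.integrable_bound[OF ib]) (use pw meas in auto)
    have "nsq (\<lambda>x. u k x * word_deriv b (u j) x) \<le> (\<integral>x. M\<^sup>2 * (word_deriv b (u j) x)\<^sup>2 \<partial>lborel)"
      unfolding nsq_def by (rule integral_mono[OF i ib pw])
    also have "\<dots> = M\<^sup>2 * nsq (word_deriv b (u j))" by (simp add: nsq_def)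
    also have "\<dots> \<le> M\<^sup>2 * energy n u"
      using nsq_le_energy[of b u j] ab 1 by (intro mult_left_mono) auto
    also have "\<dots> \<le> M\<^sup>2 * ?E" by (intro mult_left_mono) auto
    finally show ?thesis using i meas C(1) 1 by (simp add: sq_integrable_def)
  next
    case 2
    then obtain p q where pq: "a = [p]" "b = [q]" by (metis One_nat_def length_0_conv length_Suc_conv)
    have L4: "integrable lborel (\<lambda>x. partial i (u l) x ^ 4)"
      "(\<integral>x. partial i (u l) x ^ 4 \<partial>lborel) \<le> 18 * M\<^sup>2 * cutoff_const\<^sup>2 * ((1 + K) * ?E)" for i l
    proof -
      note h = integral_partial_pow4_le[OF H_infinity_smooth[OF u[of l]] M, of i]
      have s: "integrable lborel (\<lambda>x. (partial i (u l) x)\<^sup>2)" "integrable lborel (\<lambda>x. (partial i (partial i (u l)) x)\<^sup>2)"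
        using H_infinity_sq_integrable[OF u[of l], of "[i]"] H_infinity_sq_integrable[OF u[of l], of "[i, i]"]
        by (simp_all add: sq_integrable_def)
      show "integrable lborel (\<lambda>x. partial i (u l) x ^ 4)" by (rule h(1)[OF s])
      have "nsq (partial i (u l)) + nsq (partial i (partial i (u l))) \<le> K + energy n u"
        using nsq_le_energy[of "[i]" u l] nsq_le_energy[of "[i, i]" u l] K(2)[of 1] 2 by (simp add: numeral_2_eq_2)
      also have "\<dots> \<le> (1 + K) * ?E" using K(1) energy_nonneg[of n u] by (simp add: algebra_simps)
      finally have "18 * M\<^sup>2 * cutoff_const\<^sup>2 * (nsq (partial i (u l)) + nsq (partial i (partial i (u l))))
          \<le> 18 * M\<^sup>2 * cutoff_const\<^sup>2 * ((1 + K) * ?E)"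
        by (intro mult_left_mono) auto
      then show "(\<integral>x. partial i (u l) x ^ 4 \<partial>lborel) \<le> 18 * M\<^sup>2 * cutoff_const\<^sup>2 * ((1 + K) * ?E)"
        using h(2)[OF s] by (simp add: nsq_def)
    qed
    have m: "partial i (u l) \<in> borel_measurable borel" for i l
      by (intro smooth_borel_measurable smooth_partial H_infinity_smooth u)
    note w = sq_integrable_mult_weighted[OF m L4(1) m L4(1), of 1 p k q j]
    show ?thesis using w L4(2)[of p k] L4(2)[of q j] C(2) by (simp add: pq mult.assoc)
  next
    case 3
    have len: "length a < n" "length b < n" using ab 3 by linarith+
    \<comment> \<open>The bound for a word so short that even its next derivatives have order below
      n; \<open>H'\<close> below allows order n and pays with the factor \<open>?E\<close>.\<close>
    have H: "H1sq (word_deriv w (u l)) + 1 \<le> 4 * (1 + K)" if "1 \<le> length w" "Suc (length w) < n" for w l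
      using H1sq_le_energy[of w u l] K(2)[of "length w"] K(2)[of "Suc (length w)"] that by simp
    have H': "H1sq (word_deriv w (u l)) + 1 \<le> 4 * ((1 + K) * ?E)" if "1 \<le> length w" "length w < n" for w l
    proof -
      have "energy (Suc (length w)) u \<le> K + energy n u"
      proof (cases "Suc (length w) = n")
        case False
        then show ?thesis using K(2)[of "Suc (length w)"] that energy_nonneg[of n u] by simp
      qed (use K in simp)
      then have "H1sq (word_deriv w (u l)) + 1 \<le> 4 * (1 + K + energy n u)"
        using H1sq_le_energy[of w u l] K(2)[of "length w"] that energy_nonneg[of n u] K(1) by simp
      also have "\<dots> \<le> 4 * ((1 + K) * ?E)" using K(1) energy_nonneg[of n u] by (simp add: algebra_simps)
      finally show ?thesis .
    qed
    let ?A = "H1sq (word_deriv a (u k)) + 1" and ?B = "H1sq (word_deriv b (u j)) + 1"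
    have nn: "0 \<le> ?A" "0 \<le> ?B" using H1sq_nonneg by (simp_all add: add_nonneg_nonneg)
    have AB: "?A * ?B \<le> (4 * (1 + K)) * (4 * ((1 + K) * ?E))"
    \<comment> \<open>Since both lengths are positive and add up to n >= 3, the shorter one is at
      most n - 2. Hence \<open>?E\<close> enters only once.\<close>
    proof (cases "length a \<le> length b")
      case True
      then have "Suc (length a) < n" using ab 3 by linarith
      then show ?thesis using H[of a k] H'[of b j] 3 ab len nn K(1) E by (intro mult_mono) auto
    next
      case False
      then have "Suc (length b) < n" using ab 3 by linarith
      then have "?B * ?A \<le> (4 * (1 + K)) * (4 * ((1 + K) * ?E))"
        using H[of b j] H'[of a k] 3 ab len nn K(1) E by (intro mult_mono) auto
      then show ?thesis by (simp only: mult.commute[of ?A ?B])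
    qed
    note h = sq_integrable_mult_H1[OF H_infinity_word_deriv[OF u] H_infinity_word_deriv[OF u], of a k b j]
    have "nsq (\<lambda>x. word_deriv a (u k) x * word_deriv b (u j) x) \<le> sobolev_const * (?A * ?B)"
      using h(2) by (simp add: mult.assoc)
    also have "\<dots> \<le> sobolev_const * ((4 * (1 + K)) * (4 * ((1 + K) * ?E)))"
      using sobolev_const_ge by (intro mult_left_mono AB) auto
    also have "\<dots> = 16 * sobolev_const * (1 + K)\<^sup>2 * ?E" by algebra
    finally show ?thesis using h(1) C(3) by simp
  qed
  then show "sq_integrable (\<lambda>x. word_deriv a (u k) x * word_deriv b (u j) x)"
    "nsq (\<lambda>x. word_deriv a (u k) x * word_deriv b (u j) x) \<le> product_const M K * ?E" by blast+
qed

text \<open>Replaces the Leibniz formula: every letter splits the product into two terms, and (a +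
  b)^2 <= 2 a^2 + 2 b^2 costs a factor 4.\<close>

lemma word_deriv_mult_bound:
  fixes f g :: "real^3 \<Rightarrow> real"
  assumes "smooth f" "smooth g"
    and "\<And>a b. length a + length b = length ws \<Longrightarrow>
      sq_integrable (\<lambda>x. word_deriv a f x * word_deriv b g x) \<and> nsq (\<lambda>x. word_deriv a f x * word_deriv b g x) \<le> Q"
  shows "sq_integrable (word_deriv ws (\<lambda>x. f x * g x)) \<and> nsq (word_deriv ws (\<lambda>x. f x * g x)) \<le> 4 ^ length ws * Q"
  using assms
proof (induction ws arbitrary: f g)
  case Nil
  then show ?case using Nil(3)[of "[]" "[]"] by simp
next
  case (Cons i ws)
  note sm = Cons.prems(1,2)
  have 1: "sq_integrable (word_deriv ws (\<lambda>x. partial i f x * g x)) \<and>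
      nsq (word_deriv ws (\<lambda>x. partial i f x * g x)) \<le> 4 ^ length ws * Q"
    by (rule Cons.IH[OF smooth_partial[OF sm(1)] sm(2)]) (use Cons.prems(3)[of "i # a" b for a b] in simp)
  have 2: "sq_integrable (word_deriv ws (\<lambda>x. f x * partial i g x)) \<and>
      nsq (word_deriv ws (\<lambda>x. f x * partial i g x)) \<le> 4 ^ length ws * Q"
    by (rule Cons.IH[OF sm(1) smooth_partial[OF sm(2)]]) (use Cons.prems(3)[of a "i # b" for a b] in simp)
  have e: "word_deriv (i # ws) (\<lambda>x. f x * g x)
      = (\<lambda>x. word_deriv ws (\<lambda>x. partial i f x * g x) x + word_deriv ws (\<lambda>x. f x * partial i g x) x)"
    by (simp add: partial_mult sm word_deriv_add smooth_intros)
  show ?case unfolding e using 1 2 sq_integrable_add[of "word_deriv ws (\<lambda>x. partial i f x * g x)" "word_deriv ws (\<lambda>x. f x * partial i g x)"]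
    by auto
qed

text \<open>The Lamb vector, the cross product of curl u with u, expressed by the antisymmetric
  gradient.\<close>

definition lamb :: "(3 \<Rightarrow> real^3 \<Rightarrow> real) \<Rightarrow> 3 \<Rightarrow> real^3 \<Rightarrow> real" where
  "lamb u j = (\<lambda>x. \<Sum>k\<in>UNIV. u k x * vort u k j x)"

lemma smooth_vort [smooth_intros]: "(\<And>j. smooth (u j)) \<Longrightarrow> smooth (vort u i j)"
  unfolding vort_def by (intro smooth_intros)

lemma smooth_lamb [smooth_intros]: "(\<And>j. smooth (u j)) \<Longrightarrow> smooth (lamb u j)"
  unfolding lamb_def by (intro smooth_intros)

text \<open>The two terms of each vorticity entry give \<open>4 * Q\<close>, the product rule gives
  \<open>4 ^ length ws\<close>, and the threefold sum gives 10 = 2 + 2 * (2 + 2). The 4 before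
  \<open>Q\<close> completes \<open>4 ^ n\<close>, and 10 is rounded up to 40.\<close>

lemma lamb_estimate:
  assumes u: "\<And>j. H_infinity (u j)" and M: "\<And>j x. \<bar>u j x\<bar> \<le> M"
    and n: "2 \<le> n" and K: "0 \<le> K" "\<And>m. 1 \<le> m \<Longrightarrow> m < n \<Longrightarrow> energy m u \<le> K"
    and ws: "Suc (length ws) = n"
  shows "sq_integrable (word_deriv ws (lamb u j))"
    "nsq (word_deriv ws (lamb u j)) \<le> 40 * 4 ^ n * product_const M K * (1 + energy n u)"
proof -
  note sm = H_infinity_smooth[OF u]
  define Q where "Q = product_const M K * (1 + energy n u)"
  have pe: "sq_integrable (\<lambda>x. word_deriv a (u k) x * word_deriv b (u j) x)"
    "nsq (\<lambda>x. word_deriv a (u k) x * word_deriv b (u j) x) \<le> Q"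
    if "length a + length b = n" "1 \<le> length b" for a b k j
    unfolding Q_def using product_estimate[where u = u, OF u M n K(1) _ that] K(2) by blast+
  have Q: "0 \<le> Q" using order_trans[OF nsq_nonneg pe(2)[of "[]" "replicate n 1"]] n by simp
  have 1: "sq_integrable (\<lambda>x. word_deriv a (u k) x * word_deriv b (vort u k j) x) \<and>
      nsq (\<lambda>x. word_deriv a (u k) x * word_deriv b (vort u k j) x) \<le> 4 * Q"
    if "length a + length b = length ws" for a b k
  proof -
    have e: "(\<lambda>x. word_deriv a (u k) x * word_deriv b (vort u k j) x)
      = (\<lambda>x. word_deriv a (u k) x * word_deriv (k # b) (u j) x - word_deriv a (u k) x * word_deriv (j # b) (u k) x)"
      by (simp add: vort_def word_deriv_diff smooth_partial sm right_diff_distrib)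
    have l: "length a + length (k # b) = n" "1 \<le> length (k # b)" for k using that ws by auto
    show ?thesis unfolding e
      using sq_integrable_diff[OF pe(1)[OF l, of k k j] pe(1)[OF l, of k j k]]
        pe(2)[OF l, of k k j] pe(2)[OF l, of k j k] by (intro conjI) (blast, linarith)
  qed
  have 2: "sq_integrable (word_deriv ws (\<lambda>x. u k x * vort u k j x)) \<and>
      nsq (word_deriv ws (\<lambda>x. u k x * vort u k j x)) \<le> 4 ^ length ws * (4 * Q)" for k
    by (rule word_deriv_mult_bound) (use 1 in \<open>auto intro: sm smooth_vort\<close>)
  have e: "word_deriv ws (lamb u j) = (\<lambda>x. word_deriv ws (\<lambda>x. u 1 x * vort u 1 j x) x
      + (word_deriv ws (\<lambda>x. u 2 x * vort u 2 j x) x + word_deriv ws (\<lambda>x. u 3 x * vort u 3 j x) x))"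
    unfolding lamb_def by (subst word_deriv_sum) (auto simp: sum_3 add.assoc intro!: smooth_intros sm)
  note a23 = sq_integrable_add[OF conjunct1[OF 2[of 2]] conjunct1[OF 2[of 3]]]
  note a123 = sq_integrable_add[OF conjunct1[OF 2[of 1]] a23(1)]
  show "sq_integrable (word_deriv ws (lamb u j))" unfolding e by (rule a123(1))
  have "nsq (word_deriv ws (lamb u j)) \<le> 10 * (4 ^ length ws * (4 * Q))"
    unfolding e using a123(2) a23(2) conjunct2[OF 2[of 1]] conjunct2[OF 2[of 2]] conjunct2[OF 2[of 3]] by linarith
  also have "\<dots> = 10 * (4 ^ n * Q)" using ws by (simp flip: ws)
  also have "\<dots> \<le> 40 * 4 ^ n * Q" using Q by simp
  finally show "nsq (word_deriv ws (lamb u j)) \<le> 40 * 4 ^ n * product_const M K * (1 + energy n u)"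
    unfolding Q_def by (simp add: mult.assoc)
qed

section \<open>Evolution of the vorticity\<close>

text \<open>Links the Lebesgue integral over space with the gauge integral over a box, for which the
  Leibniz rule below is formulated.\<close>

lemma integral_eq_cbox:
  fixes f :: "real^3 \<Rightarrow> real"
  assumes "continuous_on UNIV f" "\<And>x. x \<notin> cbox a b \<Longrightarrow> f x = 0"
  shows "f integrable_on cbox a b" "integral (cbox a b) f = (\<integral>x. f x \<partial>lborel)"
proof -
  have "f integrable_on cbox a b" by (intro integrable_continuous continuous_on_subset[OF assms(1)]) auto
  then show "f integrable_on cbox a b" .
  have "integrable lborel (\<lambda>x. indicator (cbox a b) x *\<^sub>R f x)"
    by (intro borel_integrable_compact compact_cbox continuous_on_subset[OF assms(1)]) auto
  moreover have e: "(\<lambda>x. indicator (cbox a b) x *\<^sub>R f x) = f" using assms(2) by (auto simp: indicator_def fun_eq_iff)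
  ultimately have i: "integrable lborel f" by simp
  have "set_integrable lborel (cbox a b) f" unfolding set_integrable_def e by (rule i)
  from set_borel_integral_eq_integral(2)[OF this]
  show "integral (cbox a b) f = (\<integral>x. f x \<partial>lborel)" unfolding set_lebesgue_integral_def e by simp
qed

lemma compactly_supported_cbox:
  assumes "compactly_supported g"
  obtains a b :: "real^3" where "\<And>x. x \<notin> cbox a b \<Longrightarrow> g x = 0"
proof -
  obtain R where R: "\<forall>x. R < norm x \<longrightarrow> g x = 0" using assms unfolding compactly_supported_def by blast
  obtain a b :: "real^3" where "cball 0 R \<subseteq> cbox a b" using bounded_cball bounded_subset_cbox_symmetric by metis
  then have "g x = 0" if "x \<notin> cbox a b" for x
    using that R by (metis in_mono mem_cball_0 not_le)
  then show ?thesis using that by blast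
qed

text \<open>The compact support of the weight reduces differentiation under the integral to
  continuity on a box. Without it a dominating function would be needed, and square integrability at
  each separate time supplies none.\<close>

lemma has_derivative_cutoff_integral:
  fixes G :: "real \<Rightarrow> real^3 \<Rightarrow> real"
  assumes \<phi>: "smooth \<phi>" "compactly_supported \<phi>" and G: "spacetime_smooth T G" and t: "t \<in> {0..<T}"
  shows "((\<lambda>s. \<integral>x. \<phi> x * G s x \<partial>lborel) has_vector_derivative (\<integral>x. \<phi> x * time_deriv T G t x \<partial>lborel)) (at t within {0..<T})"
proof -
  obtain a b :: "real^3" where ab: "\<And>x. x \<notin> cbox a b \<Longrightarrow> \<phi> x = 0" using compactly_supported_cbox[OF \<phi>(2)] by blast
  have cphi: "continuous_on UNIV \<phi>" by (rule C_infinity_on_imp_continuous_on[OF \<phi>(1)])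
  have D: "spacetime_smooth T (time_deriv T G)" by (rule spacetime_time_deriv[OF G])
  have slice: "continuous_on UNIV (\<lambda>x. \<phi> x * F s x)" if "spacetime_smooth T F" "s \<in> {0..<T}" for F s
    using C_infinity_on_imp_continuous_on[OF spacetime_slice[OF that]] cphi by (intro continuous_intros)
  have eq: "integral (cbox a b) (\<lambda>x. \<phi> x * F s x) = (\<integral>x. \<phi> x * F s x \<partial>lborel)"
    "(\<lambda>x. \<phi> x * F s x) integrable_on cbox a b"
    if "spacetime_smooth T F" "s \<in> {0..<T}" for F s
    using integral_eq_cbox[OF slice[OF that], of a b] ab by auto
  have "((\<lambda>s. integral (cbox a b) (\<lambda>x. \<phi> x * G s x)) has_vector_derivative
      integral (cbox a b) (\<lambda>x. \<phi> x * time_deriv T G t x)) (at t within {0..<T})"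
  proof (rule leibniz_rule_vector_derivative)
    show "((\<lambda>s. \<phi> x * G s x) has_vector_derivative \<phi> x * time_deriv T G s x) (at s within {0..<T})"
      if "s \<in> {0..<T}" for s x
      by (intro has_vector_derivative_mult_right has_time_deriv[OF G that])
    show "(\<lambda>x. \<phi> x * G s x) integrable_on cbox a b" if "s \<in> {0..<T}" for s by (rule eq(2)[OF G that])
    have "continuous_on ({0..<T} \<times> cbox a b) (\<lambda>(s, x). time_deriv T G s x)"
      by (rule continuous_on_subset[OF C_infinity_on_imp_continuous_on[OF D]]) auto
    then have "continuous_on ({0..<T} \<times> cbox a b) (\<lambda>p. \<phi> (snd p) * time_deriv T G (fst p) (snd p))"
      by (intro continuous_intros continuous_on_compose2[OF cphi]) (auto simp: case_prod_beta')
    then show "continuous_on ({0..<T} \<times> cbox a b) (\<lambda>(s, x). \<phi> x * time_deriv T G s x)"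
      by (simp add: case_prod_beta')
  qed (use t in auto)
  then show ?thesis
    unfolding eq(1)[OF D t]
    by (rule has_vector_derivative_transform[OF t, rotated]) (simp add: eq(1)[OF G])
qed

lemma spacetime_diff:
  "spacetime_smooth T F \<Longrightarrow> spacetime_smooth T G \<Longrightarrow> spacetime_smooth T (\<lambda>t x. F t x - G t x)"
  using C_infinity_on_diff[of "{0..<T} \<times> UNIV" "\<lambda>(t, x). F t x" "\<lambda>(t, x). G t x"] by (simp add: case_prod_beta')

lemma spacetime_power:
  fixes F :: "real \<Rightarrow> real^3 \<Rightarrow> real"
  shows "spacetime_smooth T F \<Longrightarrow> spacetime_smooth T (\<lambda>t x. F t x ^ n)"
  using C_infinity_on_power[of "{0..<T} \<times> UNIV" "\<lambda>(t, x). F t x" n] by (simp add: case_prod_beta')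

lemma time_deriv_square:
  assumes F: "spacetime_smooth T F" and t: "t \<in> {0..<T}"
  shows "time_deriv T (\<lambda>t x. (F t x)\<^sup>2) t x = 2 * F t x * time_deriv T F t x"
proof (rule time_derivI[OF t])
  have "((\<lambda>s. F s x) has_real_derivative time_deriv T F t x) (at t within {0..<T})"
    using has_time_deriv[OF F t] by (simp add: has_real_derivative_iff_has_vector_derivative)
  from DERIV_power[OF this, of 2]
  show "((\<lambda>s. (F s x)\<^sup>2) has_vector_derivative 2 * F t x * time_deriv T F t x) (at t within {0..<T})"
    by (simp add: has_real_derivative_iff_has_vector_derivative mult_ac)
qed

lemma weighted_square_derivative:
  assumes \<phi>: "smooth \<phi>" "compactly_supported \<phi>" and F: "spacetime_smooth T F" and t: "t \<in> {0..<T}"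
  shows "((\<lambda>s. \<integral>x. \<phi> x * (F s x)\<^sup>2 \<partial>lborel) has_vector_derivative
    (\<integral>x. \<phi> x * (2 * F t x * time_deriv T F t x) \<partial>lborel)) (at t within {0..<T})"
  using has_derivative_cutoff_integral[OF \<phi> spacetime_power[OF F] t, of 2] time_deriv_square[OF F t] by simp

text \<open>Local energy estimate for an equation with right side Delta f + div F, tested with 2
  \<open>\<phi>\<close>^2 f. The fields \<open>H k\<close> collect everything that integrates to
  zero. What is left is, in each direction, a quadratic form in the numbers a, b, c below.\<close>

lemma parabolic_energy_inequality:
  fixes f g \<phi> :: "real^3 \<Rightarrow> real"
  assumes f: "smooth f" and F: "\<And>k. smooth (F k)" and \<phi>: "smooth \<phi>" "compactly_supported \<phi>"
    and g: "\<And>x. g x = (\<Sum>k\<in>UNIV. partial k (partial k f) x + partial k (F k) x)"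
  shows "(\<integral>x. (\<phi> x)\<^sup>2 * (2 * f x * g x) \<partial>lborel)
    \<le> (\<integral>x. (\<phi> x)\<^sup>2 * (4 * (\<Sum>k\<in>UNIV. (F k x)\<^sup>2) - (\<Sum>k\<in>UNIV. (partial k f x)\<^sup>2))
        + 10 * (\<Sum>k\<in>UNIV. (partial k \<phi> x)\<^sup>2) * (f x)\<^sup>2 \<partial>lborel)"
proof -
  note sm = f F \<phi>(1) smooth_partial[OF f] smooth_partial[OF F] smooth_partial[OF \<phi>(1)] smooth_partial[OF smooth_partial[OF f]]
  note cs = \<phi>(2) compactly_supported_partial[OF \<phi>(2)]
  define H where "H k = (\<lambda>x. (\<phi> x)\<^sup>2 * (f x * (partial k f x + F k x)))" for k
  have sH: "smooth (H k)" for k unfolding H_def by (intro smooth_intros sm)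
  have cH: "compactly_supported (H k)" for k
    unfolding H_def by (intro compactly_supported_mult1 compactly_supported_power cs) simp
  have pH: "partial k (H k) = (\<lambda>x. 2 * \<phi> x * partial k \<phi> x * (f x * (partial k f x + F k x))
      + (\<phi> x)\<^sup>2 * (partial k f x * (partial k f x + F k x) + f x * (partial k (partial k f) x + partial k (F k) x)))" for k
    unfolding H_def by (simp add: partial_mult partial_power partial_add smooth_intros sm)
  have "smooth g"
  proof -
    have "g = (\<lambda>x. \<Sum>k\<in>UNIV. partial k (partial k f) x + partial k (F k) x)" using g by auto
    then show ?thesis by (auto intro!: smooth_intros sm)
  qed
  have iH: "integrable lborel (\<lambda>x. \<Sum>k\<in>UNIV. 2 * partial k (H k) x)"
    by (intro smooth_compact_integrable smooth_intros sH compactly_supported_sum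
        compactly_supported_mult2 compactly_supported_partial cH)
  have z: "(\<integral>x. (\<Sum>k\<in>UNIV. 2 * partial k (H k) x) \<partial>lborel) = 0"
  proof -
    have "integrable lborel (partial k (H k))" for k
      by (intro smooth_compact_integrable smooth_intros sH compactly_supported_partial cH)
    then show ?thesis
      by (simp add: Bochner_Integration.integral_sum integral_partial_eq_0_compact[OF sH cH])
  qed
  let ?R = "\<lambda>x. (\<phi> x)\<^sup>2 * (4 * (\<Sum>k\<in>UNIV. (F k x)\<^sup>2) - (\<Sum>k\<in>UNIV. (partial k f x)\<^sup>2))
        + 10 * (\<Sum>k\<in>UNIV. (partial k \<phi> x)\<^sup>2) * (f x)\<^sup>2"
  have iR: "integrable lborel ?R"
    by (intro smooth_compact_integrable smooth_intros sm compactly_supported_add)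
      (intro compactly_supported_mult1 compactly_supported_mult2 compactly_supported_sum compactly_supported_power cs; simp)+
  have iL: "integrable lborel (\<lambda>x. (\<phi> x)\<^sup>2 * (2 * f x * g x))"
    by (intro smooth_compact_integrable smooth_intros sm \<open>smooth g\<close> compactly_supported_mult1 compactly_supported_power cs) simp
  have pw: "(\<phi> x)\<^sup>2 * (2 * f x * g x) \<le> (\<Sum>k\<in>UNIV. 2 * partial k (H k) x) + ?R x" for x
  proof -
    have "2 * ((\<phi> x)\<^sup>2 * (f x * (partial k (partial k f) x + partial k (F k) x)))
      \<le> 2 * partial k (H k) x + ((\<phi> x)\<^sup>2 * (4 * (F k x)\<^sup>2 - (partial k f x)\<^sup>2) + 10 * (partial k \<phi> x)\<^sup>2 * (f x)\<^sup>2)" for k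
    proof -
      define a b c where "a = \<phi> x * partial k f x" "b = partial k \<phi> x * f x" "c = \<phi> x * F k x"
      \<comment> \<open>A certificate by squares: twice this sum is the difference of the two sides
        of the inequality wanted, which is where the constants 4 and 10 originate.\<close>
      have "0 \<le> (a / 2 + c)\<^sup>2 + (a / 2 + 2 * b)\<^sup>2 + (b + c)\<^sup>2" by simp
      then have "0 \<le> a\<^sup>2 / 2 + 2 * c\<^sup>2 + 5 * b\<^sup>2 + a * c + 2 * a * b + 2 * b * c"
        by (simp add: power2_eq_square algebra_simps)
      then have "- 2 * (2 * b + a) * (a + c) \<le> 4 * c\<^sup>2 - a\<^sup>2 + 10 * b\<^sup>2"
        by (simp add: power2_eq_square algebra_simps)
      then show ?thesis unfolding pH a_b_c_def
        by (simp add: power2_eq_square algebra_simps)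
    qed
    then have "(\<Sum>k\<in>UNIV. 2 * ((\<phi> x)\<^sup>2 * (f x * (partial k (partial k f) x + partial k (F k) x))))
      \<le> (\<Sum>k\<in>UNIV. 2 * partial k (H k) x + ((\<phi> x)\<^sup>2 * (4 * (F k x)\<^sup>2 - (partial k f x)\<^sup>2) + 10 * (partial k \<phi> x)\<^sup>2 * (f x)\<^sup>2))"
      by (intro sum_mono)
    moreover have "(\<Sum>k\<in>UNIV. 2 * ((\<phi> x)\<^sup>2 * (f x * (partial k (partial k f) x + partial k (F k) x)))) = (\<phi> x)\<^sup>2 * (2 * f x * g x)"
      unfolding g by (simp add: sum_3 algebra_simps)
    moreover have "(\<Sum>k\<in>UNIV. 2 * partial k (H k) x + ((\<phi> x)\<^sup>2 * (4 * (F k x)\<^sup>2 - (partial k f x)\<^sup>2) + 10 * (partial k \<phi> x)\<^sup>2 * (f x)\<^sup>2))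
        = (\<Sum>k\<in>UNIV. 2 * partial k (H k) x) + ?R x"
      by (simp add: sum_3 algebra_simps)
    ultimately show ?thesis by simp
  qed
  have "(\<integral>x. (\<phi> x)\<^sup>2 * (2 * f x * g x) \<partial>lborel) \<le> (\<integral>x. (\<Sum>k\<in>UNIV. 2 * partial k (H k) x) + ?R x \<partial>lborel)"
    by (rule integral_mono[OF iL Bochner_Integration.integrable_add[OF iH iR] pw])
  also have "\<dots> = (\<integral>x. ?R x \<partial>lborel)" using Bochner_Integration.integral_add[OF iH iR] z by simp
  finally show ?thesis .
qed

text \<open>Here \<open>q\<close> is the Bernoulli pressure \<open>p + \<bar>u\<bar>\<^sup>2 / 2\<close>: since
  \<open>u\<^sub>k \<partial>\<^sub>k u\<^sub>j = u\<^sub>k (\<partial>\<^sub>k u\<^sub>j - \<partial>\<^sub>j u\<^sub>k) + \<partial>\<^sub>j (\<bar>u\<bar>\<^sup>2 / 2)\<close>, what remains of the convection term is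
  \<open>lamb\<close>.\<close>

locale bounded_flow =
  fixes T M :: real and U :: "real \<Rightarrow> 3 \<Rightarrow> real^3 \<Rightarrow> real" and q :: "real \<Rightarrow> real^3 \<Rightarrow> real"
  assumes T_pos: "0 < T"
    and U_smooth: "\<And>j. spacetime_smooth T (\<lambda>t. U t j)"
    and q_smooth: "\<And>t. t \<in> {0..<T} \<Longrightarrow> smooth (q t)"
    and momentum: "\<And>t j x. 0 < t \<Longrightarrow> t < T \<Longrightarrow> time_deriv T (\<lambda>s. U s j) t x
      = (\<Sum>k\<in>UNIV. partial k (partial k (U t j)) x) - lamb (U t) j x - partial j (q t) x"
    and div_free: "\<And>t x. t \<in> {0..<T} \<Longrightarrow> (\<Sum>i\<in>UNIV. partial i (U t i) x) = 0"
    and U_H: "\<And>t j. t \<in> {0..<T} \<Longrightarrow> H_infinity (U t j)"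
    and U_bound: "\<And>t j x. t \<in> {0..<T} \<Longrightarrow> \<bar>U t j x\<bar> \<le> M"
begin

lemma vort_smooth: "spacetime_smooth T (\<lambda>t. word_deriv ws (vort (U t) i j))"
  unfolding vort_def by (intro spacetime_word_deriv spacetime_diff spacetime_partial U_smooth)

text \<open>D_j G_i - D_i G_j written as the divergence of F_k = delta_kj G_i - delta_ki G_j, G
  being the Lamb vector, so that in the energy estimate no further derivative falls on G.\<close>

definition flux :: "3 list \<Rightarrow> 3 \<Rightarrow> 3 \<Rightarrow> real \<Rightarrow> 3 \<Rightarrow> real^3 \<Rightarrow> real" where
  "flux ws i j t k = (\<lambda>x. (if k = j then 1 else 0) * word_deriv ws (lamb (U t) i) x
    - (if k = i then 1 else 0) * word_deriv ws (lamb (U t) j) x)"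

lemma U_slice_smooth: "t \<in> {0..<T} \<Longrightarrow> smooth (U t j)"
  using spacetime_slice[OF U_smooth] by blast

lemma flux_smooth: "t \<in> {0..<T} \<Longrightarrow> smooth (flux ws i j t k)"
  unfolding flux_def by (intro smooth_intros U_slice_smooth)

lemma vorticity_equation:
  assumes t: "0 < t" "t < T"
  shows "time_deriv T (\<lambda>s. word_deriv ws (vort (U s) i j)) t x
    = (\<Sum>k\<in>UNIV. partial k (partial k (word_deriv ws (vort (U t) i j))) x + partial k (flux ws i j t k) x)"
proof -
  have tI: "t \<in> {0..<T}" using t by simp
  note sU = U_slice_smooth[OF tI] smooth_partial[OF U_slice_smooth[OF tI]]
  have sL: "smooth (lamb (U t) j)" for j by (intro smooth_lamb sU)
  note sq = q_smooth[OF tI]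
  define lap where "lap j = (\<lambda>x. \<Sum>k\<in>UNIV. partial k (partial k (U t j)) x)" for j
  have slap: "smooth (lap j)" for j unfolding lap_def by (intro smooth_intros sU)
  have V: "time_deriv T (\<lambda>s. U s j) t = (\<lambda>x. lap j x - lamb (U t) j x - partial j (q t) x)" for j
    using momentum[OF t] unfolding lap_def by auto
  have W: "time_deriv T (\<lambda>s. word_deriv ws (U s j)) t x
      = word_deriv ws (lap j) x - word_deriv ws (lamb (U t) j) x - word_deriv ws (partial j (q t)) x" for ws j x
    unfolding time_deriv_word_deriv[OF t U_smooth] V
    by (simp add: word_deriv_diff smooth_intros slap sL sq)
  have split: "word_deriv ws (vort (U s) i j) x = word_deriv (i # ws) (U s j) x - word_deriv (j # ws) (U s i) x"
    if "s \<in> {0..<T}" for s x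
    by (simp add: vort_def word_deriv_diff smooth_intros U_slice_smooth[OF that])
  have "time_deriv T (\<lambda>s. word_deriv ws (vort (U s) i j)) t x
      = time_deriv T (\<lambda>s. word_deriv (i # ws) (U s j)) t x - time_deriv T (\<lambda>s. word_deriv (j # ws) (U s i)) t x"
  proof (rule time_derivI[OF tI])
    have "((\<lambda>s. word_deriv (i # ws) (U s j) x - word_deriv (j # ws) (U s i) x) has_vector_derivative
        time_deriv T (\<lambda>s. word_deriv (i # ws) (U s j)) t x - time_deriv T (\<lambda>s. word_deriv (j # ws) (U s i)) t x) (at t within {0..<T})"
      by (intro has_vector_derivative_diff has_time_deriv spacetime_word_deriv U_smooth tI)
    then show "((\<lambda>s. word_deriv ws (vort (U s) i j) x) has_vector_derivative
        time_deriv T (\<lambda>s. word_deriv (i # ws) (U s j)) t x - time_deriv T (\<lambda>s. word_deriv (j # ws) (U s i)) t x) (at t within {0..<T})"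
      by (rule has_vector_derivative_transform[OF tI, rotated]) (rule split)
  qed
  \<comment> \<open>The terms with \<open>q\<close> are its mixed derivatives in directions i and j
    in either order and cancel; here the pressure leaves the argument.\<close>
  also have "\<dots> = (word_deriv ws (partial i (lap j)) x - word_deriv ws (partial j (lap i)) x)
      - partial i (word_deriv ws (lamb (U t) j)) x + partial j (word_deriv ws (lamb (U t) i)) x"
    unfolding W using partial_commute[OF sq, of i j] by (simp add: partial_word_deriv sL)
  also have "word_deriv ws (partial i (lap j)) x - word_deriv ws (partial j (lap i)) x
      = (\<Sum>k\<in>UNIV. partial k (partial k (word_deriv ws (vort (U t) i j))) x)"
  proof -
    have c: "word_deriv ws (partial i (lap j)) = (\<lambda>x. \<Sum>k\<in>UNIV. partial k (partial k (word_deriv (i # ws) (U t j))) x)" for i j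
    proof -
      have "partial i (partial k (partial k (U t j))) = partial k (partial k (partial i (U t j)))" for k
        by (metis partial_commute smooth_partial sU(1))
      then have "partial i (lap j) = (\<lambda>x. \<Sum>k\<in>UNIV. partial k (partial k (partial i (U t j))) x)"
        unfolding lap_def by (simp add: partial_sum smooth_intros sU)
      then show ?thesis by (simp add: word_deriv_sum smooth_intros sU partial_word_deriv)
    qed
    have "word_deriv ws (vort (U t) i j) = (\<lambda>x. word_deriv (i # ws) (U t j) x - word_deriv (j # ws) (U t i) x)"
      using split[OF tI] by auto
    then show ?thesis unfolding c
      by (simp add: partial_diff smooth_intros sU sum_subtractf del: word_deriv.simps)
  qed
  also have "\<dots> - partial i (word_deriv ws (lamb (U t) j)) x + partial j (word_deriv ws (lamb (U t) i)) x
      = (\<Sum>k\<in>UNIV. partial k (partial k (word_deriv ws (vort (U t) i j))) x + partial k (flux ws i j t k) x)"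
  proof -
    have "partial k (flux ws i j t k) x = (if k = j then partial k (word_deriv ws (lamb (U t) i)) x else 0)
        - (if k = i then partial k (word_deriv ws (lamb (U t) j)) x else 0)" for k
      unfolding flux_def by (simp add: partial_diff partial_mult partial_const smooth_intros sL sU)
    then show ?thesis by (simp add: sum.distrib sum_subtractf)
  qed
  finally show ?thesis .
qed

lemma flux_sq_le:
  "(\<Sum>k\<in>UNIV. (flux ws i j t k x)\<^sup>2) \<le> 2 * (word_deriv ws (lamb (U t) i) x)\<^sup>2 + 2 * (word_deriv ws (lamb (U t) j) x)\<^sup>2"
proof -
  let ?a = "word_deriv ws (lamb (U t) i) x" and ?b = "word_deriv ws (lamb (U t) j) x"
  have "(flux ws i j t k x)\<^sup>2 \<le> (if k = j then 2 * ?a\<^sup>2 else 0) + (if k = i then 2 * ?b\<^sup>2 else 0)" for k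
    using sum_squares_bound[of ?a "- ?b"] unfolding flux_def by (auto simp: power2_diff)
  then have "(\<Sum>k\<in>UNIV. (flux ws i j t k x)\<^sup>2) \<le> (\<Sum>k\<in>UNIV. (if k = j then 2 * ?a\<^sup>2 else 0) + (if k = i then 2 * ?b\<^sup>2 else 0))"
    by (intro sum_mono)
  then show ?thesis by (simp add: sum.distrib)
qed

definition weighted_rate where
  "weighted_rate \<phi> ws i j t = (\<integral>x. (\<phi> x)\<^sup>2 * (2 * word_deriv ws (vort (U t) i j) x
    * time_deriv T (\<lambda>s. word_deriv ws (vort (U s) i j)) t x) \<partial>lborel)"

lemma weighted_rate_derivative:
  assumes "smooth \<phi>" "compactly_supported \<phi>" "t \<in> {0..<T}"
  shows "((\<lambda>s. \<integral>x. (\<phi> x)\<^sup>2 * (word_deriv ws (vort (U s) i j) x)\<^sup>2 \<partial>lborel) has_vector_derivative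
    weighted_rate \<phi> ws i j t) (at t within {0..<T})"
  unfolding weighted_rate_def
  by (rule weighted_square_derivative) (use assms in \<open>auto intro!: smooth_intros compactly_supported_power vort_smooth\<close>)

lemma weighted_rate_le:
  assumes \<phi>: "smooth \<phi>" "compactly_supported \<phi>" and t: "0 < t" "t < T"
  shows "weighted_rate \<phi> ws i j t \<le> (\<integral>x. (\<phi> x)\<^sup>2 * (4 * (\<Sum>k\<in>UNIV. (flux ws i j t k x)\<^sup>2)
      - (\<Sum>k\<in>UNIV. (word_deriv (k # ws) (vort (U t) i j) x)\<^sup>2))
    + 10 * (\<Sum>k\<in>UNIV. (partial k \<phi> x)\<^sup>2) * (word_deriv ws (vort (U t) i j) x)\<^sup>2 \<partial>lborel)"
proof -
  have tI: "t \<in> {0..<T}" using t by simp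
  have sv: "smooth (vort (U t) i j)" by (intro smooth_vort U_slice_smooth tI)
  show ?thesis
    using parabolic_energy_inequality[OF smooth_word_deriv[OF sv, of ws] flux_smooth[OF tI] \<phi> vorticity_equation[OF t]]
    unfolding weighted_rate_def by (simp add: partial_word_deriv sv)
qed

end

section \<open>Integration in time\<close>

lemma integrated_differential_inequality:
  fixes y z r :: "real \<Rightarrow> real"
  assumes t: "0 \<le> t" and cont: "continuous_on {0..t} y"
    and deriv: "\<And>s. 0 < s \<Longrightarrow> s < t \<Longrightarrow> (y has_vector_derivative y' s) (at s)"
    and le: "\<And>s. 0 < s \<Longrightarrow> s < t \<Longrightarrow> y' s \<le> r s - z s"
    and int: "r integrable_on {0..t}" "z integrable_on {0..t}"
  shows "y t + integral {0..t} z \<le> y 0 + integral {0..t} r"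
proof -
  \<comment> \<open>At the endpoints the derivative is replaced by the right side, so that the
    comparison holds on the closed interval. Integrability of \<open>d\<close> is delivered by the
    fundamental theorem of calculus.\<close>
  define d where "d s = (if 0 < s \<and> s < t then y' s else r s - z s)" for s
  have "(d has_integral (y t - y 0)) {0..t}"
    by (rule fundamental_theorem_of_calculus_interior[OF t cont]) (use deriv in \<open>auto simp: d_def\<close>)
  moreover have "((\<lambda>s. r s - z s) has_integral (integral {0..t} r - integral {0..t} z)) {0..t}"
    by (intro has_integral_diff integrable_integral int)
  ultimately have "y t - y 0 \<le> integral {0..t} r - integral {0..t} z"
    by (rule has_integral_le) (use le in \<open>auto simp: d_def\<close>)
  then show ?thesis by simp
qed

text \<open>Besides \<open>y\<close> the time integral of the dissipation \<open>z\<close> has to be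
  retained. After multiplication by exp (- a s) the nonnegativity of \<open>z\<close> permits its
  weight to be lowered to exp (- a T), and a common factor exp (a T) restores both terms.\<close>

lemma gronwall_with_dissipation:
  fixes y z :: "real \<Rightarrow> real"
  assumes t: "0 \<le> t" "t \<le> T" and cont: "continuous_on {0..t} y"
    and deriv: "\<And>s. 0 < s \<Longrightarrow> s < t \<Longrightarrow> (y has_vector_derivative y' s) (at s)"
    and le: "\<And>s. 0 < s \<Longrightarrow> s < t \<Longrightarrow> y' s \<le> a * y s - z s + D"
    and int: "z integrable_on {0..t}" and nn: "\<And>s. 0 \<le> z s" "0 \<le> y t" "0 \<le> a" "0 \<le> D"
  shows "y t + integral {0..t} z \<le> exp (a * T) * (y 0 + D * T)"
proof -
  define w where "w s = exp (- a * s) * y s" for s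
  have "w t + integral {0..t} (\<lambda>s. exp (- a * T) * z s) \<le> w 0 + integral {0..t} (\<lambda>s. D)"
  proof (rule integrated_differential_inequality[OF t(1)])
    show "continuous_on {0..t} w" unfolding w_def by (intro continuous_intros cont)
    show "(w has_vector_derivative exp (- a * s) * y' s - a * exp (- a * s) * y s) (at s)" if "0 < s" "s < t" for s
      using deriv[OF that] unfolding w_def
      by (auto intro!: derivative_eq_intros simp: has_real_derivative_iff_has_vector_derivative[symmetric])
    show "exp (- a * s) * y' s - a * exp (- a * s) * y s \<le> D - exp (- a * T) * z s" if s: "0 < s" "s < t" for s
    proof -
      have e: "exp (- a * T) \<le> exp (- a * s)" "exp (- a * s) \<le> 1" using s t nn by (auto simp: mult_left_mono)
      have "exp (- a * s) * y' s - a * exp (- a * s) * y s = exp (- a * s) * (y' s - a * y s)"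
        by (simp add: algebra_simps)
      also have "\<dots> \<le> exp (- a * s) * (D - z s)" using le[OF s] by (intro mult_left_mono) auto
      also have "\<dots> = exp (- a * s) * D - exp (- a * s) * z s" by (simp add: algebra_simps)
      also have "\<dots> \<le> 1 * D - exp (- a * T) * z s"
        using e nn by (intro diff_mono mult_right_mono) auto
      finally show ?thesis by simp
    qed
    show "(\<lambda>s. exp (- a * T) * z s) integrable_on {0..t}" using integrable_cmul[OF int, of "exp (- a * T)"] by simp
  qed (auto intro: integrable_const_ivl)
  then have "exp (- a * t) * y t + exp (- a * T) * integral {0..t} z \<le> y 0 + D * t"
    using t by (simp add: w_def mult.commute)
  moreover have "exp (- a * T) * y t \<le> exp (- a * t) * y t"
    using t nn by (intro mult_right_mono) (auto simp: mult_left_mono)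
  moreover have "D * t \<le> D * T" using t nn by (intro mult_left_mono) auto
  ultimately have "exp (- a * T) * (y t + integral {0..t} z) \<le> y 0 + D * T"
    by (simp add: distrib_left)
  then have "exp (a * T) * (exp (- a * T) * (y t + integral {0..t} z)) \<le> exp (a * T) * (y 0 + D * T)"
    by (intro mult_left_mono) auto
  then show ?thesis by (simp add: mult.assoc[symmetric] exp_add[symmetric])
qed

lemma weighted_square_continuous:
  assumes "smooth \<phi>" "compactly_supported \<phi>" "spacetime_smooth T F" "t < T"
  shows "continuous_on {0..t} (\<lambda>s. \<integral>x. \<phi> x * (F s x)\<^sup>2 \<partial>lborel)"
proof -
  have "continuous_on {0..<T} (\<lambda>s. \<integral>x. \<phi> x * (F s x)\<^sup>2 \<partial>lborel)"
    using weighted_square_derivative[OF assms(1-3)]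
    unfolding continuous_on_eq_continuous_within by (blast intro: has_vector_derivative_continuous)
  then show ?thesis by (rule continuous_on_subset) (use assms in auto)
qed

text \<open>The cut-offs increase with the radius, so monotone convergence of gauge integrals also supplies
  the integrability in time, for which nothing is known in advance.\<close>

lemma nsq_time_integral_bound:
  assumes G: "spacetime_smooth T G" and t: "t \<in> {0..<T}" and p: "0 < p"
    and sq: "\<And>s. s \<in> {0..<T} \<Longrightarrow> sq_integrable (G s)"
    and R: "\<And>m. integral {0..t} (\<lambda>s. \<integral>x. cutoff (real (Suc m)) x ^ p * (G s x)\<^sup>2 \<partial>lborel) \<le> R"
  shows "(\<lambda>s. nsq (G s)) integrable_on {0..t}" "integral {0..t} (\<lambda>s. nsq (G s)) \<le> R"
proof -
  let ?f = "\<lambda>m s. \<integral>x. cutoff (real (Suc m)) x ^ p * (G s x)\<^sup>2 \<partial>lborel"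
  have sI: "s \<in> {0..<T}" if "s \<in> {0..t}" for s using that t by auto
  have i: "integrable lborel (\<lambda>x. (G s x)\<^sup>2)" if "s \<in> {0..t}" for s
    using sq[OF sI[OF that]] by (simp add: sq_integrable_def)
  have int: "?f m integrable_on {0..t}" for m
    using t by (intro integrable_continuous_interval weighted_square_continuous[OF _ _ G] smooth_intros
        compactly_supported_power compactly_supported_cutoff p) auto
  have nn: "0 \<le> ?f m s" for m s by (simp add: cutoff_nonneg)
  have *: "(\<lambda>s. nsq (G s)) integrable_on {0..t} \<and> (\<lambda>m. integral {0..t} (?f m)) \<longlonglongrightarrow> integral {0..t} (\<lambda>s. nsq (G s))"
  proof (rule monotone_convergence_increasing[OF int])
    show "?f m s \<le> ?f (Suc m) s" if "s \<in> {0..t}" for m s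
      by (intro integral_mono integrable_cutoff_mult i[OF that] mult_right_mono power_mono cutoff_mono cutoff_nonneg) auto
    show "(\<lambda>m. ?f m s) \<longlonglongrightarrow> nsq (G s)" if "s \<in> {0..t}" for s
      unfolding nsq_def by (rule integral_cutoff_tendsto[OF i[OF that]])
    have "norm (integral {0..t} (?f m)) \<le> R" for m
      using R[of m] integral_nonneg[OF int[of m]] nn by simp
    then show "bounded (range (\<lambda>m. integral {0..t} (?f m)))" unfolding bounded_iff by blast
  qed
  then show "(\<lambda>s. nsq (G s)) integrable_on {0..t}" by blast
  show "integral {0..t} (\<lambda>s. nsq (G s)) \<le> R"
    using LIMSEQ_le_const2[OF conjunct2[OF *]] R by blast
qed

lemma nsq_le_if_cutoff_bounded:
  assumes "sq_integrable g" "\<And>m. (\<integral>x. cutoff (real (Suc m)) x ^ p * (g x)\<^sup>2 \<partial>lborel) \<le> R"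
  shows "nsq g \<le> R"
  using LIMSEQ_le_const2[OF integral_cutoff_tendsto[of "\<lambda>x. (g x)\<^sup>2" p], of R] assms
  by (auto simp: sq_integrable_def nsq_def)

lemma cutoff_weight_le_nsq:
  "sq_integrable g \<Longrightarrow> (\<integral>x. cutoff R x ^ p * (g x)\<^sup>2 \<partial>lborel) \<le> nsq g"
  unfolding nsq_def sq_integrable_def by (intro integral_cutoff_le) auto

lemma nsq_le_enstrophy: "nsq (word_deriv ws (vort u i j)) \<le> enstrophy (length ws) u"
proof -
  have "nsq (word_deriv ws (vort u i j)) \<le> (\<Sum>j\<in>UNIV. nsq (word_deriv ws (vort u i j)))"
    by (rule member_le_sum) (auto simp: nsq_nonneg)
  also have "\<dots> \<le> (\<Sum>i\<in>UNIV. \<Sum>j\<in>UNIV. nsq (word_deriv ws (vort u i j)))"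
    by (rule member_le_sum[of i UNIV "\<lambda>i. \<Sum>j\<in>UNIV. nsq (word_deriv ws (vort u i j))"]) (auto simp: nsq_nonneg sum_nonneg)
  also have "\<dots> \<le> enstrophy (length ws) u"
    unfolding enstrophy_def
    by (rule member_le_sum[of ws "words (length ws)" "\<lambda>ws. \<Sum>i\<in>UNIV. \<Sum>j\<in>UNIV. nsq (word_deriv ws (vort u i j))"])
      (auto simp: words_def sum_nonneg nsq_nonneg finite_words[unfolded words_def])
  finally show ?thesis .
qed

lemma enstrophy_le:
  assumes "\<And>ws i j. length ws = n \<Longrightarrow> nsq (word_deriv ws (vort u i j)) \<le> R"
  shows "enstrophy n u \<le> 9 * real (card (words n)) * R"
proof -
  have "enstrophy n u \<le> (\<Sum>ws\<in>words n. \<Sum>i\<in>(UNIV::3 set). \<Sum>j\<in>(UNIV::3 set). R)"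
    unfolding enstrophy_def by (intro sum_mono assms) (simp add: words_def)
  then show ?thesis by simp
qed

lemma enstrophy_time_integral:
  assumes "\<And>ws i j. length ws = n \<Longrightarrow> (\<lambda>s. nsq (word_deriv ws (vort (U s) i j))) integrable_on S"
    and "\<And>ws i j. length ws = n \<Longrightarrow> integral S (\<lambda>s. nsq (word_deriv ws (vort (U s) i j))) \<le> R"
  shows "(\<lambda>s. enstrophy n (U s)) integrable_on S" "integral S (\<lambda>s. enstrophy n (U s)) \<le> 9 * real (card (words n)) * R"
proof -
  have len: "ws \<in> words n \<Longrightarrow> length ws = n" for ws by (simp add: words_def)
  show "(\<lambda>s. enstrophy n (U s)) integrable_on S"
    unfolding enstrophy_def by (intro integrable_sum finite_words assms(1) len) auto
  have "integral S (\<lambda>s. enstrophy n (U s)) = (\<Sum>ws\<in>words n. \<Sum>i\<in>UNIV. \<Sum>j\<in>UNIV. integral S (\<lambda>s. nsq (word_deriv ws (vort (U s) i j))))"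
    unfolding enstrophy_def
    by (simp add: integral_sum finite_words integrable_sum assms(1) len)
  also have "\<dots> \<le> (\<Sum>ws\<in>words n. \<Sum>i\<in>(UNIV::3 set). \<Sum>j\<in>(UNIV::3 set). R)"
    by (intro sum_mono assms(2) len)
  finally show "integral S (\<lambda>s. enstrophy n (U s)) \<le> 9 * real (card (words n)) * R" by simp
qed

text \<open>Integrating the derivatives in \<open>f = \<partial>\<^sub>i v - \<partial>\<^sub>j w\<close> by parts trades the local \<open>L\<^sup>2\<close> norm of \<open>f\<close>
  for the bound \<open>M\<close> and a small multiple of the dissipation.  Multiplied by \<open>1 / \<rho>\<^sup>2\<close>, the first term
  stays bounded because the support of the cut-off has volume of order \<open>\<rho>\<^sup>3\<close>.\<close>

lemma cutoff_vorticity_bound: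
  fixes f v w :: "real^3 \<Rightarrow> real"
  assumes sm: "smooth f" "smooth v" "smooth w" and f: "\<And>x. f x = partial i v x - partial j w x"
    and M: "\<And>x. \<bar>v x\<bar> \<le> M" "\<And>x. \<bar>w x\<bar> \<le> M" and \<rho>: "1 \<le> \<rho>" and \<eta>: "0 < \<eta>"
  shows "(\<integral>x. (cutoff \<rho> x)\<^sup>2 * (f x)\<^sup>2 \<partial>lborel) \<le> 8 * \<rho> * (M\<^sup>2 * (16 * cutoff_const\<^sup>2 + 1 / \<eta>))
    + 4 * \<eta> * \<rho>\<^sup>2 * (\<integral>x. (cutoff \<rho> x) ^ 4 * (\<Sum>k\<in>UNIV. (partial k f x)\<^sup>2) \<partial>lborel)"
proof -
  let ?c = "cutoff \<rho>"
  let ?Q = "cbox (- \<rho> *\<^sub>R One) (\<rho> *\<^sub>R One) :: (real^3) set"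
  define H where "H v = (\<lambda>x. (?c x)\<^sup>2 * (f x * v x))" for v
  have cs: "compactly_supported ?c" by (rule compactly_supported_cutoff) (use \<rho> in simp)
  have sc: "smooth ?c" by (rule smooth_cutoff)
  have H: "smooth (H v)" "compactly_supported (H v)" if "smooth v" for v
    unfolding H_def by (intro smooth_intros sm that compactly_supported_mult1 compactly_supported_power cs; simp)+
  have pH: "partial i (H v) = (\<lambda>x. 2 * ?c x * partial i ?c x * (f x * v x) + (?c x)\<^sup>2 * (partial i f x * v x + f x * partial i v x))"
    if "smooth v" for v i
    unfolding H_def using that by (simp add: partial_mult partial_power smooth_intros sm)
  have iH: "integrable lborel (partial i (H v))" if "smooth v" for v i
    by (intro smooth_compact_integrable smooth_partial compactly_supported_partial H that)
  \<comment> \<open>The cube of side 2 \<open>\<rho>\<close> contains the support of the cut-off;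
    its volume 8 \<open>\<rho>\<close>^3 integrates the constant remainders of Young's
    inequality.\<close>
  have Qm: "integrable lborel (\<lambda>x. indicator ?Q x * B)" "(\<integral>x. indicator ?Q x * B \<partial>lborel) = 8 * \<rho> ^ 3 * B" for B :: real
  proof -
    have "emeasure lborel ?Q < \<infinity>" by (simp add: emeasure_lborel_cbox_eq)
    then show "integrable lborel (\<lambda>x. indicator ?Q x * B)"
      by (intro integrable_mult_left integrable_real_indicator) auto
    have "measure lborel ?Q = (\<Prod>b\<in>(Basis::(real^3) set). 2 * \<rho>)"
    proof -
      have One: "(One :: real^3) \<bullet> b = 1" if "b \<in> Basis" for b
        using that by (simp add: inner_sum_left inner_Basis cong: sum.cong)
      have eq: "(\<rho> *\<^sub>R One - - \<rho> *\<^sub>R One) \<bullet> b = 2 * \<rho>" and le: "(- \<rho> *\<^sub>R One) \<bullet> b \<le> (\<rho> *\<^sub>R One) \<bullet> b"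
        if "b \<in> (Basis :: (real^3) set)" for b
        using One[OF that] \<rho> by (simp_all only: inner_diff_left inner_scaleR_left)
      have "measure lborel ?Q = (\<Prod>b\<in>(Basis::(real^3) set). (\<rho> *\<^sub>R One - - \<rho> *\<^sub>R One) \<bullet> b)"
        by (rule measure_lborel_cbox) (rule le)
      also have "\<dots> = (\<Prod>b\<in>(Basis::(real^3) set). 2 * \<rho>)" by (rule prod.cong[OF refl]) (rule eq)
      finally show ?thesis .
    qed
    also have "\<dots> = 8 * \<rho> ^ 3" by (simp add: power_mult_distrib)
    finally show "(\<integral>x. indicator ?Q x * B \<partial>lborel) = 8 * \<rho> ^ 3 * B" by simp
  qed
  let ?S = "\<lambda>x. \<Sum>k\<in>UNIV. (partial k f x)\<^sup>2"
  let ?B = "M\<^sup>2 / \<rho>\<^sup>2 * (8 * cutoff_const\<^sup>2 + 1 / (2 * \<eta>))"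
  have iS: "integrable lborel (\<lambda>x. ?c x ^ 4 * ?S x)"
    by (intro smooth_compact_integrable smooth_intros sm compactly_supported_mult1 compactly_supported_power cs) simp
  have iL: "integrable lborel (\<lambda>x. (?c x)\<^sup>2 * (f x)\<^sup>2)"
    by (intro smooth_compact_integrable smooth_intros sm compactly_supported_mult1 compactly_supported_power cs) simp
  \<comment> \<open>Here a stands for f, c for the cut-off, d for its derivative, e for a derivative
    of f, and u for v or - w. Two squares are completed; the weight \<open>\<eta>\<close> *
    \<open>\<rho>\<close>^2 anticipates a later division by \<open>\<rho>\<close>^2.\<close>
  have young: "- (2 * c * d * (a * u)) - c\<^sup>2 * (e * u) \<le> (1/4) * (c\<^sup>2 * a\<^sup>2) + \<eta> * \<rho>\<^sup>2 * (c ^ 4 * e\<^sup>2)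
      + M\<^sup>2 / \<rho>\<^sup>2 * (4 * cutoff_const\<^sup>2 + 1 / (4 * \<eta>))"
    if d: "\<bar>d\<bar> \<le> cutoff_const / \<rho>" and u: "\<bar>u\<bar> \<le> M" for a c d e u :: real
  proof -
    have u2: "u\<^sup>2 \<le> M\<^sup>2" using u by (metis abs_ge_zero power2_abs power_mono)
    have d2: "d\<^sup>2 \<le> cutoff_const\<^sup>2 / \<rho>\<^sup>2" using d by (metis abs_ge_zero power2_abs power_mono power_divide)
    have "0 \<le> ((1/2) * (c * a) + 2 * (d * u))\<^sup>2" by simp
    then have 1: "- (2 * c * d * (a * u)) \<le> (1/4) * (c\<^sup>2 * a\<^sup>2) + 4 * (d\<^sup>2 * u\<^sup>2)"
      by (simp add: power2_eq_square algebra_simps)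
    have "d\<^sup>2 * u\<^sup>2 \<le> (cutoff_const\<^sup>2 / \<rho>\<^sup>2) * M\<^sup>2" using d2 u2 by (intro mult_mono) auto
    then have "4 * (d\<^sup>2 * u\<^sup>2) \<le> 4 * ((cutoff_const\<^sup>2 / \<rho>\<^sup>2) * M\<^sup>2)" by simp
    also have "\<dots> = M\<^sup>2 / \<rho>\<^sup>2 * (4 * cutoff_const\<^sup>2)" by simp
    finally have 2: "4 * (d\<^sup>2 * u\<^sup>2) \<le> M\<^sup>2 / \<rho>\<^sup>2 * (4 * cutoff_const\<^sup>2)" .
    define l where "l = \<eta> * \<rho>\<^sup>2"
    have l: "0 < l" unfolding l_def using \<eta> \<rho> by simp
    have "0 \<le> (2 * l * (c\<^sup>2 * e) + u)\<^sup>2" by simp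
    then have "- (4 * l * (c\<^sup>2 * (e * u))) \<le> 4 * l * (l * (c ^ 4 * e\<^sup>2)) + u\<^sup>2"
      by (simp add: power2_eq_square power4_eq_xxxx algebra_simps)
    then have "- (c\<^sup>2 * (e * u)) \<le> l * (c ^ 4 * e\<^sup>2) + u\<^sup>2 / (4 * l)"
      using l by (simp add: field_simps)
    also have "u\<^sup>2 / (4 * l) \<le> M\<^sup>2 / (4 * l)" using u2 l by (intro divide_right_mono) auto
    also have "M\<^sup>2 / (4 * l) = M\<^sup>2 / \<rho>\<^sup>2 * (1 / (4 * \<eta>))" unfolding l_def using \<eta> \<rho> by (simp add: field_simps)
    finally have 3: "- (c\<^sup>2 * (e * u)) \<le> \<eta> * \<rho>\<^sup>2 * (c ^ 4 * e\<^sup>2) + M\<^sup>2 / \<rho>\<^sup>2 * (1 / (4 * \<eta>))"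
      unfolding l_def by simp
    show ?thesis using 1 2 3 by (simp add: distrib_left)
  qed
  have pw: "(1/2) * ((?c x)\<^sup>2 * (f x)\<^sup>2) \<le> (partial i (H v) x - partial j (H w) x) + indicator ?Q x * ?B
      + 2 * \<eta> * \<rho>\<^sup>2 * (?c x ^ 4 * ?S x)" for x
  proof (cases "x \<in> ?Q")
    case False
    have "\<rho> \<le> norm x"
    proof (rule ccontr)
      assume "\<not> \<rho> \<le> norm x"
      then have "\<bar>x \<bullet> b\<bar> \<le> \<rho>" if "b \<in> Basis" for b using Basis_le_norm[OF that, of x] by linarith
      then have "x \<in> ?Q" by (auto simp: mem_box inner_sum_left_Basis abs_le_iff) (smt (verit))+
      with False show False by simp
    qed
    then have "?c x = 0" using cutoff_eq_0 \<rho> by simp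
    then show ?thesis using False by (simp add: pH sm)
  next
    case True
    have d: "\<bar>partial k ?c x\<bar> \<le> cutoff_const / \<rho>" for k using cutoff_const(2) \<rho> by simp
    have mem: "(partial k f x)\<^sup>2 \<le> ?S x" for k by (rule member_le_sum) auto
    \<comment> \<open>The product rule, after one of the two factors f has been replaced by the
      difference of derivatives of v and w.\<close>
    have e: "(?c x)\<^sup>2 * (f x)\<^sup>2 = partial i (H v) x - partial j (H w) x
        + (- (2 * ?c x * partial i ?c x * (f x * v x)) - (?c x)\<^sup>2 * (partial i f x * v x))
        + (- (2 * ?c x * partial j ?c x * (f x * (- w x))) - (?c x)\<^sup>2 * (partial j f x * (- w x)))"
    proof -
      have "partial i v x = f x + partial j w x" using f[of x] by simp
      then show ?thesis by (simp add: pH sm power2_eq_square algebra_simps)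
    qed
    have t1: "- (2 * ?c x * partial i ?c x * (f x * v x)) - (?c x)\<^sup>2 * (partial i f x * v x)
        \<le> (1/4) * ((?c x)\<^sup>2 * (f x)\<^sup>2) + \<eta> * \<rho>\<^sup>2 * (?c x ^ 4 * (partial i f x)\<^sup>2) + M\<^sup>2 / \<rho>\<^sup>2 * (4 * cutoff_const\<^sup>2 + 1 / (4 * \<eta>))"
      by (rule young[OF d]) (rule M)
    have t2: "- (2 * ?c x * partial j ?c x * (f x * (- w x))) - (?c x)\<^sup>2 * (partial j f x * (- w x))
        \<le> (1/4) * ((?c x)\<^sup>2 * (f x)\<^sup>2) + \<eta> * \<rho>\<^sup>2 * (?c x ^ 4 * (partial j f x)\<^sup>2) + M\<^sup>2 / \<rho>\<^sup>2 * (4 * cutoff_const\<^sup>2 + 1 / (4 * \<eta>))"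
      by (rule young[OF d]) (use M in simp)
    have t3: "\<eta> * \<rho>\<^sup>2 * (?c x ^ 4 * (partial k f x)\<^sup>2) \<le> \<eta> * \<rho>\<^sup>2 * (?c x ^ 4 * ?S x)" for k
      using \<eta> by (intro mult_left_mono mem) auto
    have t4: "2 * (M\<^sup>2 / \<rho>\<^sup>2 * (4 * cutoff_const\<^sup>2 + 1 / (4 * \<eta>))) = ?B" by (simp add: algebra_simps)
    have t5: "2 * \<eta> * \<rho>\<^sup>2 * (?c x ^ 4 * ?S x) = 2 * (\<eta> * \<rho>\<^sup>2 * (?c x ^ 4 * ?S x))"
      and t6: "indicator ?Q x * ?B = ?B" using True by simp_all
    \<comment> \<open>Naming the nonlinear terms leaves a statement of linear arithmetic.\<close>
    have combine: "(1/2) * X \<le> P + B + 2 * G"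
      if "X = P + A1 + A2" "A1 \<le> (1/4) * X + G1 + Y" "A2 \<le> (1/4) * X + G2 + Y" "G1 \<le> G" "G2 \<le> G" "2 * Y = B"
      for X P A1 A2 G1 G2 G Y B :: real
      using that by linarith
    show ?thesis unfolding t5 t6 by (rule combine[OF e t1 t2 t3 t3 t4])
  qed
  let ?d = "\<lambda>x. partial i (H v) x - partial j (H w) x"
  have id: "integrable lborel ?d" "(\<integral>x. ?d x \<partial>lborel) = 0"
    using iH[OF sm(2)] iH[OF sm(3)] integral_partial_eq_0_compact[OF H[OF sm(2)]] integral_partial_eq_0_compact[OF H[OF sm(3)]]
    by simp_all
  have "(\<integral>x. (1/2) * ((?c x)\<^sup>2 * (f x)\<^sup>2) \<partial>lborel)
      \<le> (\<integral>x. ?d x + indicator ?Q x * ?B + 2 * \<eta> * \<rho>\<^sup>2 * (?c x ^ 4 * ?S x) \<partial>lborel)"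
    by (rule integral_mono[OF _ _ pw])
      (intro Bochner_Integration.integrable_add integrable_mult_right id(1) Qm(1) iS iL)+
  also have "\<dots> = 0 + 8 * \<rho> ^ 3 * ?B + 2 * \<eta> * \<rho>\<^sup>2 * (\<integral>x. ?c x ^ 4 * ?S x \<partial>lborel)"
    using id(1) Qm(1)[of ?B] iS by (simp only: Bochner_Integration.integral_add Bochner_Integration.integrable_add
        integrable_mult_right Qm(2) id(2) integral_mult_right_zero)
  finally have "(\<integral>x. (?c x)\<^sup>2 * (f x)\<^sup>2 \<partial>lborel)
      \<le> 2 * (8 * \<rho> ^ 3 * ?B) + 4 * \<eta> * \<rho>\<^sup>2 * (\<integral>x. ?c x ^ 4 * ?S x \<partial>lborel)" by simp
  also have "2 * (8 * \<rho> ^ 3 * ?B) = 8 * \<rho> * (M\<^sup>2 * (16 * cutoff_const\<^sup>2 + 1 / \<eta>))"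
    using \<rho> \<eta> by (simp add: field_simps power2_eq_square power3_eq_cube)
  finally show ?thesis .
qed

lemma weighted_square_integrable:
  assumes "smooth \<phi>" "compactly_supported \<phi>" "smooth g"
  shows "integrable lborel (\<lambda>x. \<phi> x * (g x)\<^sup>2)"
  by (intro smooth_compact_integrable smooth_intros compactly_supported_mult1 assms)

context bounded_flow
begin

lemma vort_H: "t \<in> {0..<T} \<Longrightarrow> H_infinity (vort (U t) i j)"
  by (intro H_infinity_vort U_H)

lemma vort_sq: "t \<in> {0..<T} \<Longrightarrow> sq_integrable (word_deriv ws (vort (U t) i j))"
  by (intro H_infinity_sq_integrable vort_H)

lemma energy_le_enstrophy_flow: "t \<in> {0..<T} \<Longrightarrow> energy (Suc n) (U t) \<le> enstrophy n (U t)"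
  by (intro energy_le_enstrophy U_H div_free)

lemma enstrophy_le_energy_flow: "t \<in> {0..<T} \<Longrightarrow> enstrophy n (U t) \<le> 4 * energy (Suc n) (U t)"
  by (intro enstrophy_le_energy U_H)

lemma weighted_derivative_at:
  assumes "smooth \<phi>" "compactly_supported \<phi>" "0 < s" "s < T"
  shows "((\<lambda>s. \<integral>x. (\<phi> x)\<^sup>2 * (word_deriv ws (vort (U s) i j) x)\<^sup>2 \<partial>lborel) has_vector_derivative
    weighted_rate \<phi> ws i j s) (at s)"
proof -
  have "at s within {0..<T} = at s" by (rule at_within_interior) (use assms in \<open>simp add: interior_atLeastLessThan\<close>)
  then show ?thesis using weighted_rate_derivative[OF assms(1,2), of s ws i j] assms by simp
qed

text \<open>No decay in R is needed: |grad c|^2 is bounded for R >= 1 and multiplies the squared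
  norm of an entry that \<open>enstrophy (n - 1)\<close> dominates. In the constants, 8 = 4 * 2
  comes from \<open>flux_sq_le\<close>, 640 is twice 8 * 40, and 30 is 10 for each of three
  directions.\<close>

lemma higher_rate_component:
  assumes "s \<in> {0..<T}" and R: "R = real (Suc m)"
    and n: "2 \<le> n" "Suc (length ws) = n" and K: "0 \<le> K" "\<And>l. 1 \<le> l \<Longrightarrow> l < n \<Longrightarrow> energy l (U s) \<le> K"
    and s0: "0 < s"
  shows "weighted_rate (cutoff R) ws i j s
    \<le> (640 * 4 ^ n * product_const M K + 30 * cutoff_const\<^sup>2) * (1 + enstrophy (n - 1) (U s))
      - (\<integral>x. (cutoff R x)\<^sup>2 * (\<Sum>k\<in>UNIV. (word_deriv (k # ws) (vort (U s) i j) x)\<^sup>2) \<partial>lborel)"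
proof -
  let ?c = "cutoff R"
  let ?G = "\<lambda>j. word_deriv ws (lamb (U s) j)" and ?B = "word_deriv ws (vort (U s) i j)"
  let ?S = "\<lambda>x. \<Sum>k\<in>UNIV. (word_deriv (k # ws) (vort (U s) i j) x)\<^sup>2"
  have cs: "compactly_supported ?c" and sc: "smooth ?c" and R1: "1 \<le> R"
    using R by (auto intro: compactly_supported_cutoff smooth_cutoff)
  have sv: "smooth (vort (U s) i j)" by (rule H_infinity_smooth[OF vort_H[OF assms(1)]])
  note sG = smooth_lamb[of "U s", OF U_slice_smooth[OF assms(1)]]
  have G: "sq_integrable (?G j)" "nsq (?G j) \<le> 40 * 4 ^ n * product_const M K * (1 + energy n (U s))" for j
    using lamb_estimate[where u = "U s", OF U_H[OF assms(1)] U_bound[OF assms(1)] n(1) K(1) _ n(2)] K(2) by blast+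
  have B: "sq_integrable ?B" by (rule vort_sq[OF assms(1)])
  have e: "energy n (U s) \<le> enstrophy (n - 1) (U s)"
    using energy_le_enstrophy_flow[OF assms(1), of "n - 1"] n by simp
  have nB: "nsq ?B \<le> enstrophy (n - 1) (U s)"
    using nsq_le_enstrophy[of ws "U s" i j] n by (metis diff_Suc_1)
  have P: "0 \<le> product_const M K" unfolding product_const_def using K(1) sobolev_const_ge by simp
  have iS: "integrable lborel (\<lambda>x. (?c x)\<^sup>2 * ?S x)"
    by (intro smooth_compact_integrable smooth_intros sv compactly_supported_mult1 compactly_supported_power cs smooth_word_deriv) simp
  have iR: "integrable lborel (\<lambda>x. (8 * (?G i x)\<^sup>2 + 8 * (?G j x)\<^sup>2 + 30 * cutoff_const\<^sup>2 * (?B x)\<^sup>2) - (?c x)\<^sup>2 * ?S x)"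
    using G(1)[of i] G(1)[of j] B iS by (simp add: sq_integrable_def)
  have iL: "integrable lborel (\<lambda>x. (?c x)\<^sup>2 * (4 * (\<Sum>k\<in>UNIV. (flux ws i j s k x)\<^sup>2) - ?S x)
      + 10 * (\<Sum>k\<in>UNIV. (partial k ?c x)\<^sup>2) * (?B x)\<^sup>2)"
    by (intro smooth_compact_integrable smooth_intros sv smooth_word_deriv flux_smooth[OF assms(1)] compactly_supported_add)
      (intro compactly_supported_mult1 compactly_supported_mult2 compactly_supported_sum compactly_supported_power compactly_supported_partial cs; simp)+
  have pw: "(?c x)\<^sup>2 * (4 * (\<Sum>k\<in>UNIV. (flux ws i j s k x)\<^sup>2) - ?S x) + 10 * (\<Sum>k\<in>UNIV. (partial k ?c x)\<^sup>2) * (?B x)\<^sup>2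
      \<le> (8 * (?G i x)\<^sup>2 + 8 * (?G j x)\<^sup>2 + 30 * cutoff_const\<^sup>2 * (?B x)\<^sup>2) - (?c x)\<^sup>2 * ?S x" for x
  proof -
    let ?F = "\<Sum>k\<in>UNIV. (flux ws i j s k x)\<^sup>2"
    have "(?c x)\<^sup>2 * (4 * ?F) \<le> 1 * (4 * ?F)"
      by (intro mult_right_mono) (auto simp: power_le_one cutoff_nonneg cutoff_le_1 sum_nonneg)
    also have "\<dots> \<le> 8 * (?G i x)\<^sup>2 + 8 * (?G j x)\<^sup>2" using flux_sq_le[of ws i j s x] by simp
    finally have 1: "(?c x)\<^sup>2 * (4 * ?F) \<le> 8 * (?G i x)\<^sup>2 + 8 * (?G j x)\<^sup>2" .
    have "(\<Sum>k\<in>UNIV. (partial k ?c x)\<^sup>2) \<le> (\<Sum>k\<in>(UNIV::3 set). cutoff_const\<^sup>2)"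
      by (intro sum_mono cutoff_gradient_sq R1)
    then have "10 * (\<Sum>k\<in>UNIV. (partial k ?c x)\<^sup>2) * (?B x)\<^sup>2 \<le> 30 * cutoff_const\<^sup>2 * (?B x)\<^sup>2"
      by (intro mult_right_mono) auto
    with 1 show ?thesis by (simp add: right_diff_distrib)
  qed
  have "weighted_rate ?c ws i j s \<le> (\<integral>x. (?c x)\<^sup>2 * (4 * (\<Sum>k\<in>UNIV. (flux ws i j s k x)\<^sup>2) - ?S x)
      + 10 * (\<Sum>k\<in>UNIV. (partial k ?c x)\<^sup>2) * (?B x)\<^sup>2 \<partial>lborel)"
    by (rule weighted_rate_le[OF sc cs s0]) (use assms in auto)
  also have "\<dots> \<le> (\<integral>x. (8 * (?G i x)\<^sup>2 + 8 * (?G j x)\<^sup>2 + 30 * cutoff_const\<^sup>2 * (?B x)\<^sup>2) - (?c x)\<^sup>2 * ?S x \<partial>lborel)"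
    by (rule integral_mono[OF iL iR pw])
  also have "\<dots> = 8 * nsq (?G i) + 8 * nsq (?G j) + 30 * cutoff_const\<^sup>2 * nsq ?B - (\<integral>x. (?c x)\<^sup>2 * ?S x \<partial>lborel)"
    using G(1)[of i] G(1)[of j] B iS by (simp add: sq_integrable_def nsq_def)
  also have "\<dots> \<le> (640 * 4 ^ n * product_const M K + 30 * cutoff_const\<^sup>2) * (1 + enstrophy (n - 1) (U s))
      - (\<integral>x. (?c x)\<^sup>2 * ?S x \<partial>lborel)"
  proof -
    let ?E = "1 + enstrophy (n - 1) (U s)"
    have "40 * 4 ^ n * product_const M K * (1 + energy n (U s)) \<le> 40 * 4 ^ n * product_const M K * ?E"
      using e P by (intro mult_left_mono) auto
    then have "nsq (?G j) \<le> 40 * 4 ^ n * product_const M K * ?E" for j using G(2)[of j] by linarith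
    from this[of i] this[of j] have g: "8 * nsq (?G i) + 8 * nsq (?G j) \<le> 640 * 4 ^ n * product_const M K * ?E" by linarith
    have "30 * cutoff_const\<^sup>2 * nsq ?B \<le> 30 * cutoff_const\<^sup>2 * ?E"
      using nB by (intro mult_left_mono) auto
    with g show ?thesis by (simp only: distrib_right)
  qed
  finally show ?thesis .
qed

text \<open>No Gronwall argument is needed: the forcing is at most linear in \<open>enstrophy (n - 1)\<close>, whose time
  integral is the dissipation controlled at the preceding level.\<close>

lemma higher_step_component:
  assumes n: "2 \<le> n" "Suc (length ws) = n" and K: "0 \<le> K"
    and Kn: "\<And>t l. t \<in> {0..<T} \<Longrightarrow> 1 \<le> l \<Longrightarrow> l < n \<Longrightarrow> energy l (U t) \<le> K"
    and Ki: "\<And>t. t \<in> {0..<T} \<Longrightarrow> (\<lambda>s. enstrophy (n - 1) (U s)) integrable_on {0..t}"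
      "\<And>t. t \<in> {0..<T} \<Longrightarrow> integral {0..t} (\<lambda>s. enstrophy (n - 1) (U s)) \<le> K"
    and E0: "energy n (U 0) \<le> E0" and t: "t \<in> {0..<T}"
  defines "R \<equiv> 4 * E0 + (640 * 4 ^ n * product_const M K + 30 * cutoff_const\<^sup>2) * (T + K)"
  shows "nsq (word_deriv ws (vort (U t) i j)) \<le> R"
    "(\<lambda>s. nsq (word_deriv (k # ws) (vort (U s) i j))) integrable_on {0..t}"
    "integral {0..t} (\<lambda>s. nsq (word_deriv (k # ws) (vort (U s) i j))) \<le> R"
proof -
  define C where "C = 640 * 4 ^ n * product_const M K + 30 * cutoff_const\<^sup>2"
  have C: "0 \<le> C" unfolding C_def product_const_def using K(1) sobolev_const_ge by simp
  let ?B = "\<lambda>s. word_deriv ws (vort (U s) i j)" and ?D = "\<lambda>k s. word_deriv (k # ws) (vort (U s) i j)"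
  define y where "y m s = (\<integral>x. (cutoff (real (Suc m)) x)\<^sup>2 * (?B s x)\<^sup>2 \<partial>lborel)" for m s
  define d where "d k m s = (\<integral>x. (cutoff (real (Suc m)) x)\<^sup>2 * (?D k s x)\<^sup>2 \<partial>lborel)" for k m s
  have c: "smooth (cutoff (real (Suc m)))" "compactly_supported (cutoff (real (Suc m)))" for m
    by (rule smooth_cutoff) (rule compactly_supported_cutoff, simp)
  have c2: "smooth (\<lambda>x. (cutoff (real (Suc m)) x)\<^sup>2)" "compactly_supported (\<lambda>x. (cutoff (real (Suc m)) x)\<^sup>2)" for m
    by (rule C_infinity_on_power[OF c(1)]) (rule compactly_supported_power[OF c(2)], simp)
  have contd: "continuous_on {0..t} (d k m)" for k m
    unfolding d_def by (rule weighted_square_continuous[OF c2 vort_smooth]) (use t in auto)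
  have conty: "continuous_on {0..t} (y m)" for m
    unfolding y_def by (rule weighted_square_continuous[OF c2 vort_smooth]) (use t in auto)
  have dn: "0 \<le> d k m s" for k m s unfolding d_def by simp
  have yn: "0 \<le> y m s" for m s unfolding y_def by simp
  have T0: "0 \<in> {0..<T}" using T_pos by simp
  have key: "y m t + integral {0..t} (\<lambda>s. \<Sum>k\<in>UNIV. d k m s) \<le> R" for m
  proof -
    have "y m t + integral {0..t} (\<lambda>s. \<Sum>k\<in>UNIV. d k m s)
        \<le> y m 0 + integral {0..t} (\<lambda>s. C * (1 + enstrophy (n - 1) (U s)))"
    proof (rule integrated_differential_inequality[OF _ conty])
      show "(y m has_vector_derivative weighted_rate (cutoff (real (Suc m))) ws i j s) (at s)" if "0 < s" "s < t" for s
        unfolding y_def by (rule weighted_derivative_at[OF c]) (use that t in auto)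
      show "weighted_rate (cutoff (real (Suc m))) ws i j s \<le> C * (1 + enstrophy (n - 1) (U s)) - (\<Sum>k\<in>UNIV. d k m s)"
        if s: "0 < s" "s < t" for s
      proof -
        have sI: "s \<in> {0..<T}" using s t by auto
        have "(\<integral>x. (cutoff (real (Suc m)) x)\<^sup>2 * (\<Sum>k\<in>UNIV. (?D k s x)\<^sup>2) \<partial>lborel) = (\<Sum>k\<in>UNIV. d k m s)"
          unfolding d_def sum_distrib_left
          by (rule Bochner_Integration.integral_sum)
            (intro weighted_square_integrable c2 smooth_word_deriv H_infinity_smooth[OF vort_H[OF sI]])
        then show ?thesis
          using higher_rate_component[OF sI refl n K(1) Kn[OF sI] s(1), of m i j] unfolding C_def by simp
      qed
      show "(\<lambda>s. C * (1 + enstrophy (n - 1) (U s))) integrable_on {0..t}"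
        by (intro integrable_on_mult_right integrable_add integrable_const_ivl Ki(1)[OF t])
      show "(\<lambda>s. \<Sum>k\<in>UNIV. d k m s) integrable_on {0..t}"
        by (intro integrable_sum integrable_continuous_interval contd) auto
    qed (use t in auto)
    also have "y m 0 \<le> 4 * E0"
    proof -
      have "y m 0 \<le> nsq (?B 0)" unfolding y_def by (rule cutoff_weight_le_nsq[OF vort_sq[OF T0]])
      also have "\<dots> \<le> enstrophy (n - 1) (U 0)" using nsq_le_enstrophy[of ws "U 0" i j] n
        by (metis diff_Suc_1)
      also have "\<dots> \<le> 4 * energy n (U 0)" using enstrophy_le_energy_flow[OF T0, of "n - 1"] n by simp
      finally show ?thesis using E0 by simp
    qed
    also have "integral {0..t} (\<lambda>s. C * (1 + enstrophy (n - 1) (U s))) \<le> C * (T + K)"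
    proof -
      have "integral {0..t} (\<lambda>s. C * (1 + enstrophy (n - 1) (U s))) = C * (t + integral {0..t} (\<lambda>s. enstrophy (n - 1) (U s)))"
        using integral_add[OF integrable_const_ivl[of 1 0 t] Ki(1)[OF t]] t by simp
      also have "\<dots> \<le> C * (T + K)" using C t Ki(2)[OF t] by (intro mult_left_mono add_mono) auto
      finally show ?thesis .
    qed
    finally show ?thesis unfolding R_def C_def by simp
  qed
  have ii: "0 \<le> integral {0..t} (\<lambda>s. \<Sum>k\<in>UNIV. d k m s)" for m
    by (intro integral_nonneg integrable_sum integrable_continuous_interval contd) (auto simp: dn sum_nonneg)
  show "nsq (?B t) \<le> R"
  proof (rule nsq_le_if_cutoff_bounded[OF vort_sq[OF t], where p = 2])
    show "(\<integral>x. (cutoff (real (Suc m)) x)\<^sup>2 * (?B t x)\<^sup>2 \<partial>lborel) \<le> R" for m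
      using key[of m] ii[of m] by (simp add: y_def)
  qed
  have di: "integral {0..t} (\<lambda>s. \<integral>x. cutoff (real (Suc m)) x ^ 2 * (?D k s x)\<^sup>2 \<partial>lborel) \<le> R" for m
  proof -
    have "integral {0..t} (d k m) \<le> integral {0..t} (\<lambda>s. \<Sum>k\<in>UNIV. d k m s)"
      by (intro integral_le integrable_sum integrable_continuous_interval contd member_le_sum) (auto simp: dn)
    then show ?thesis using key[of m] yn[of m t] unfolding d_def by linarith
  qed
  show "(\<lambda>s. nsq (?D k s)) integrable_on {0..t}" "integral {0..t} (\<lambda>s. nsq (?D k s)) \<le> R"
    using nsq_time_integral_bound[OF vort_smooth t _ vort_sq di] by simp_all
qed


text \<open>\<open>energy n\<close> is read off from \<open>enstrophy (n - 1)\<close>, while the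
  dissipation yields \<open>enstrophy n\<close>; hence the two different numbers of words.\<close>

lemma higher_step:
  assumes n: "2 \<le> n" and K: "0 \<le> K"
    and Kn: "\<And>t l. t \<in> {0..<T} \<Longrightarrow> 1 \<le> l \<Longrightarrow> l < n \<Longrightarrow> energy l (U t) \<le> K"
    and Ki: "\<And>t. t \<in> {0..<T} \<Longrightarrow> (\<lambda>s. enstrophy (n - 1) (U s)) integrable_on {0..t}"
      "\<And>t. t \<in> {0..<T} \<Longrightarrow> integral {0..t} (\<lambda>s. enstrophy (n - 1) (U s)) \<le> K"
    and E0: "energy n (U 0) \<le> E0" and t: "t \<in> {0..<T}"
  defines "R \<equiv> 4 * E0 + (640 * 4 ^ n * product_const M K + 30 * cutoff_const\<^sup>2) * (T + K)"
  shows "energy n (U t) \<le> 9 * real (card (words (n - 1))) * R"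
    "(\<lambda>s. enstrophy n (U s)) integrable_on {0..t}"
    "integral {0..t} (\<lambda>s. enstrophy n (U s)) \<le> 9 * real (card (words n)) * R"
proof -
  note step = higher_step_component[OF n _ K Kn Ki E0 t, folded R_def]
  have "energy n (U t) \<le> enstrophy (n - 1) (U t)"
    using energy_le_enstrophy_flow[OF t, of "n - 1"] n by simp
  also have "\<dots> \<le> 9 * real (card (words (n - 1))) * R"
    by (rule enstrophy_le, rule step(1)) (use n in auto)
  finally show "energy n (U t) \<le> 9 * real (card (words (n - 1))) * R" .
  have *: "(\<lambda>s. nsq (word_deriv ws (vort (U s) i j))) integrable_on {0..t} \<and>
      integral {0..t} (\<lambda>s. nsq (word_deriv ws (vort (U s) i j))) \<le> R" if l: "length ws = n" for ws i j
  proof (cases ws)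
    case (Cons k vs)
    then have "Suc (length vs) = n" using l by simp
    then show ?thesis unfolding Cons using step(2,3) by blast
  qed (use l n in simp)
  show "(\<lambda>s. enstrophy n (U s)) integrable_on {0..t}"
    "integral {0..t} (\<lambda>s. enstrophy n (U s)) \<le> 9 * real (card (words n)) * R"
    using enstrophy_time_integral[of n U "{0..t}" R] * by blast+
qed

section \<open>The bound for the first derivatives\<close>

lemma lamb_sq_le:
  assumes "t \<in> {0..<T}"
  shows "(lamb (U t) j x)\<^sup>2 \<le> 3 * M\<^sup>2 * (\<Sum>k\<in>UNIV. (vort (U t) k j x)\<^sup>2)"
proof -
  have u2: "(U t k x)\<^sup>2 \<le> M\<^sup>2" for k using U_bound[OF assms, of k x] by (metis abs_ge_zero power2_abs power_mono)
  have three: "(a + b + c)\<^sup>2 \<le> 3 * (a\<^sup>2 + b\<^sup>2 + c\<^sup>2)" for a b c :: real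
  proof -
    have "0 \<le> (a - b)\<^sup>2 + (b - c)\<^sup>2 + (a - c)\<^sup>2" by simp
    then show ?thesis by (simp add: power2_eq_square algebra_simps)
  qed
  have "(lamb (U t) j x)\<^sup>2 \<le> 3 * (\<Sum>k\<in>UNIV. (U t k x * vort (U t) k j x)\<^sup>2)"
    unfolding lamb_def sum_3 by (rule three)
  also have "\<dots> \<le> 3 * (\<Sum>k\<in>UNIV. M\<^sup>2 * (vort (U t) k j x)\<^sup>2)"
    unfolding power_mult_distrib by (intro mult_left_mono sum_mono mult_right_mono u2) auto
  finally show ?thesis by (simp add: sum_distrib_left mult.assoc)
qed

text \<open>The constant part of the cut-off error: the outer 960 is 120 * 8, and 960
  \<open>cutoff_const\<close>^2 is the reciprocal of the parameter with which
  \<open>cutoff_vorticity_bound\<close> is applied.\<close>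

definition first_const :: real where
  "first_const = 960 * cutoff_const\<^sup>2 * M\<^sup>2 * (16 * cutoff_const\<^sup>2 + 960 * cutoff_const\<^sup>2)"

text \<open>With c the cut-off and C the bound on its scaled gradient, the squared gradient of c^2
  is at most 4 C^2 c^2 / R^2 in each direction. The factor c^2 that it keeps is the weight in
  \<open>cutoff_vorticity_bound\<close>. The number 120 is 10 * 3 * 4: the constant of the energy
  inequality, three directions, and this 4. Half of the dissipation is spent on absorbing the
  error.\<close>

lemma first_rate_component:
  assumes s: "0 < s" "s < T" and R: "R = real (Suc m)"
  shows "weighted_rate (\<lambda>x. (cutoff R x)\<^sup>2) [] i j s
    \<le> 8 * (\<integral>x. (cutoff R x) ^ 4 * (lamb (U s) i x)\<^sup>2 \<partial>lborel) + 8 * (\<integral>x. (cutoff R x) ^ 4 * (lamb (U s) j x)\<^sup>2 \<partial>lborel)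
      + first_const - (1/2) * (\<integral>x. (cutoff R x) ^ 4 * (\<Sum>k\<in>UNIV. (partial k (vort (U s) i j) x)\<^sup>2) \<partial>lborel)"
proof -
  let ?c = "cutoff R" and ?A = "vort (U s) i j"
  let ?p = "\<lambda>x. (?c x)\<^sup>2"
  let ?G = "\<lambda>j. lamb (U s) j"
  let ?S = "\<lambda>x. \<Sum>k\<in>UNIV. (partial k ?A x)\<^sup>2"
  define C where "C = cutoff_const"
  have C: "1 \<le> C" unfolding C_def by (rule cutoff_const(1))
  have sI: "s \<in> {0..<T}" using s by simp
  have R1: "1 \<le> R" using R by simp
  have cs: "compactly_supported ?c" and sc: "smooth ?c"
    using R by (auto intro: compactly_supported_cutoff smooth_cutoff)
  have sp: "smooth ?p" "compactly_supported ?p" by (intro smooth_intros compactly_supported_power cs; simp)+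
  note sU = U_slice_smooth[OF sI]
  have sv: "smooth ?A" by (intro smooth_vort sU)
  have sG: "smooth (?G j)" for j by (intro smooth_lamb sU)
  have p4: "(?p x)\<^sup>2 = ?c x ^ 4" for x by (simp flip: power_mult)
  have i4: "integrable lborel (\<lambda>x. ?c x ^ 4 * g x)" if "smooth g" for g
    by (intro smooth_compact_integrable smooth_intros sc that compactly_supported_mult1 compactly_supported_power cs) simp
  have i2: "integrable lborel (\<lambda>x. ?c x ^ 2 * g x)" if "smooth g" for g
    by (intro smooth_compact_integrable smooth_intros sc that compactly_supported_mult1 compactly_supported_power cs) simp
  note ints = i4[OF C_infinity_on_power[OF sG, of i 2]] i4[OF C_infinity_on_power[OF sG, of j 2]]
  have iS: "integrable lborel (\<lambda>x. ?c x ^ 4 * ?S x)" by (intro i4 smooth_intros sv)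
  have iA: "integrable lborel (\<lambda>x. ?c x ^ 2 * (?A x)\<^sup>2)" by (intro i2 smooth_intros sv)
  have iL: "integrable lborel (\<lambda>x. (?p x)\<^sup>2 * (4 * (\<Sum>k\<in>UNIV. (flux [] i j s k x)\<^sup>2) - ?S x)
      + 10 * (\<Sum>k\<in>UNIV. (partial k ?p x)\<^sup>2) * (?A x)\<^sup>2)"
    by (intro smooth_compact_integrable smooth_intros sv sc flux_smooth[OF sI] compactly_supported_add)
      (intro compactly_supported_mult1 compactly_supported_mult2 compactly_supported_sum compactly_supported_power compactly_supported_partial cs; simp)+
  have iR: "integrable lborel (\<lambda>x. (8 * (?c x ^ 4 * (?G i x)\<^sup>2) + 8 * (?c x ^ 4 * (?G j x)\<^sup>2)
      + (120 * C\<^sup>2 / R\<^sup>2) * (?c x ^ 2 * (?A x)\<^sup>2)) - ?c x ^ 4 * ?S x)"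
    by (intro Bochner_Integration.integrable_add Bochner_Integration.integrable_diff integrable_mult_right ints iS iA)
  have pw: "(?p x)\<^sup>2 * (4 * (\<Sum>k\<in>UNIV. (flux [] i j s k x)\<^sup>2) - ?S x) + 10 * (\<Sum>k\<in>UNIV. (partial k ?p x)\<^sup>2) * (?A x)\<^sup>2
      \<le> (8 * (?c x ^ 4 * (?G i x)\<^sup>2) + 8 * (?c x ^ 4 * (?G j x)\<^sup>2) + (120 * C\<^sup>2 / R\<^sup>2) * (?c x ^ 2 * (?A x)\<^sup>2)) - ?c x ^ 4 * ?S x" for x
  proof -
    let ?F = "\<Sum>k\<in>UNIV. (flux [] i j s k x)\<^sup>2"
    have "?c x ^ 4 * (4 * ?F) \<le> ?c x ^ 4 * (8 * (?G i x)\<^sup>2 + 8 * (?G j x)\<^sup>2)"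
      using flux_sq_le[of "[]" i j s x] by (intro mult_left_mono) auto
    then have 1: "?c x ^ 4 * (4 * ?F) \<le> 8 * (?c x ^ 4 * (?G i x)\<^sup>2) + 8 * (?c x ^ 4 * (?G j x)\<^sup>2)"
      by (simp add: algebra_simps)
    have "(partial k ?p x)\<^sup>2 \<le> 4 * C\<^sup>2 / R\<^sup>2 * ?c x ^ 2" for k
    proof -
      have "\<bar>partial k ?c x\<bar> \<le> C / R" unfolding C_def using cutoff_const(2) R1 by simp
      then have "(partial k ?c x)\<^sup>2 \<le> (C / R)\<^sup>2" by (metis abs_ge_zero power2_abs power_mono)
      then have "(2 * ?c x)\<^sup>2 * (partial k ?c x)\<^sup>2 \<le> (2 * ?c x)\<^sup>2 * (C / R)\<^sup>2" by (intro mult_left_mono) auto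
      moreover have "partial k ?p x = 2 * ?c x * partial k ?c x" using partial_power[OF sc, of k 2] by simp
      ultimately show ?thesis by (simp add: power_mult_distrib power_divide mult_ac)
    qed
    then have "(\<Sum>k\<in>UNIV. (partial k ?p x)\<^sup>2) \<le> (\<Sum>k\<in>(UNIV::3 set). 4 * C\<^sup>2 / R\<^sup>2 * ?c x ^ 2)"
      by (intro sum_mono)
    then have "(\<Sum>k\<in>UNIV. (partial k ?p x)\<^sup>2) * (10 * (?A x)\<^sup>2) \<le> (12 * C\<^sup>2 / R\<^sup>2 * ?c x ^ 2) * (10 * (?A x)\<^sup>2)"
      by (intro mult_right_mono) auto
    then have 2: "10 * (\<Sum>k\<in>UNIV. (partial k ?p x)\<^sup>2) * (?A x)\<^sup>2 \<le> (120 * C\<^sup>2 / R\<^sup>2) * (?c x ^ 2 * (?A x)\<^sup>2)"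
      by (simp add: mult_ac)
    show ?thesis unfolding p4 right_diff_distrib using 1 2 by linarith
  qed
  have loc: "(120 * C\<^sup>2 / R\<^sup>2) * (\<integral>x. ?c x ^ 2 * (?A x)\<^sup>2 \<partial>lborel) \<le> first_const + (1/2) * (\<integral>x. ?c x ^ 4 * ?S x \<partial>lborel)"
  proof -
    \<comment> \<open>Makes the share of the dissipation consumed, (120 C^2 / R^2) * 4 e R^2 = 480
      C^2 e, exactly one half.\<close>
    define e where "e = 1 / (960 * C\<^sup>2)"
    have C2: "0 < C\<^sup>2" using C by simp
    have e: "0 < e" unfolding e_def using C2 by simp
    have "(\<integral>x. ?c x ^ 2 * (?A x)\<^sup>2 \<partial>lborel) \<le> 8 * R * (M\<^sup>2 * (16 * C\<^sup>2 + 1 / e))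
        + 4 * e * R\<^sup>2 * (\<integral>x. ?c x ^ 4 * ?S x \<partial>lborel)"
      unfolding C_def
      by (rule cutoff_vorticity_bound[OF sv sU sU _ U_bound[OF sI] U_bound[OF sI] R1 e]) (simp add: vort_def)
    then have "(120 * C\<^sup>2 / R\<^sup>2) * (\<integral>x. ?c x ^ 2 * (?A x)\<^sup>2 \<partial>lborel)
        \<le> (120 * C\<^sup>2 / R\<^sup>2) * (8 * R * (M\<^sup>2 * (16 * C\<^sup>2 + 1 / e)) + 4 * e * R\<^sup>2 * (\<integral>x. ?c x ^ 4 * ?S x \<partial>lborel))"
      by (intro mult_left_mono) auto
    also have "\<dots> = (960 * C\<^sup>2 * M\<^sup>2 * (16 * C\<^sup>2 + 1 / e)) / R + 480 * C\<^sup>2 * e * (\<integral>x. ?c x ^ 4 * ?S x \<partial>lborel)"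
      using R1 by (simp add: power2_eq_square field_simps)
    also have "480 * C\<^sup>2 * e = 1/2" unfolding e_def using C2 by simp
    also have "1 / e = 960 * C\<^sup>2" unfolding e_def by simp
    also have "(960 * C\<^sup>2 * M\<^sup>2 * (16 * C\<^sup>2 + 960 * C\<^sup>2)) / R \<le> first_const"
    proof -
      have "0 \<le> first_const" unfolding first_const_def by simp
      then have "first_const / R \<le> first_const" using R1 mult_left_mono[OF R1, of first_const] by (simp add: divide_le_eq)
      then show ?thesis unfolding first_const_def C_def .
    qed
    finally show ?thesis by simp
  qed
  have "weighted_rate ?p [] i j s \<le> (\<integral>x. (?p x)\<^sup>2 * (4 * (\<Sum>k\<in>UNIV. (flux [] i j s k x)\<^sup>2) - ?S x)
      + 10 * (\<Sum>k\<in>UNIV. (partial k ?p x)\<^sup>2) * (?A x)\<^sup>2 \<partial>lborel)"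
    using weighted_rate_le[OF sp s, of "[]" i j] by simp
  also have "\<dots> \<le> (\<integral>x. (8 * (?c x ^ 4 * (?G i x)\<^sup>2) + 8 * (?c x ^ 4 * (?G j x)\<^sup>2)
      + (120 * C\<^sup>2 / R\<^sup>2) * (?c x ^ 2 * (?A x)\<^sup>2)) - ?c x ^ 4 * ?S x \<partial>lborel)"
    by (rule integral_mono[OF iL iR pw])
  also have "\<dots> = 8 * (\<integral>x. ?c x ^ 4 * (?G i x)\<^sup>2 \<partial>lborel) + 8 * (\<integral>x. ?c x ^ 4 * (?G j x)\<^sup>2 \<partial>lborel)
      + (120 * C\<^sup>2 / R\<^sup>2) * (\<integral>x. ?c x ^ 2 * (?A x)\<^sup>2 \<partial>lborel) - (\<integral>x. ?c x ^ 4 * ?S x \<partial>lborel)"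
    using ints iS iA by (simp only: Bochner_Integration.integral_add Bochner_Integration.integral_diff
        Bochner_Integration.integrable_add integrable_mult_right integral_mult_right_zero)
  finally show ?thesis using loc by linarith
qed

text \<open>The Lamb vector couples the entries of the vorticity, so Gronwall's inequality is
  applied to the sum over i and j. Summing 8 g_i + 8 g_j over nine pairs gives 48 times the sum of
  g, and \<open>lamb_sq_le\<close> contributes 3 M^2, whence 144 M^2. The outer 2 in
  \<open>R\<close> undoes the one half before the dissipation.\<close>

lemma first_step:
  assumes E0: "energy 1 (U 0) \<le> E0" and t: "t \<in> {0..<T}"
  defines "R \<equiv> 2 * (exp (144 * M\<^sup>2 * T) * (4 * E0 + 9 * first_const * T))"
  shows "energy 1 (U t) \<le> 9 * R" "(\<lambda>s. enstrophy 1 (U s)) integrable_on {0..t}"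
    "integral {0..t} (\<lambda>s. enstrophy 1 (U s)) \<le> 9 * real (card (words 1)) * R"
proof -
  let ?c = "\<lambda>m x. cutoff (real (Suc m)) x"
  define Y where "Y i j m s = (\<integral>x. ?c m x ^ 4 * (vort (U s) i j x)\<^sup>2 \<partial>lborel)" for i j m s
  define d where "d k i j m s = (\<integral>x. ?c m x ^ 4 * (partial k (vort (U s) i j) x)\<^sup>2 \<partial>lborel)" for k i j m s
  define y where "y m s = (\<Sum>i\<in>UNIV. \<Sum>j\<in>UNIV. Y i j m s)" for m s
  define z where "z m s = (1/2) * (\<Sum>i\<in>UNIV. \<Sum>j\<in>UNIV. \<Sum>k\<in>UNIV. d k i j m s)" for m s
  have c: "smooth (?c m)" "compactly_supported (?c m)" for m
    by (rule smooth_cutoff) (rule compactly_supported_cutoff, simp)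
  have c2: "smooth (\<lambda>x. ?c m x ^ 2)" "compactly_supported (\<lambda>x. ?c m x ^ 2)" for m
    by (rule C_infinity_on_power[OF c(1)]) (rule compactly_supported_power[OF c(2)], simp)
  have c4: "smooth (\<lambda>x. ?c m x ^ 4)" "compactly_supported (\<lambda>x. ?c m x ^ 4)" for m
    by (rule C_infinity_on_power[OF c(1)]) (rule compactly_supported_power[OF c(2)], simp)
  have p4: "((?c m x)\<^sup>2)\<^sup>2 = ?c m x ^ 4" for m x by (simp flip: power_mult)
  have T0: "0 \<in> {0..<T}" using T_pos by simp
  have contY: "continuous_on {0..t} (Y i j m)" for i j m
    unfolding Y_def using weighted_square_continuous[OF c4 vort_smooth[of "[]"]] t by simp
  have contd: "continuous_on {0..t} (d k i j m)" for k i j m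
    unfolding d_def using weighted_square_continuous[OF c4 vort_smooth[of "[k]"]] t by simp
  have Yn: "0 \<le> Y i j m s" for i j m s unfolding Y_def by simp
  have dn: "0 \<le> d k i j m s" for k i j m s unfolding d_def by simp
  have zn: "0 \<le> z m s" for m s unfolding z_def by (simp add: sum_nonneg dn)
  have yn: "0 \<le> y m s" for m s unfolding y_def by (simp add: sum_nonneg Yn)
  have contz: "continuous_on {0..t} (z m)" for m unfolding z_def by (intro continuous_intros contd)
  have fc: "0 \<le> first_const" unfolding first_const_def by simp
  have key: "y m t + integral {0..t} (z m) \<le> exp (144 * M\<^sup>2 * T) * (y m 0 + 9 * first_const * T)" for m
  proof (rule gronwall_with_dissipation[where y' = "\<lambda>s. \<Sum>i\<in>UNIV. \<Sum>j\<in>UNIV. weighted_rate (\<lambda>x. (?c m x)\<^sup>2) [] i j s"])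
    show "continuous_on {0..t} (y m)" unfolding y_def by (intro continuous_intros contY)
    show "(y m has_vector_derivative (\<Sum>i\<in>UNIV. \<Sum>j\<in>UNIV. weighted_rate (\<lambda>x. (?c m x)\<^sup>2) [] i j s)) (at s)"
      if "0 < s" "s < t" for s
      unfolding y_def
    proof (intro has_vector_derivative_sum)
      fix i j
      show "(Y i j m has_vector_derivative weighted_rate (\<lambda>x. (?c m x)\<^sup>2) [] i j s) (at s)"
        using weighted_derivative_at[OF c2, of s m "[]" i j] that t unfolding Y_def p4 by simp
    qed
    show "(\<Sum>i\<in>UNIV. \<Sum>j\<in>UNIV. weighted_rate (\<lambda>x. (?c m x)\<^sup>2) [] i j s) \<le> 144 * M\<^sup>2 * y m s - z m s + 9 * first_const"
      if s: "0 < s" "s < t" for s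
    proof -
      have sT: "0 < s" "s < T" and sI: "s \<in> {0..<T}" using s t by auto
      define g where "g j = (\<integral>x. ?c m x ^ 4 * (lamb (U s) j x)\<^sup>2 \<partial>lborel)" for j
      note sU = U_slice_smooth[OF sI]
      have iV: "integrable lborel (\<lambda>x. ?c m x ^ 4 * (vort (U s) k j x)\<^sup>2)" for k j
        by (intro weighted_square_integrable c4 smooth_vort sU)
      have iD: "integrable lborel (\<lambda>x. ?c m x ^ 4 * (partial k (vort (U s) i j) x)\<^sup>2)" for k i j
        by (intro weighted_square_integrable c4 smooth_partial smooth_vort sU)
      have g: "g j \<le> 3 * M\<^sup>2 * (\<Sum>k\<in>UNIV. Y k j m s)" for j
      proof -
        have iW: "integrable lborel (\<lambda>x. 3 * M\<^sup>2 * (\<Sum>k\<in>UNIV. ?c m x ^ 4 * (vort (U s) k j x)\<^sup>2))"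
          by (intro integrable_mult_right Bochner_Integration.integrable_sum iV)
        have "g j \<le> (\<integral>x. 3 * M\<^sup>2 * (\<Sum>k\<in>UNIV. ?c m x ^ 4 * (vort (U s) k j x)\<^sup>2) \<partial>lborel)"
          unfolding g_def
        proof (rule integral_mono[OF weighted_square_integrable[OF c4 smooth_lamb[OF sU]] iW])
          fix x
          have "?c m x ^ 4 * (lamb (U s) j x)\<^sup>2 \<le> ?c m x ^ 4 * (3 * M\<^sup>2 * (\<Sum>k\<in>UNIV. (vort (U s) k j x)\<^sup>2))"
            by (intro mult_left_mono lamb_sq_le[OF sI]) auto
          then show "?c m x ^ 4 * (lamb (U s) j x)\<^sup>2 \<le> 3 * M\<^sup>2 * (\<Sum>k\<in>UNIV. ?c m x ^ 4 * (vort (U s) k j x)\<^sup>2)"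
            by (simp add: sum_distrib_left mult_ac)
        qed
        also have "\<dots> = 3 * M\<^sup>2 * (\<Sum>k\<in>UNIV. Y k j m s)"
          unfolding Y_def integral_mult_right_zero
          by (subst Bochner_Integration.integral_sum) (rule iV, rule refl)
        finally show ?thesis .
      qed
      have comp: "weighted_rate (\<lambda>x. (?c m x)\<^sup>2) [] i j s \<le> 8 * g i + 8 * g j + first_const - (1/2) * (\<Sum>k\<in>UNIV. d k i j m s)" for i j
      proof -
        have "(\<integral>x. ?c m x ^ 4 * (\<Sum>k\<in>UNIV. (partial k (vort (U s) i j) x)\<^sup>2) \<partial>lborel) = (\<Sum>k\<in>UNIV. d k i j m s)"
          unfolding d_def sum_distrib_left by (rule Bochner_Integration.integral_sum) (rule iD)
        then show ?thesis using first_rate_component[OF sT refl, of m i j] unfolding g_def by simp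
      qed
      have "(\<Sum>i\<in>UNIV. \<Sum>j\<in>UNIV. weighted_rate (\<lambda>x. (?c m x)\<^sup>2) [] i j s)
          \<le> (\<Sum>i\<in>UNIV. \<Sum>j\<in>UNIV. 8 * g i + 8 * g j + first_const - (1/2) * (\<Sum>k\<in>UNIV. d k i j m s))"
        by (intro sum_mono comp)
      also have "\<dots> = 48 * (\<Sum>j\<in>UNIV. g j) + 9 * first_const - z m s"
        unfolding z_def by (simp add: sum_subtractf sum.distrib sum_3 algebra_simps)
      also have "(\<Sum>j\<in>UNIV. g j) \<le> (\<Sum>j\<in>UNIV. 3 * M\<^sup>2 * (\<Sum>k\<in>UNIV. Y k j m s))" by (intro sum_mono g)
      also have "(\<Sum>j\<in>UNIV. 3 * M\<^sup>2 * (\<Sum>k\<in>UNIV. Y k j m s)) = 3 * M\<^sup>2 * y m s"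
      proof -
        have "(\<Sum>j\<in>UNIV. \<Sum>k\<in>UNIV. Y k j m s) = y m s" unfolding y_def by (rule sum.swap)
        then show ?thesis by (simp flip: sum_distrib_left)
      qed
      finally show ?thesis by simp
    qed
    show "z m integrable_on {0..t}" by (intro integrable_continuous_interval contz)
  qed (use t zn yn fc in auto)
  have y0: "y m 0 \<le> 4 * E0" for m
  proof -
    have "y m 0 \<le> (\<Sum>i\<in>UNIV. \<Sum>j\<in>UNIV. nsq (vort (U 0) i j))"
      unfolding y_def Y_def using cutoff_weight_le_nsq[OF vort_sq[OF T0, of "[]"]] by (intro sum_mono) simp
    also have "\<dots> = enstrophy 0 (U 0)" by (simp add: enstrophy_def words_def)
    also have "\<dots> \<le> 4 * energy 1 (U 0)" using enstrophy_le_energy_flow[OF T0, of 0] by simp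
    finally show ?thesis using E0 by simp
  qed
  have bound: "y m t + integral {0..t} (z m) \<le> R / 2" for m
  proof -
    have "exp (144 * M\<^sup>2 * T) * (y m 0 + 9 * first_const * T) \<le> R / 2"
      unfolding R_def using y0[of m] by (simp add: mult_left_mono)
    then show ?thesis using key[of m] by linarith
  qed
  have zi: "0 \<le> integral {0..t} (z m)" for m
    by (intro integral_nonneg integrable_continuous_interval contz zn)
  have R0: "0 \<le> R" using bound[of 0] yn[of 0 t] zi[of 0] by linarith
  have nv: "nsq (vort (U t) i j) \<le> R" for i j
  proof (rule nsq_le_if_cutoff_bounded[where p = 4])
    show "sq_integrable (vort (U t) i j)" using vort_sq[OF t, of "[]"] by simp
    show "(\<integral>x. ?c m x ^ 4 * (vort (U t) i j x)\<^sup>2 \<partial>lborel) \<le> R" for m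
    proof -
      have "Y i j m t \<le> (\<Sum>j\<in>UNIV. Y i j m t)" by (rule member_le_sum) (auto simp: Yn)
      also have "\<dots> \<le> y m t" unfolding y_def
        by (rule member_le_sum[of i UNIV "\<lambda>i. \<Sum>j\<in>UNIV. Y i j m t"]) (auto simp: Yn sum_nonneg)
      finally show ?thesis using bound[of m] zi[of m] R0 unfolding Y_def by linarith
    qed
  qed
  have "energy 1 (U t) \<le> enstrophy 0 (U t)" using energy_le_enstrophy_flow[OF t, of 0] by simp
  also have "\<dots> \<le> 9 * real (card (words 0)) * R" by (rule enstrophy_le) (use nv in simp)
  finally show "energy 1 (U t) \<le> 9 * R" by (simp add: words_def)
  have *: "(\<lambda>s. nsq (word_deriv ws (vort (U s) i j))) integrable_on {0..t} \<and>
      integral {0..t} (\<lambda>s. nsq (word_deriv ws (vort (U s) i j))) \<le> R" if l: "length ws = 1" for ws i j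
  proof -
    obtain k where k: "ws = [k]" using l by (metis One_nat_def length_0_conv length_Suc_conv)
    have di: "integral {0..t} (\<lambda>s. \<integral>x. ?c m x ^ 4 * (word_deriv ws (vort (U s) i j) x)\<^sup>2 \<partial>lborel) \<le> R" for m
    proof -
      have "d k i j m s \<le> 2 * z m s" for s
      proof -
        have "d k i j m s \<le> (\<Sum>k\<in>UNIV. d k i j m s)" by (rule member_le_sum) (auto simp: dn)
        also have "\<dots> \<le> (\<Sum>j\<in>UNIV. \<Sum>k\<in>UNIV. d k i j m s)"
          by (rule member_le_sum[of j UNIV "\<lambda>j. \<Sum>k\<in>UNIV. d k i j m s"]) (auto simp: dn sum_nonneg)
        also have "\<dots> \<le> (\<Sum>i\<in>UNIV. \<Sum>j\<in>UNIV. \<Sum>k\<in>UNIV. d k i j m s)"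
          by (rule member_le_sum[of i UNIV "\<lambda>i. \<Sum>j\<in>UNIV. \<Sum>k\<in>UNIV. d k i j m s"]) (auto simp: dn sum_nonneg)
        finally show ?thesis by (simp add: z_def)
      qed
      then have "integral {0..t} (d k i j m) \<le> integral {0..t} (\<lambda>s. 2 * z m s)"
        by (intro integral_le integrable_continuous_interval contd continuous_intros contz)
      then show ?thesis using bound[of m] yn[of m t] unfolding d_def k by simp
    qed
    show ?thesis
      using nsq_time_integral_bound[OF vort_smooth t _ vort_sq di] by simp
  qed
  show "(\<lambda>s. enstrophy 1 (U s)) integrable_on {0..t}"
    "integral {0..t} (\<lambda>s. enstrophy 1 (U s)) \<le> 9 * real (card (words 1)) * R"
    using enstrophy_time_integral[of 1 U "{0..t}" R] * by blast+
qed

end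

section \<open>The uniform bounds\<close>

text \<open>\<open>K\<close> is quantified before \<open>U\<close> and \<open>q\<close>: this is the
  claim that it depends on n, T, M and E0 alone. Integrability and the integral bound of
  \<open>enstrophy n\<close> belong to the induction hypothesis because the next order consumes
  them.\<close>

lemma flow_bound:
  assumes "1 \<le> n"
  shows "\<exists>K\<ge>0. \<forall>U q. bounded_flow T M U q \<longrightarrow> (\<forall>m. 1 \<le> m \<and> m \<le> n \<longrightarrow> energy m (U 0) \<le> E0) \<longrightarrow>
    (\<forall>t\<in>{0..<T}. (\<forall>m. 1 \<le> m \<and> m \<le> n \<longrightarrow> energy m (U t) \<le> K) \<and>
      (\<lambda>s. enstrophy n (U s)) integrable_on {0..t} \<and> integral {0..t} (\<lambda>s. enstrophy n (U s)) \<le> K)"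
  using assms
proof (induction n rule: dec_induct)
  case base
  define R where "R = 2 * (exp (144 * M\<^sup>2 * T) * (4 * E0 + 9 * bounded_flow.first_const M * T))"
  \<comment> \<open>Absolute values keep \<open>K\<close> nonnegative also for parameters that
    belong to no flow, such as a negative \<open>E0\<close>.\<close>
  define K where "K = \<bar>9 * R\<bar> + \<bar>9 * real (card (words 1)) * R\<bar>"
  have K: "9 * R \<le> K" "9 * real (card (words 1)) * R \<le> K" unfolding K_def by linarith+
  have "energy m (U t) \<le> K \<and> (\<lambda>s. enstrophy 1 (U s)) integrable_on {0..t} \<and> integral {0..t} (\<lambda>s. enstrophy 1 (U s)) \<le> K"
    if f: "bounded_flow T M U q" and e: "\<forall>m. 1 \<le> m \<and> m \<le> 1 \<longrightarrow> energy m (U 0) \<le> E0"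
      and t: "t \<in> {0..<T}" and m: "1 \<le> m" "m \<le> 1" for U q t m
  proof -
    have "m = 1" using m by simp
    have "energy 1 (U 0) \<le> E0" using e by simp
    note s = bounded_flow.first_step[OF f this t, folded R_def]
    show ?thesis unfolding \<open>m = 1\<close> using s K by linarith
  qed
  moreover have "0 \<le> K" unfolding K_def by simp
  ultimately show ?case by (intro exI[of _ K]) blast
next
  case (step n)
  then obtain K where K: "0 \<le> K" and IH: "\<And>U q t. bounded_flow T M U q \<Longrightarrow>
      (\<forall>m. 1 \<le> m \<and> m \<le> n \<longrightarrow> energy m (U 0) \<le> E0) \<Longrightarrow> t \<in> {0..<T} \<Longrightarrow>
      (\<forall>m. 1 \<le> m \<and> m \<le> n \<longrightarrow> energy m (U t) \<le> K) \<and>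
      (\<lambda>s. enstrophy n (U s)) integrable_on {0..t} \<and> integral {0..t} (\<lambda>s. enstrophy n (U s)) \<le> K"
    by blast
  define R where "R = 4 * E0 + (640 * 4 ^ Suc n * product_const M K + 30 * cutoff_const\<^sup>2) * (T + K)"
  define K' where "K' = K + \<bar>9 * real (card (words n)) * R\<bar> + \<bar>9 * real (card (words (Suc n))) * R\<bar>"
  have K': "9 * real (card (words n)) * R \<le> K'" "9 * real (card (words (Suc n))) * R \<le> K'" "K \<le> K'" "0 \<le> K'"
    unfolding K'_def using K by linarith+
  have "energy m (U t) \<le> K' \<and> (\<lambda>s. enstrophy (Suc n) (U s)) integrable_on {0..t} \<and> integral {0..t} (\<lambda>s. enstrophy (Suc n) (U s)) \<le> K'"
    if f: "bounded_flow T M U q" and e: "\<forall>m. 1 \<le> m \<and> m \<le> Suc n \<longrightarrow> energy m (U 0) \<le> E0"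
      and t: "t \<in> {0..<T}" and m: "1 \<le> m" "m \<le> Suc n" for U q t m
  proof -
    have e': "\<forall>m. 1 \<le> m \<and> m \<le> n \<longrightarrow> energy m (U 0) \<le> E0" using e by auto
    note ih = IH[OF f e']
    have n2: "2 \<le> Suc n" using step.hyps by simp
    have Kn: "energy l (U t) \<le> K" if "t \<in> {0..<T}" "1 \<le> l" "l < Suc n" for t l
      using ih[OF that(1)] that by auto
    have Ki: "(\<lambda>s. enstrophy (Suc n - 1) (U s)) integrable_on {0..t}"
      "integral {0..t} (\<lambda>s. enstrophy (Suc n - 1) (U s)) \<le> K" if "t \<in> {0..<T}" for t
      using ih[OF that] by auto
    have E: "energy (Suc n) (U 0) \<le> E0" using e by simp
    have s: "energy (Suc n) (U t) \<le> 9 * real (card (words (Suc n - 1))) * R"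
      "(\<lambda>s. enstrophy (Suc n) (U s)) integrable_on {0..t}"
      "integral {0..t} (\<lambda>s. enstrophy (Suc n) (U s)) \<le> 9 * real (card (words (Suc n))) * R"
      unfolding R_def by (rule bounded_flow.higher_step[OF f n2 K Kn Ki E t]; assumption)+
    have "energy m (U t) \<le> K'"
    proof (cases "m = Suc n")
      case True
      then show ?thesis using s(1) K' by simp
    next
      case False
      then show ?thesis using Kn[OF t m(1)] m K' by simp
    qed
    then show ?thesis using s K' by linarith
  qed
  moreover have "1 \<le> Suc n" by simp
  ultimately show ?case using K'(4) order_refl[of "1 :: nat"] by (intro exI[of _ K']) blast
qed

section \<open>Multi-indices, Lebesgue measure and the initial state\<close>

lemma Dm_component:
  fixes v :: "real^3 \<Rightarrow> real^3"
  assumes "smooth v"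
  shows "Dm \<alpha> v x $ j = Dm \<alpha> (\<lambda>x. v x $ j) x"
  unfolding Dm_eq_word_deriv word_deriv_component[OF assms] ..

lemma mlen_Dm_word: "length (replicate (\<alpha> $ 3) 3 @ replicate (\<alpha> $ 2) 2 @ replicate (\<alpha> $ 1) (1::3)) = mlen \<alpha>"
  by (simp add: mlen_def sum_3)

lemma smooth_Dm: "smooth g \<Longrightarrow> smooth (Dm \<alpha> g)"
  unfolding Dm_eq_word_deriv by (rule smooth_word_deriv)

lemma finite_mlen_le: "finite {\<alpha>. mlen \<alpha> \<le> n}"
proof -
  have "inj (\<lambda>\<alpha>::multi_index. (\<alpha> $ 1, \<alpha> $ 2, \<alpha> $ 3))"
    by (auto simp: inj_def vec_eq_iff forall_3)
  moreover have "(\<lambda>\<alpha>::multi_index. (\<alpha> $ 1, \<alpha> $ 2, \<alpha> $ 3)) ` {\<alpha>. mlen \<alpha> \<le> n} \<subseteq> {..n} \<times> {..n} \<times> {..n}"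
    by (auto simp: mlen_def sum_3)
  ultimately show ?thesis
    by (meson finite_SigmaI finite_atMost finite_subset finite_imageD inj_on_subset subset_UNIV)
qed

lemma integral_lebesgue_lborel:
  "(g :: real^3 \<Rightarrow> real) \<in> borel_measurable borel \<Longrightarrow> (\<integral>x. g x \<partial>lebesgue) = (\<integral>x. g x \<partial>lborel)"
  by (rule integral_completion) simp

lemma integrable_lebesgue_lborel:
  "(g :: real^3 \<Rightarrow> real) \<in> borel_measurable borel \<Longrightarrow> integrable lebesgue g \<longleftrightarrow> integrable lborel g"
  by (rule integrable_completion) simp

lemma L2_imp_sq_integrable:
  "(g :: real^3 \<Rightarrow> real) \<in> borel_measurable borel \<Longrightarrow> L2 g \<Longrightarrow> sq_integrable g"
  unfolding L2_def sq_integrable_def using integrable_lebesgue_lborel[of "\<lambda>x. (g x)\<^sup>2"] by simp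

lemma integral_by_parts_word:
  fixes g \<psi> :: "real^3 \<Rightarrow> real"
  assumes "smooth g" "smooth \<psi>" "compactly_supported \<psi>"
  shows "(\<integral>x. g x * word_deriv ws \<psi> x \<partial>lborel) = (- 1) ^ length ws * (\<integral>x. word_deriv ws g x * \<psi> x \<partial>lborel)"
  using assms(2,3)
proof (induction ws arbitrary: \<psi>)
  case (Cons i ws)
  let ?G = "word_deriv ws g"
  have sG: "smooth ?G" by (rule smooth_word_deriv[OF assms(1)])
  note sp = Cons.prems(1) smooth_partial[OF Cons.prems(1)]
  note cp = Cons.prems(2) compactly_supported_partial[OF Cons.prems(2)]
  have z: "(\<integral>x. partial i (\<lambda>x. ?G x * \<psi> x) x \<partial>lborel) = 0"
    by (intro integral_partial_eq_0_compact smooth_intros sG sp compactly_supported_mult2 cp)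
  have p: "partial i (\<lambda>x. ?G x * \<psi> x) = (\<lambda>x. partial i ?G x * \<psi> x + ?G x * partial i \<psi> x)"
    by (rule partial_mult[OF sG sp(1)])
  have "integrable lborel (\<lambda>x. partial i ?G x * \<psi> x)" "integrable lborel (\<lambda>x. ?G x * partial i \<psi> x)"
    by (intro smooth_compact_integrable smooth_intros sG sp compactly_supported_mult2 cp)+
  then have "(\<integral>x. ?G x * partial i \<psi> x \<partial>lborel) = - (\<integral>x. partial i ?G x * \<psi> x \<partial>lborel)"
    using z unfolding p by simp
  then show ?case
    using Cons.IH[OF sp(2) cp(2)] by (simp add: partial_word_deriv assms(1))
qed simp

text \<open>Testing the weak derivative with a cut-off of the classical one bounds the latter without
  identifying the two almost everywhere.\<close>

lemma nsq_Dm_le_weak: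
  assumes g: "smooth g" "sq_integrable (Dm \<alpha> g)" and f: "L2 f" "AE x in lebesgue. g x = f x"
    and h: "is_weak_D \<alpha> f h"
  shows "nsq (Dm \<alpha> g) \<le> (\<integral>x. (h x)\<^sup>2 \<partial>lebesgue)"
proof (rule nsq_le_if_cutoff_bounded[OF g(2), where p = 1])
  fix m
  let ?c = "cutoff (real (Suc m))" and ?D = "Dm \<alpha> g"
  let ?\<psi> = "\<lambda>x. ?c x * ?D x"
  have sD: "smooth ?D" by (rule smooth_Dm[OF g(1)])
  have cc: "compactly_supported ?c" by (rule compactly_supported_cutoff) simp
  have \<psi>: "smooth ?\<psi>" "compactly_supported ?\<psi>" by (intro smooth_intros sD compactly_supported_mult1 cc)+
  have "test_function ?\<psi>"
  proof -
    obtain R where "\<forall>x. R < norm x \<longrightarrow> ?\<psi> x = 0" using \<psi>(2) unfolding compactly_supported_def by blast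
    then have "{x. ?\<psi> x \<noteq> 0} \<subseteq> cball 0 R" by (auto simp: not_less[symmetric])
    then have "bounded {x. ?\<psi> x \<noteq> 0}" using bounded_cball bounded_subset by blast
    then show ?thesis unfolding test_function_def using \<psi>(1) compact_closure by blast
  qed
  then have w: "(\<integral>x. f x * Dm \<alpha> ?\<psi> x \<partial>lebesgue) = (- 1) ^ mlen \<alpha> * (\<integral>x. h x * ?\<psi> x \<partial>lebesgue)"
    using h unfolding is_weak_D_def by blast
  have sDp: "smooth (Dm \<alpha> ?\<psi>)" by (rule smooth_Dm[OF \<psi>(1)])
  have meas: "F \<in> borel_measurable lebesgue" if "smooth F" for F :: "real^3 \<Rightarrow> real"
    using smooth_borel_measurable[OF that] by (simp add: measurable_completion)
  have "(\<integral>x. f x * Dm \<alpha> ?\<psi> x \<partial>lebesgue) = (\<integral>x. g x * Dm \<alpha> ?\<psi> x \<partial>lebesgue)"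
    by (rule integral_cong_AE) (use f meas[OF sDp] meas[OF g(1)] in \<open>auto simp: L2_def\<close>)
  also have "\<dots> = (\<integral>x. g x * Dm \<alpha> ?\<psi> x \<partial>lborel)"
    by (intro integral_lebesgue_lborel smooth_borel_measurable smooth_intros g sDp)
  also have "\<dots> = (- 1) ^ mlen \<alpha> * (\<integral>x. ?D x * ?\<psi> x \<partial>lborel)"
    unfolding Dm_eq_word_deriv[of \<alpha>] mlen_Dm_word[symmetric]
    by (rule integral_by_parts_word[OF g(1) \<psi>[unfolded Dm_eq_word_deriv]])
  finally have e: "(\<integral>x. ?D x * ?\<psi> x \<partial>lborel) = (\<integral>x. h x * ?\<psi> x \<partial>lebesgue)"
    using w by simp
  let ?X = "\<integral>x. ?c x * (?D x)\<^sup>2 \<partial>lborel"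
  have X1: "?X = (\<integral>x. h x * ?\<psi> x \<partial>lebesgue)" using e by (simp add: power2_eq_square mult_ac)
  have X2: "?X = (\<integral>x. ?c x * (?D x)\<^sup>2 \<partial>lebesgue)"
    by (intro integral_lebesgue_lborel[symmetric] smooth_borel_measurable smooth_intros sD)
  have iX: "integrable lebesgue (\<lambda>x. ?c x * (?D x)\<^sup>2)"
    by (subst integrable_lebesgue_lborel)
      (intro smooth_borel_measurable smooth_compact_integrable smooth_intros sD compactly_supported_mult1 cc)+
  have "integrable lebesgue (\<lambda>x. (?\<psi> x)\<^sup>2)"
    by (subst integrable_lebesgue_lborel)
      (intro smooth_borel_measurable smooth_compact_integrable smooth_intros sD compactly_supported_power compactly_supported_mult1 cc; simp)+
  then have ih: "integrable lebesgue (\<lambda>x. h x * ?\<psi> x)" and ih2: "integrable lebesgue (\<lambda>x. (h x)\<^sup>2)"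
    using integrable_product[of h lebesgue ?\<psi>] h meas[OF \<psi>(1)] unfolding is_weak_D_def L2_def by auto
  \<comment> \<open>Young's inequality and c^2 <= c, for the cut-off c, bound twice
    \<open>?X\<close> by the integral of h^2 plus \<open>?X\<close>; as \<open>?X\<close> is finite,
    one copy can be subtracted.\<close>
  have "2 * ?X = (\<integral>x. 2 * (h x * ?\<psi> x) \<partial>lebesgue)" unfolding X1 by simp
  also have "\<dots> \<le> (\<integral>x. (h x)\<^sup>2 + ?c x * (?D x)\<^sup>2 \<partial>lebesgue)"
  proof (rule integral_mono)
    fix x
    have "2 * (h x * ?\<psi> x) \<le> (h x)\<^sup>2 + (?\<psi> x)\<^sup>2" using sum_squares_bound[of "h x" "?\<psi> x"] by simp
    moreover have "(?\<psi> x)\<^sup>2 = ?c x * (?c x * (?D x)\<^sup>2)" by (simp add: power2_eq_square mult_ac)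
    moreover have "?c x * (?c x * (?D x)\<^sup>2) \<le> 1 * (?c x * (?D x)\<^sup>2)"
      by (intro mult_right_mono cutoff_le_1 mult_nonneg_nonneg cutoff_nonneg) auto
    ultimately show "2 * (h x * ?\<psi> x) \<le> (h x)\<^sup>2 + ?c x * (?D x)\<^sup>2" by linarith
  qed (use ih ih2 iX in auto)
  also have "\<dots> = (\<integral>x. (h x)\<^sup>2 \<partial>lebesgue) + ?X" unfolding X2 by (rule Bochner_Integration.integral_add[OF ih2 iX])
  finally show "(\<integral>x. ?c x ^ 1 * (?D x)\<^sup>2 \<partial>lborel) \<le> (\<integral>x. (h x)\<^sup>2 \<partial>lebesgue)" by simp
qed

lemma weak_D_sq_le_H_norm:
  assumes "mlen \<alpha> \<le> n"
  shows "(\<integral>x. (weak_D \<alpha> (\<lambda>y. f y $ j) x)\<^sup>2 \<partial>lebesgue) \<le> (H_norm n f)\<^sup>2"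
proof -
  let ?w = "\<lambda>\<alpha> j. \<integral>x. (weak_D \<alpha> (\<lambda>y. f y $ j) x)\<^sup>2 \<partial>lebesgue"
  have e: "L2_norm_sq (\<lambda>x. \<chi> i. weak_D \<alpha> (\<lambda>y. f y $ i) x) = (\<Sum>j\<in>UNIV. ?w \<alpha> j)" for \<alpha>
    by (simp add: L2_norm_sq_def)
  have "?w \<alpha> j \<le> (\<Sum>j\<in>UNIV. ?w \<alpha> j)" by (rule member_le_sum) auto
  also have "\<dots> \<le> (\<Sum>\<alpha> | mlen \<alpha> \<le> n. \<Sum>j\<in>UNIV. ?w \<alpha> j)"
    by (rule member_le_sum[of \<alpha> _ "\<lambda>\<alpha>. \<Sum>j\<in>UNIV. ?w \<alpha> j"]) (use assms finite_mlen_le in \<open>auto intro: sum_nonneg\<close>)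
  also have "\<dots> = (H_norm n f)\<^sup>2"
    unfolding H_norm_def e by (subst real_sqrt_pow2) (auto intro!: sum_nonneg)
  finally show ?thesis .
qed

lemma J_le_energy:
  assumes v: "smooth v" and K: "energy n (\<lambda>j x. v x $ j) \<le> K"
  shows "J n v \<le> sqrt (3 * real (card {\<alpha>. mlen \<alpha> = n}) * K)"
proof -
  have "L2_norm_sq (Dm \<alpha> v) \<le> 3 * K" if "mlen \<alpha> = n" for \<alpha>
  proof -
    have "(\<integral>x. \<bar>Dm \<alpha> v x $ j\<bar>\<^sup>2 \<partial>lebesgue) \<le> K" for j
    proof -
      have s: "smooth (Dm \<alpha> (\<lambda>x. v x $ j))" by (intro smooth_Dm smooth_component v)
      have "(\<integral>x. \<bar>Dm \<alpha> v x $ j\<bar>\<^sup>2 \<partial>lebesgue) = nsq (Dm \<alpha> (\<lambda>x. v x $ j))"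
        unfolding Dm_component[OF v] nsq_def power2_abs
        by (intro integral_lebesgue_lborel smooth_borel_measurable smooth_intros s)
      also have "\<dots> \<le> energy n (\<lambda>j x. v x $ j)"
        unfolding Dm_eq_word_deriv that[symmetric] mlen_Dm_word[symmetric]
        by (rule nsq_le_energy[where u = "\<lambda>j x. v x $ j"])
      finally show ?thesis using K by simp
    qed
    then have "L2_norm_sq (Dm \<alpha> v) \<le> (\<Sum>j\<in>(UNIV::3 set). K)" unfolding L2_norm_sq_def by (intro sum_mono)
    then show ?thesis by simp
  qed
  then have "(\<Sum>\<alpha> | mlen \<alpha> = n. L2_norm_sq (Dm \<alpha> v)) \<le> (\<Sum>\<alpha> | mlen \<alpha> = n. 3 * K)" by (intro sum_mono) simp
  then show ?thesis unfolding J_def by (simp add: mult_ac)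
qed

section \<open>Navier-Stokes solutions as bounded flows\<close>

lemma component_le_max_norm: "ereal \<bar>v x $ i\<bar> \<le> max_norm v"
  unfolding max_norm_def by (rule SUP_upper2[OF UNIV_I]) (rule SUP_upper[OF UNIV_I])

lemma at_within_time_interval:
  fixes t T :: real
  assumes "0 < t" "t < T" "{0..<T} \<subseteq> I"
  shows "at t within I = at t"
proof (rule at_within_interior)
  have "{0<..<T} \<subseteq> I" using assms(3) by auto
  then have "{0<..<T} \<subseteq> interior I" by (rule interior_maximal) (rule open_greaterThanLessThan)
  then show "t \<in> interior I" using assms by auto
qed

text \<open>Restricts the solution to \<open>{0..<T}\<close> and splits it into scalar components;
  adding |u|^2 / 2 to the pressure leaves the Lamb vector of the convection term.\<close>

lemma NS_solution_bounded_flow: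
  assumes sol: "NS_solution f Tf u p" and T: "0 < T" "ereal T \<le> Tf"
    and M: "(SUP t\<in>{0..<T}. max_norm (u t)) = ereal M"
  shows "bounded_flow T M (\<lambda>t j x. u t x $ j) (\<lambda>t x. p t x + (1/2) * (\<Sum>k\<in>UNIV. (u t x $ k)\<^sup>2))"
proof -
  have sub: "{0..<T} \<subseteq> time_interval Tf"
    unfolding time_interval_def using T(2) by (auto intro!: less_le_trans[OF _ T(2)])
  have u: "spacetime_smooth T u" and p: "spacetime_smooth T p"
    using sol sub unfolding NS_solution_def by (auto intro: C_infinity_on_subset)
  have su: "smooth (u t)" and sp: "smooth (p t)" if "t \<in> {0..<T}" for t
    by (rule spacetime_slice[OF u that], rule spacetime_slice[OF p that])
  note sc = smooth_component[OF su]
  show ?thesis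
  proof
    show "0 < T" by fact
    show us: "spacetime_smooth T (\<lambda>t x. u t x $ j)" for j
      using C_infinity_on_linear[OF bounded_linear_vec_nth u, of j] by (simp add: case_prod_beta')
    show "smooth (\<lambda>x. p t x + (1/2) * (\<Sum>k\<in>UNIV. (u t x $ k)\<^sup>2))" if "t \<in> {0..<T}" for t
      by (intro smooth_intros sp sc that)
    show "(\<Sum>i\<in>UNIV. partial i (\<lambda>x. u t x $ i) x) = 0" if t: "t \<in> {0..<T}" for t x
    proof -
      have "divergence (u t) x = 0" using sol t sub unfolding NS_solution_def by blast
      then show ?thesis unfolding divergence_def partial_component[OF su[OF t]] .
    qed
    show "H_infinity (\<lambda>x. u t x $ j)" if t: "t \<in> {0..<T}" for t j
      unfolding H_infinity_def
    proof (intro conjI allI)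
      show "smooth (\<lambda>x. u t x $ j)" by (rule sc[OF t])
      fix ws
      obtain \<alpha> where "word_deriv ws (\<lambda>x. u t x $ j) = Dm \<alpha> (\<lambda>x. u t x $ j)"
        using word_deriv_eq_Dm[OF sc[OF t]] by blast
      moreover have "L2 (\<lambda>x. Dm \<alpha> (u t) x $ j)" using sol t sub unfolding NS_solution_def by blast
      ultimately show "sq_integrable (word_deriv ws (\<lambda>x. u t x $ j))"
        using L2_imp_sq_integrable[OF smooth_borel_measurable[OF smooth_Dm[OF sc[OF t]]]]
        by (simp add: Dm_component[OF su[OF t]])
    qed
    show "\<bar>u t x $ j\<bar> \<le> M" if t: "t \<in> {0..<T}" for t j x
    proof -
      have "ereal \<bar>u t x $ j\<bar> \<le> max_norm (u t)" by (rule component_le_max_norm)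
      also have "\<dots> \<le> ereal M" unfolding M[symmetric] by (rule SUP_upper[OF t])
      finally show ?thesis by simp
    qed
    show "time_deriv T (\<lambda>s x. u s x $ j) t x = (\<Sum>k\<in>UNIV. partial k (partial k (\<lambda>x. u t x $ j)) x)
        - lamb (\<lambda>j x. u t x $ j) j x - partial j (\<lambda>x. p t x + (1/2) * (\<Sum>k\<in>UNIV. (u t x $ k)\<^sup>2)) x"
      if t: "0 < t" "t < T" for t j x
    proof -
      have tI: "t \<in> {0..<T}" using t by simp
      obtain D where "((\<lambda>(t, x). u t x) has_derivative D) (at (t, x) within {0..<T} \<times> UNIV)"
        using C_infinity_on_imp_differentiable[OF u] tI by (metis SigmaI UNIV_I)
      from spacetime_slice_derivatives(2)[OF this tI]
      obtain d where d: "((\<lambda>s. u s x) has_vector_derivative d) (at t within {0..<T})" by blast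
      \<comment> \<open>At an interior time the derivatives within \<open>{0..<T}\<close> and within
        the interval of existence are both the two-sided one, so the equation carries over to the
        shorter interval.\<close>
      have d': "((\<lambda>s. u s x) has_vector_derivative d) (at t)"
        using d at_within_time_interval[OF t order_refl] by simp
      have eq: "d + advect (u t) (u t) x + grad (p t) x = laplacian (u t) x"
        using sol tI sub vector_derivative_at[OF d'] at_within_time_interval[OF t sub]
        unfolding NS_solution_def by (metis subsetD)
      have "((\<lambda>s. u s x $ j) has_vector_derivative d $ j) (at t within {0..<T})"
        using bounded_linear.has_vector_derivative[OF bounded_linear_vec_nth d] .
      then have td: "time_deriv T (\<lambda>s x. u s x $ j) t x = d $ j" by (rule time_derivI[OF tI])
      note s = sc[OF tI] sp[OF tI]
      have lap: "laplacian (u t) x $ j = (\<Sum>k\<in>UNIV. partial k (partial k (\<lambda>x. u t x $ j)) x)"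
        unfolding laplacian_def sum_component
        by (simp add: partial_component su[OF tI] smooth_partial)
      have adv: "advect (u t) (u t) x $ j = (\<Sum>k\<in>UNIV. u t x $ k * partial k (\<lambda>x. u t x $ j) x)"
        unfolding advect_def sum_component by (simp add: partial_component su[OF tI])
      have dq: "partial j (\<lambda>x. p t x + (1/2) * (\<Sum>k\<in>UNIV. (u t x $ k)\<^sup>2)) x
          = partial j (p t) x + (\<Sum>k\<in>UNIV. u t x $ k * partial j (\<lambda>x. u t x $ k) x)"
      proof -
        have "partial j (\<lambda>x. p t x + (1/2) * (\<Sum>k\<in>UNIV. (u t x $ k)\<^sup>2))
            = (\<lambda>x. partial j (p t) x + partial j (\<lambda>x. (1/2) * (\<Sum>k\<in>UNIV. (u t x $ k)\<^sup>2)) x)"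
          by (rule partial_add) (intro smooth_intros s)+
        moreover have "partial j (\<lambda>x. (1/2) * (\<Sum>k\<in>UNIV. (u t x $ k)\<^sup>2))
            = (\<lambda>x. partial j (\<lambda>x. 1/2) x * (\<Sum>k\<in>UNIV. (u t x $ k)\<^sup>2) + (1/2) * partial j (\<lambda>x. \<Sum>k\<in>UNIV. (u t x $ k)\<^sup>2) x)"
          by (rule partial_mult) (intro smooth_intros s)+
        moreover have "partial j (\<lambda>x. \<Sum>k\<in>UNIV. (u t x $ k)\<^sup>2) = (\<lambda>x. \<Sum>k\<in>UNIV. partial j (\<lambda>x. (u t x $ k)\<^sup>2) x)"
          by (rule partial_sum) (intro smooth_intros s)
        ultimately show ?thesis by (simp add: partial_power s partial_const sum_distrib_left mult.assoc)
      qed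
      have lb: "lamb (\<lambda>j x. u t x $ j) j x = (\<Sum>k\<in>UNIV. u t x $ k * partial k (\<lambda>x. u t x $ j) x)
          - (\<Sum>k\<in>UNIV. u t x $ k * partial j (\<lambda>x. u t x $ k) x)"
        by (simp add: lamb_def vort_def right_diff_distrib sum_subtractf)
      have "d $ j + advect (u t) (u t) x $ j + partial j (p t) x = laplacian (u t) x $ j"
        using arg_cong[OF eq, of "\<lambda>v. v $ j"] by (simp add: grad_def)
      then show ?thesis unfolding td dq lb lap adv by simp
    qed
  qed
qed

lemma initial_energy_le:
  assumes f: "\<And>n. in_H n f" and sol: "NS_solution f Tf u p"
    and flow: "bounded_flow T M (\<lambda>t j x. u t x $ j) q" and m: "m \<le> n"
  shows "energy m (\<lambda>j x. u 0 x $ j) \<le> 3 * real (card (words m)) * (H_norm n f)\<^sup>2"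
proof -
  have T0: "0 \<in> {0..<T}" using bounded_flow.T_pos[OF flow] by simp
  have H: "H_infinity (\<lambda>x. u 0 x $ j)" for j using bounded_flow.U_H[OF flow T0] .
  have "nsq (word_deriv ws (\<lambda>x. u 0 x $ j)) \<le> (H_norm n f)\<^sup>2" if ws: "length ws = m" for ws j
  proof -
    obtain \<alpha> where \<alpha>: "mlen \<alpha> = m" "word_deriv ws (\<lambda>x. u 0 x $ j) = Dm \<alpha> (\<lambda>x. u 0 x $ j)"
      using word_deriv_eq_Dm[OF H_infinity_smooth[OF H]] ws by blast
    \<comment> \<open>\<open>weak_D\<close> is a choice and becomes a weak derivative only through
      existence, which membership in H^m supplies.\<close>
    have "\<exists>h. is_weak_D \<alpha> (\<lambda>x. f x $ j) h" using f[of m] \<alpha>(1) unfolding in_H_def by auto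
    then have w: "is_weak_D \<alpha> (\<lambda>x. f x $ j) (weak_D \<alpha> (\<lambda>x. f x $ j))" unfolding weak_D_def by (rule someI_ex)
    have "AE x in lebesgue. u 0 x = f x" using sol unfolding NS_solution_def by blast
    then have ae: "AE x in lebesgue. u 0 x $ j = f x $ j" by eventually_elim simp
    have "nsq (Dm \<alpha> (\<lambda>x. u 0 x $ j)) \<le> (\<integral>x. (weak_D \<alpha> (\<lambda>x. f x $ j) x)\<^sup>2 \<partial>lebesgue)"
    proof (rule nsq_Dm_le_weak[OF H_infinity_smooth[OF H] _ _ ae w])
      show "sq_integrable (Dm \<alpha> (\<lambda>x. u 0 x $ j))" using H_infinity_sq_integrable[OF H, of ws j] \<alpha>(2) by simp
      show "L2 (\<lambda>x. f x $ j)" using f[of 0] unfolding in_H_def by blast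
    qed
    also have "\<dots> \<le> (H_norm n f)\<^sup>2" by (rule weak_D_sq_le_H_norm) (use \<alpha> m in simp)
    finally show ?thesis using \<alpha>(2) by simp
  qed
  then have "energy m (\<lambda>j x. u 0 x $ j) \<le> (\<Sum>ws\<in>words m. \<Sum>j\<in>(UNIV::3 set). (H_norm n f)\<^sup>2)"
    unfolding energy_def by (intro sum_mono) (simp add: words_def)
  then show ?thesis by simp
qed

text \<open>Isolates what one number \<open>K\<close> must achieve for all solutions sharing the
  numbers n, M, T and H. Choosing a \<open>K\<close> for each such quadruple produces the bounding
  function and thereby its dependence on these numbers only.\<close>

definition admissible_bound :: "nat \<Rightarrow> real \<Rightarrow> real \<Rightarrow> real \<Rightarrow> real \<Rightarrow> bool" where
  "admissible_bound n M T H K \<longleftrightarrow> 0 < K \<and> (\<forall>f Tf u p. (\<forall>n. in_H n f) \<longrightarrow> NS_solution f Tf u p \<longrightarrow>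
    0 < T \<longrightarrow> ereal T \<le> Tf \<longrightarrow> (SUP t\<in>{0..<T}. max_norm (u t)) = ereal M \<longrightarrow> H_norm n f = H \<longrightarrow>
    (\<forall>t\<in>{0..<T}. J n (u t) \<le> K))"

lemma admissible_bound_exists:
  assumes "1 \<le> n" shows "\<exists>K. admissible_bound n M T H K"
proof -
  define E0 where "E0 = (\<Sum>m\<le>n. 3 * real (card (words m)) * H\<^sup>2)"
  obtain K where K: "0 \<le> K" "\<And>U q t. bounded_flow T M U q \<Longrightarrow> (\<forall>m. 1 \<le> m \<and> m \<le> n \<longrightarrow> energy m (U 0) \<le> E0) \<Longrightarrow>
      t \<in> {0..<T} \<Longrightarrow> energy n (U t) \<le> K"
    using flow_bound[OF assms, of T M E0] assms by blast
  \<comment> \<open>The added 1 makes the bound strictly positive.\<close>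
  define K' where "K' = sqrt (3 * real (card {\<alpha>. mlen \<alpha> = n}) * K) + 1"
  have "J n (u t) \<le> K'" if f: "\<forall>n. in_H n f" and sol: "NS_solution f Tf u p" and T: "0 < T" "ereal T \<le> Tf"
    and M: "(SUP t\<in>{0..<T}. max_norm (u t)) = ereal M" and H: "H_norm n f = H" and t: "t \<in> {0..<T}" for f Tf u p t
  proof -
    note flow = NS_solution_bounded_flow[OF sol T M]
    have "energy m (\<lambda>j x. u 0 x $ j) \<le> E0" if "m \<le> n" for m
    proof -
      have "energy m (\<lambda>j x. u 0 x $ j) \<le> 3 * real (card (words m)) * H\<^sup>2"
        using initial_energy_le[OF _ sol flow that] f H by blast
      also have "\<dots> \<le> E0" unfolding E0_def
        by (rule member_le_sum[of m "{..n}" "\<lambda>m. 3 * real (card (words m)) * H\<^sup>2"]) (use that in auto)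
      finally show ?thesis .
    qed
    then have e: "energy n (\<lambda>j x. u t x $ j) \<le> K" using K(2)[OF flow _ t] by blast
    have "smooth (u t)"
    proof (rule spacetime_slice[OF _ t])
      have "{0..<T} \<times> UNIV \<subseteq> time_interval Tf \<times> (UNIV :: (real^3) set)"
        unfolding time_interval_def using T(2) by (auto intro!: less_le_trans[OF _ T(2)])
      then show "spacetime_smooth T u"
        using sol C_infinity_on_subset unfolding NS_solution_def by blast
    qed
    then show ?thesis using J_le_energy[OF _ e] unfolding K'_def by fastforce
  qed
  moreover have "0 < K'" unfolding K'_def using K(1) by (simp add: add_nonneg_pos)
  ultimately show ?thesis unfolding admissible_bound_def by blast
qed

theorem theorem2p2:
  "\<exists>K :: nat \<Rightarrow> real \<Rightarrow> real \<Rightarrow> real \<Rightarrow> real.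
     \<forall>(f :: real^3 \<Rightarrow> real^3) (u :: real \<Rightarrow> real^3 \<Rightarrow> real^3) (p :: real \<Rightarrow> real^3 \<Rightarrow> real)
      (Tf :: ereal) (T :: real) (M :: real).
       (\<forall>n. in_H n f) \<longrightarrow>
       weakly_div_free f \<longrightarrow>
       maximal_NS_solution f Tf u p \<longrightarrow>
       0 < T \<longrightarrow>
       ereal T \<le> Tf \<longrightarrow>
       (SUP t\<in>{0..<T}. max_norm (u t)) = ereal M \<longrightarrow>
       (\<forall>n\<ge>1. 0 < K n M T (H_norm n f) \<and>
               (\<forall>t\<in>{0..<T}. J n (u t) \<le> K n M T (H_norm n f)))"
proof -
  define K where "K n M T H = (SOME K. admissible_bound n M T H K)" for n M T H
  have "admissible_bound n M T H (K n M T H)" if "1 \<le> n" for n M T H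
    unfolding K_def by (rule someI_ex) (rule admissible_bound_exists[OF that])
  then show ?thesis
    unfolding admissible_bound_def maximal_NS_solution_def by (intro exI[of _ K]) blast
qed

end
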